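(* Let $\lambda>0$ and let $\Xi=\bigcup_{i\ge1}(\Xi_i+X_i)$ be the stationary Poisson grain model in $\mathbb{R}^d$, $d\ge1$, with intensity $\lambda$ and compact typical grain $\Xi_0$, and assume that $M(a):=\mathsf{E}\exp\{a|\Xi_0|\}<\infty$ for some $a>0$. Let $(W_n)_{n\ge1}$ be a convex averaging sequence in $\mathbb{R}^d$. Put $$H(a):=\frac{8\lambda M(a)\,(1+\exp\{\lambda\mathsf{E}|\Xi_0|\})}{a^2},\qquad \Delta(a):=\frac{8(a+\lambda M(a))\,(1+\exp\{\lambda\mathsf{E}|\Xi_0|\})}{a^2}.$$ Then for every $k\ge2$ $$\int_{(\mathbb{R}^d)^{k-1}}\bigl|c_\Xi^{(k)}(o,x_2,\dots,x_k)\bigr|\,d(x_2,\dots,x_k)\le (k-1)!\,H(a)\,\Delta(a)^{k-2}.$$ Furthermore, the limit $L(z)=\lim_{n\to\infty}L_n(z)$ exists and is analytic on the open disk $D_{\Delta(a)}=\{z\in\mathbb{C}:|z|<1/\Delta(a)\}$, where $L_n(z)=|W_n|^{-1}\log\mathsf{E}\exp\{z|\Xi\cap W_n|\}$.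
   Context: $|\cdot|$ denotes $d$-dimensional Lebesgue measure (and the modulus for complex numbers), $o$ the origin of $\mathbb{R}^d$. Poisson grain model (PGM, Boolean model): $\Pi_\lambda=\sum_{i\ge1}\delta_{X_i}$ is a stationary Poisson process on $\mathbb{R}^d$ with intensity $\lambda>0$; $\Xi_0$ (the typical grain) is a random compact set, i.e. a measurable map into the space $\mathcal{K}$ of non-empty compact subsets of $\mathbb{R}^d$ with the Borel $\sigma$-field of the Hausdorff metric; $\Xi_1,\Xi_2,\dots$ are independent copies of $\Xi_0$, independent of $\Pi_\lambda$; and $\Xi:=\bigcup_{i\ge1}(\Xi_i+X_i)$. ($\Xi$ need not be closed.) The underlying probability space $[\Omega,\mathfrak{A},\mathsf{P}]$ is chosen such that $(x,\omega)\mapsto\mathbf{1}_{\Xi(\omega)}(x)$ is jointly measurable. Mixed cumulant of random variables $Y_1,\dots,Y_k$ with finite $k$-th moments: $\Gamma(Y_1,\dots,Y_k):=i^{-k}\frac{\partial^k}{\partial s_1\cdots\partial s_k}\log\mathsf{E}\exp\{i\sum_{j=1}^k s_jY_j\}\big|_{s_1=\cdots=s_k=0}$. With $\xi(x)=\mathbf{1}_\Xi(x)$, put $c_\Xi^{(k)}(x_1,\dots,x_k):=\Gamma(\xi(x_1),\dots,\xi(x_k))$. A convex averaging sequence $(W_n)_{n\ge1}$ is a non-decreasing sequence of (deterministic) compact convex sets in $\mathbb{R}^d$ with $\bigcup_n W_n=\mathbb{R}^d$ (with $|W_n|>0$). In $L_n(z)$, $\log$ denotes the branch vanishing at $z=0$.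 *)

theory Defs
  imports "HOL-Probability.Probability" "HOL-Complex_Analysis.Complex_Analysis"
begin

section \<open>Random compact sets\<close>

definition compacts :: "'a::euclidean_space set set"
  where "compacts = {K. compact K \<and> K \<noteq> {}}"

text \<open>The value 0 off \<^const>\<open>compacts\<close> is junk; the locale \<^locale>\<open>Metric_space\<close> requires
  non-negativity on the whole type.\<close>

definition hausdorff_dist :: "'a::euclidean_space set \<Rightarrow> 'a set \<Rightarrow> real"
  where "hausdorff_dist A B =
    (if A \<in> compacts \<and> B \<in> compacts
     then max (SUP x\<in>A. infdist x B) (SUP y\<in>B. infdist y A) else 0)"

lemma hausdorff_dist_le_iff:
  assumes A: "A \<in> compacts" and B: "B \<in> compacts"
  shows "hausdorff_dist A B \<le> r \<longleftrightarrow> (\<forall>x\<in>A. infdist x B \<le> r) \<and> (\<forall>y\<in>B. infdist y A \<le> r)"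
proof -
  have bdd: "bdd_above ((\<lambda>x. infdist x D) ` C)" if "C \<in> compacts" for C D :: "'a set"
  proof -
    have "compact ((\<lambda>x. infdist x D) ` C)"
      using that by (intro compact_continuous_image continuous_intros) (auto simp: compacts_def)
    then show ?thesis
      by (intro bounded_imp_bdd_above compact_imp_bounded)
  qed
  have "A \<noteq> {}" "B \<noteq> {}"
    using A B by (auto simp: compacts_def)
  then show ?thesis
    using A B by (simp add: hausdorff_dist_def cSUP_le_iff bdd)
qed

lemma Metric_space_hausdorff:
  "Metric_space (compacts :: 'a::euclidean_space set set) hausdorff_dist"
proof
  fix A B :: "'a set"
  show nonneg: "0 \<le> hausdorff_dist A B"
  proof (cases "A \<in> compacts \<and> B \<in> compacts")
    case True
    then obtain x where "x \<in> A" by (auto simp: compacts_def)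
    then have "infdist x B \<le> hausdorff_dist A B"
      using True hausdorff_dist_le_iff[of A B "hausdorff_dist A B"] by auto
    with infdist_nonneg[of x B] show ?thesis by linarith
  qed (auto simp: hausdorff_dist_def)
  show "hausdorff_dist A B = hausdorff_dist B A"
    by (auto simp: hausdorff_dist_def max.commute)
  assume AB: "A \<in> compacts" "B \<in> compacts"
  have "hausdorff_dist A B \<le> 0 \<longleftrightarrow> A = B"
  proof -
    have *: "infdist x D \<le> 0 \<longleftrightarrow> x \<in> D" if "D \<in> compacts" for x and D :: "'a set"
    proof -
      have "closed D" "D \<noteq> {}"
        using that by (auto simp: compacts_def compact_imp_closed)
      then show ?thesis
        using in_closed_iff_infdist_zero[of D x] infdist_nonneg[of x D] by auto
    qed
    show ?thesis
      using hausdorff_dist_le_iff[OF AB, of 0] * AB by auto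
  qed
  with nonneg show "hausdorff_dist A B = 0 \<longleftrightarrow> A = B" by auto
next
  fix A B C :: "'a set"
  assume ABC: "A \<in> compacts" "B \<in> compacts" "C \<in> compacts"
  have *: "infdist x F \<le> hausdorff_dist D E + hausdorff_dist E F"
    if DEF: "D \<in> compacts" "E \<in> compacts" "F \<in> compacts" and x: "x \<in> D"
    for x and D E F :: "'a set"
  proof -
    have "closed E" "E \<noteq> {}"
      using DEF by (auto simp: compacts_def compact_imp_closed)
    then obtain y where y: "y \<in> E" "infdist x E = dist x y"
      using infdist_attains_inf[of E x] by auto
    have "infdist x F \<le> infdist y F + dist x y"
      by (rule infdist_triangle)
    also have "infdist y F \<le> hausdorff_dist E F"
      using hausdorff_dist_le_iff[of E F "hausdorff_dist E F"] DEF y by auto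
    also have "dist x y \<le> hausdorff_dist D E"
      using hausdorff_dist_le_iff[of D E "hausdorff_dist D E"] DEF x y by auto
    finally show ?thesis by simp
  qed
  have comm: "hausdorff_dist D E = hausdorff_dist E D" for D E :: "'a set"
    by (auto simp: hausdorff_dist_def max.commute)
  show "hausdorff_dist A C \<le> hausdorff_dist A B + hausdorff_dist B C"
    using hausdorff_dist_le_iff[of A C] ABC *[of A B C] *[of C B A]
    by (simp add: comm[of C] comm[of B A] add.commute)
qed

definition compacts_borel :: "'a::euclidean_space set measure"
  where "compacts_borel =
    sigma compacts {U. openin (Metric_space.mtopology compacts hausdorff_dist) U}"


section \<open>The Poisson grain model\<close>

text \<open>The number of points \<open>X i\<close> in \<open>B\<close> with multiplicity, i.e. the value of
  \<open>\<Sum>i. \<delta>\<^bsub>X i\<^esub>\<close> on \<open>B\<close>.\<close>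

definition point_count :: "(nat \<Rightarrow> 'w \<Rightarrow> 'a) \<Rightarrow> 'a set \<Rightarrow> 'w \<Rightarrow> ennreal"
  where "point_count X B \<omega> = (\<Sum>i. indicator B (X i \<omega>))"

definition (in prob_space) stationary_poisson_process ::
    "real \<Rightarrow> (nat \<Rightarrow> 'a \<Rightarrow> 'b::euclidean_space) \<Rightarrow> bool"
  where "stationary_poisson_process intensity X \<longleftrightarrow>
    (\<forall>i. random_variable borel (X i)) \<and>
    (\<forall>B\<in>sets borel. bounded B \<longrightarrow>
      (\<forall>n::nat. prob {\<omega> \<in> space M. point_count X B \<omega> = of_nat n} =
        (intensity * measure lborel B) ^ n / fact n * exp (- intensity * measure lborel B))) \<and>
    (\<forall>(I::nat set) B. finite I \<longrightarrow> (\<forall>j\<in>I. B j \<in> sets borel \<and> bounded (B j)) \<longrightarrow>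
      disjoint_family_on B I \<longrightarrow>
      indep_vars (\<lambda>_. borel) (\<lambda>j. point_count X (B j)) I)"

definition grain_union ::
    "(nat \<Rightarrow> 'w \<Rightarrow> 'a::euclidean_space) \<Rightarrow> (nat \<Rightarrow> 'w \<Rightarrow> 'a set) \<Rightarrow> 'w \<Rightarrow> 'a set"
  where "grain_union X Z \<omega> = (\<Union>i. (\<lambda>x. x + X i \<omega>) ` Z i \<omega>)"

text \<open>The typical grain is \<open>Z\<^sub>0\<close>; the points and the grains attached to them are enumerated
  by \<open>X i\<close>, \<open>Z i\<close> with \<open>i\<close> starting at 0. No dependence structure between \<open>Z\<^sub>0\<close> and the
  other variables is assumed, as only its law matters. Independence is required between the
  sequences \<open>X\<close> and \<open>Z\<close>: independence of \<open>Z\<close> from the unordered point process alone would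
  allow enumerations that depend on the grains.\<close>

locale poisson_grain_model = prob_space M
  for M :: "'w measure" +
  fixes intensity :: real
    and X :: "nat \<Rightarrow> 'w \<Rightarrow> 'a::euclidean_space"
    and Z :: "nat \<Rightarrow> 'w \<Rightarrow> 'a set"
    and Z\<^sub>0 :: "'w \<Rightarrow> 'a set"
  assumes intensity_pos: "0 < intensity"
    and points: "stationary_poisson_process intensity X"
    and typical_grain: "random_variable compacts_borel Z\<^sub>0"
    and grains_indep: "indep_vars (\<lambda>_. compacts_borel) Z UNIV"
    and grains_copies: "\<And>i. distr M compacts_borel (Z i) = distr M compacts_borel Z\<^sub>0"
    and points_grains_indep:
      "indep_set
        {(\<lambda>\<omega> i. X i \<omega>) -` A \<inter> space M | A. A \<in> sets (PiM UNIV (\<lambda>_. borel))}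
        {(\<lambda>\<omega> i. Z i \<omega>) -` A \<inter> space M | A. A \<in> sets (PiM UNIV (\<lambda>_. compacts_borel))}"
    and jointly_measurable:
      "(\<lambda>(x, \<omega>). indicator (grain_union X Z \<omega>) x :: real) \<in> borel_measurable (borel \<Otimes>\<^sub>M M)"


section \<open>Mixed cumulants\<close>

definition partial_deriv ::
    "nat \<Rightarrow> ((nat \<Rightarrow> real) \<Rightarrow> complex) \<Rightarrow> (nat \<Rightarrow> real) \<Rightarrow> complex"
  where "partial_deriv j f s = vector_derivative (\<lambda>t. f (s(j := t))) (at (s j))"

text \<open>\<open>mixed_partial k\<close> is \<open>\<partial>\<^sup>k / \<partial>s\<^sub>1 \<dots> \<partial>s\<^sub>k\<close>.\<close>

primrec mixed_partial ::
    "nat \<Rightarrow> ((nat \<Rightarrow> real) \<Rightarrow> complex) \<Rightarrow> (nat \<Rightarrow> real) \<Rightarrow> complex"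
  where
    "mixed_partial 0 f = f"
  | "mixed_partial (Suc k) f = mixed_partial k (partial_deriv (Suc k) f)"

text \<open>The joint characteristic function is 1 at the origin and continuous, so its
  logarithm near the origin is given by the principal branch \<^const>\<open>Ln\<close>.\<close>

definition mixed_cumulant :: "'w measure \<Rightarrow> nat \<Rightarrow> (nat \<Rightarrow> 'w \<Rightarrow> real) \<Rightarrow> complex"
  where "mixed_cumulant M k Y =
    inverse (\<i> ^ k) *
    mixed_partial k
      (\<lambda>s. Ln (\<integral>\<omega>. exp (\<i> * complex_of_real (\<Sum>j=1..k. s j * Y j \<omega>)) \<partial>M)) (\<lambda>_. 0)"

definition set_cumulant ::
    "'w measure \<Rightarrow> ('w \<Rightarrow> 'a set) \<Rightarrow> nat \<Rightarrow> (nat \<Rightarrow> 'a) \<Rightarrow> complex"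
  where "set_cumulant M S k x = mixed_cumulant M k (\<lambda>j \<omega>. indicator (S \<omega>) (x j))"


section \<open>Averaging sequences and logarithms\<close>

definition convex_averaging_sequence :: "(nat \<Rightarrow> 'a::euclidean_space set) \<Rightarrow> bool"
  where "convex_averaging_sequence W \<longleftrightarrow>
    (\<forall>n. compact (W n) \<and> convex (W n) \<and> 0 < measure lborel (W n)) \<and>
    incseq W \<and> (\<Union>n. W n) = UNIV"

text \<open>On a connected open set \<open>D\<close> containing 0 there is at most one such \<open>g\<close> (up to its
  values outside \<open>D\<close>); it exists only if \<open>f\<close> has no zero in \<open>D\<close>.\<close>

definition log_branch_on :: "complex set \<Rightarrow> (complex \<Rightarrow> complex) \<Rightarrow> (complex \<Rightarrow> complex) \<Rightarrow> bool"
  where "log_branch_on D f g \<longleftrightarrow>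
    g holomorphic_on D \<and> g 0 = 0 \<and> (\<forall>z\<in>D. exp (g z) = f z)"

end

theory Submission
  imports Defs
begin

text \<open>Let \<open>\<rho>(J)\<close> be the probability that the grains miss the points \<open>x\<^sub>j\<close>, \<open>j \<in> J\<close>; it equals
  \<open>exp (- Q(\<Union>\<^sub>j A(x\<^sub>j)))\<close>, where \<open>Q\<close> is the intensity measure of the marked process and \<open>A(x)\<close> the set
  of pairs (grain, germ) that cover \<open>x\<close>. The mixed cumulants are, up to sign, the Ursell functions of
  \<open>\<rho>\<close>. Since \<open>\<rho>(a \<union> X \<union> T) / \<rho>(X \<union> T)\<close> is the exponential of a measure, its Moebius transform in \<open>T\<close>
  turns the definition of the Ursell functions into a Kirkwood--Salsburg recursion that removes the
  root \<open>a\<close> and moves a subset of the remaining points to the roots. Expanding the exponential and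
  integrating out the points one factor at a time bounds the integral of the recursion kernel by
  \<open>|S|! z\<^bsup>-|S|\<^esup> (e\<^bsup>g\<^esup> - 1)\<close> with \<open>g = \<lambda> E |\<Xi>\<^sub>0| (e\<^bsup>z|\<Xi>\<^sub>0|\<^esup> - 1)\<close>. For \<open>z = a\<^sup>2 / (4 (a + \<lambda> M(a)))\<close> this gives
  \<open>e\<^bsup>g\<^esup> - 1 \<le> \<lambda> M(a) / (a + \<lambda> M(a))\<close>, and induction along the recursion proves the bound with \<open>4 / z\<close> in
  place of \<open>\<Delta>(a)\<close>; the factor \<open>1 + exp (\<lambda> E |\<Xi>\<^sub>0|) \<ge> 2\<close> absorbs the constants.

  The cumulants of \<open>|\<Xi> \<inter> W|\<close> are integrals of Ursell functions over \<open>W\<close>. The bounds make their generating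
  function converge on the disk, where the relation of moments and cumulants becomes \<open>F' = G' F\<close> and
  hence \<open>F = exp G\<close>. By translation invariance the coefficients divided by \<open>|W|\<close> converge
  along a convex averaging sequence, and Tannery's theorem passes to the limit in the series.\<close>

section \<open>Ursell functions and Moebius transforms\<close>

text \<open>Vacancies are used instead of \<open>\<xi>\<close> because their joint moments are
  exponentials of a measure: \<open>\<rho>(a \<union> X \<union> T) / \<rho>(X \<union> T)\<close>
  is the exponential of minus the mass of the pairs that cover \<open>a\<close> and miss both
  \<open>X\<close> and \<open>T\<close>. Restricting \<open>Q\<close> to the pairs that cover
  \<open>a\<close> and miss \<open>X\<close> leaves a function of \<open>T\<close> alone, and a
  restriction only lowers moments. So the kernel bound depends neither on the number nor on the
  position of the roots. A termwise estimate of the definition of the Ursell functions would fail,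
  since \<open>\<rho>\<close> does not decay and its terms are not integrable one by one.

  The base \<open>4 / z\<close> is forced by the induction: each root costs a factor 2, so a set of
  \<open>c\<close> moved points contributes \<open>(2 / 4) ^ c\<close>. The choice of
  \<open>z\<close> ensures \<open>z \<le> a / 4\<close>, which leaves three quarters of the exponent
  \<open>a |\<Xi>_0|\<close> to absorb \<open>|\<Xi>_0|^2\<close>; in the code \<open>g\<close> is
  the resulting upper bound \<open>2 z \<lambda> M(a) / a^2 \<le> 1 / 2\<close>.

  That the Laplace transform has no zero in the disk is not known beforehand. The candidate for its
  logarithm is built first as a power series, and \<open>exp G = F\<close> then shows that it is a
  branch.\<close>

lemma sum_Pow_Pow:
  fixes g :: "'i set \<Rightarrow> 'i set \<Rightarrow> 'i set \<Rightarrow> 'b::comm_monoid_add"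
  assumes "finite Y"
  shows "(\<Sum>T\<in>Pow Y. \<Sum>S\<in>Pow T. g S (T - S) (Y - T)) =
    (\<Sum>S\<in>Pow Y. \<Sum>T\<in>Pow (Y - S). g S T (Y - S - T))"
proof -
  have fin: "finite T" if "T \<subseteq> Y" for T using that assms finite_subset by auto
  have "(\<Sum>T\<in>Pow Y. \<Sum>S\<in>Pow T. g S (T - S) (Y - T)) =
      (\<Sum>(T, S)\<in>Sigma (Pow Y) Pow. g S (T - S) (Y - T))"
    by (subst sum.Sigma) (auto simp: assms fin)
  also have "\<dots> = (\<Sum>(S, T)\<in>(SIGMA S:Pow Y. Pow (Y - S)). g S T (Y - S - T))"
    by (rule sum.reindex_bij_witness[where i = "\<lambda>(S, T). (S \<union> T, S)" and j = "\<lambda>(T, S). (S, T - S)"])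
      (auto intro!: arg_cong3[where f = g])
  also have "\<dots> = (\<Sum>S\<in>Pow Y. \<Sum>T\<in>Pow (Y - S). g S T (Y - S - T))"
    by (subst sum.Sigma) (auto simp: assms)
  finally show ?thesis .
qed

lemma sum_Pow_insert:
  fixes f :: "'i set \<Rightarrow> 'b::comm_monoid_add"
  assumes "finite Y" "b \<notin> Y"
  shows "(\<Sum>S\<in>Pow (insert b Y). f S) = (\<Sum>S\<in>Pow Y. f S) + (\<Sum>S\<in>Pow Y. f (insert b S))"
proof -
  have "inj_on (insert b) (Pow Y)" using assms by (auto simp: inj_on_def)
  moreover have "Pow Y \<inter> insert b ` Pow Y = {}" using assms by auto
  ultimately show ?thesis
    using assms by (simp add: Pow_insert sum.union_disjoint sum.reindex)
qed

lemma sum_Pow_card: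
  fixes f :: "nat \<Rightarrow> 'b::comm_semiring_1"
  assumes "finite S"
  shows "(\<Sum>C\<in>Pow S. f (card C)) = (\<Sum>c\<le>card S. of_nat (card S choose c) * f c)"
proof -
  have "(\<Sum>C\<in>Pow S. f (card C)) = (\<Sum>c\<le>card S. \<Sum>C\<in>{C \<in> Pow S. card C = c}. f (card C))"
    using assms by (intro sum.group[symmetric]) (auto intro: card_mono)
  also have "\<dots> = (\<Sum>c\<le>card S. of_nat (card S choose c) * f c)"
  proof (rule sum.cong)
    fix c
    have "card {C \<in> Pow S. card C = c} = card S choose c"
      using n_subsets[OF assms, of c] by simp
    then show "(\<Sum>C\<in>{C \<in> Pow S. card C = c}. f (card C)) = of_nat (card S choose c) * f c"
      by simp
  qed simp
  finally show ?thesis .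
qed

text \<open>Passes to the recursive calls below that \<open>S\<close> is a proper subset of
  \<open>Y\<close>, which is what makes the recursion terminate.\<close>

declare sum.cong[fundef_cong]

text \<open>The solution \<open>u\<close> of \<open>\<Sum>\<^bsub>S \<subseteq> Y\<^esub> u(S) r(Y - S) = r(X \<union> Y)\<close>, with the junk value 0 for infinite \<open>Y\<close>.
  For \<open>X = {a}\<close> it is the Ursell function (joint cumulant) of \<open>{a} \<union> Y\<close>, if \<open>r\<close> consists of the
  joint moments.\<close>

function ursell :: "('i set \<Rightarrow> 'b::field) \<Rightarrow> 'i set \<Rightarrow> 'i set \<Rightarrow> 'b" where
  "ursell r X Y = (if finite Y
    then (r (X \<union> Y) - (\<Sum>S\<in>Pow Y - {Y}. ursell r X S * r (Y - S))) / r {} else 0)"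
  by auto
termination
  by (relation "Wellfounded.measure (\<lambda>(r, X, Y). card Y)") (auto intro: psubset_card_mono)

declare ursell.simps[simp del]

lemma sum_Pow_split:
  fixes f :: "'i set \<Rightarrow> 'b::comm_monoid_add"
  assumes "finite Y"
  shows "(\<Sum>S\<in>Pow Y. f S) = f Y + (\<Sum>S\<in>Pow Y - {Y}. f S)"
  using assms by (intro sum.remove) auto

lemma ursell_conv:
  assumes "finite Y" "r {} \<noteq> 0"
  shows "(\<Sum>S\<in>Pow Y. ursell r X S * r (Y - S)) = r (X \<union> Y)"
  using assms by (subst sum_Pow_split, simp, subst ursell.simps, simp)

text \<open>Convolution with \<open>r\<close> is triangular with diagonal entry \<open>r {}\<close>:
  the value at \<open>Y\<close> is determined by the values at proper subsets. The identities for
  \<open>ursell\<close> are therefore proved by convolving the claimed value with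
  \<open>r\<close>.\<close>

lemma conv_unique:
  fixes f g r :: "'i set \<Rightarrow> 'b::field"
  assumes "finite Y" "r {} \<noteq> 0"
    and "\<And>T. T \<subseteq> Y \<Longrightarrow> (\<Sum>S\<in>Pow T. f S * r (T - S)) = (\<Sum>S\<in>Pow T. g S * r (T - S))"
  shows "f Y = g Y"
  using assms(1,3)
proof (induction Y rule: finite_psubset_induct)
  case (psubset Y)
  have "f S = g S" if "S \<in> Pow Y - {Y}" for S
  proof (rule psubset.IH)
    show "S \<subset> Y" using that by auto
    fix T assume "T \<subseteq> S"
    with that have "T \<subseteq> Y" by auto
    then show "(\<Sum>S\<in>Pow T. f S * r (T - S)) = (\<Sum>S\<in>Pow T. g S * r (T - S))"
      by (rule psubset.prems)
  qed
  then have "(\<Sum>S\<in>Pow Y - {Y}. f S * r (Y - S)) = (\<Sum>S\<in>Pow Y - {Y}. g S * r (Y - S))"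
    by (intro sum.cong) auto
  moreover have "f Y * r {} + (\<Sum>S\<in>Pow Y - {Y}. f S * r (Y - S)) =
      g Y * r {} + (\<Sum>S\<in>Pow Y - {Y}. g S * r (Y - S))"
    using psubset.prems[of Y] sum_Pow_split[OF psubset.hyps, of "\<lambda>S. f S * r (Y - S)"]
      sum_Pow_split[OF psubset.hyps, of "\<lambda>S. g S * r (Y - S)"] by simp
  ultimately show ?case
    using assms(2) by simp
qed

lemma ursell_unique:
  fixes f r :: "'i set \<Rightarrow> 'b::field"
  assumes "finite Y" "r {} \<noteq> 0"
    and "\<And>T. T \<subseteq> Y \<Longrightarrow> (\<Sum>S\<in>Pow T. f S * r (T - S)) = r (X \<union> T)"
  shows "ursell r X Y = f Y"
proof (rule conv_unique[where r = r, OF assms(1,2)])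
  fix T assume "T \<subseteq> Y"
  then show "(\<Sum>S\<in>Pow T. ursell r X S * r (T - S)) = (\<Sum>S\<in>Pow T. f S * r (T - S))"
    using assms finite_subset by (subst ursell_conv) auto
qed

text \<open>Without roots the solution is the unit of the convolution. Its vanishing on nonempty
  sets ends the recursion and removes the term \<open>S = {}\<close> when a single root is
  left.\<close>

lemma ursell_empty:
  fixes r :: "'i set \<Rightarrow> 'b::field"
  assumes "finite Y" "r {} \<noteq> 0"
  shows "ursell r {} Y = (if Y = {} then 1 else 0)"
proof (rule ursell_unique[where r = r, OF assms])
  fix T assume "T \<subseteq> Y"
  then have "finite T" using assms finite_subset by auto
  have "(\<Sum>S\<in>Pow T. (if S = {} then 1 else 0) * r (T - S)) = (\<Sum>S\<in>Pow T. if S = {} then r T else 0)"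
    by (intro sum.cong) auto
  also have "\<dots> = r T" using \<open>finite T\<close> by (subst sum.delta) auto
  finally show "(\<Sum>S\<in>Pow T. (if S = {} then 1 else 0) * r (T - S)) = r ({} \<union> T)" by simp
qed

text \<open>The algebraic form of the Kirkwood--Salsburg recursion; \<open>k\<close> plays the role
  of the Moebius transform of
  \<open>T \<mapsto> r (insert a (X \<union> T)) / r (X \<union> T)\<close>. Convolve the right-hand
  side with \<open>r\<close> and use associativity: for fixed \<open>S\<close> the inner sum is the
  defining relation for the roots \<open>X \<union> S\<close>, whose value
  \<open>r (X \<union> T)\<close> no longer depends on \<open>S\<close>.\<close>

lemma ursell_insert:
  fixes k r :: "'i set \<Rightarrow> 'b::field"
  assumes "finite Y" "r {} \<noteq> 0"
    and "\<And>T. T \<subseteq> Y \<Longrightarrow> r (insert a (X \<union> T)) = r (X \<union> T) * (\<Sum>S\<in>Pow T. k S)"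
  shows "ursell r (insert a X) Y = (\<Sum>S\<in>Pow Y. k S * ursell r (X \<union> S) (Y - S))"
proof (rule ursell_unique[where r = r, OF assms(1,2)])
  fix T assume T: "T \<subseteq> Y"
  then have fin: "finite T" using assms finite_subset by auto
  have "(\<Sum>U\<in>Pow T. (\<Sum>S\<in>Pow U. k S * ursell r (X \<union> S) (U - S)) * r (T - U)) =
      (\<Sum>U\<in>Pow T. \<Sum>S\<in>Pow U. k S * ursell r (X \<union> S) (U - S) * r (T - U))"
    by (simp add: sum_distrib_right)
  also have "\<dots> = (\<Sum>S\<in>Pow T. \<Sum>U\<in>Pow (T - S). k S * ursell r (X \<union> S) U * r (T - S - U))"
    by (rule sum_Pow_Pow[OF fin])
  also have "\<dots> = (\<Sum>S\<in>Pow T. k S * r (X \<union> T))"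
  proof (rule sum.cong)
    fix S assume "S \<in> Pow T"
    then have eq: "X \<union> S \<union> (T - S) = X \<union> T" by auto
    have "(\<Sum>U\<in>Pow (T - S). k S * ursell r (X \<union> S) U * r (T - S - U)) =
        k S * (\<Sum>U\<in>Pow (T - S). ursell r (X \<union> S) U * r (T - S - U))"
      by (simp add: sum_distrib_left mult.assoc)
    also have "\<dots> = k S * r (X \<union> S \<union> (T - S))"
      using fin assms by (subst ursell_conv) auto
    finally show "(\<Sum>U\<in>Pow (T - S). k S * ursell r (X \<union> S) U * r (T - S - U)) = k S * r (X \<union> T)"
      unfolding eq .
  qed simp
  also have "\<dots> = r (insert a X \<union> T)"
    using assms(3)[OF T] by (simp add: sum_distrib_right mult.commute)
  finally show "(\<Sum>U\<in>Pow T. (\<Sum>S\<in>Pow U. k S * ursell r (X \<union> S) (U - S)) * r (T - U)) = r (insert a X \<union> T)" .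
qed

text \<open>Joint cumulants are symmetric, although the definition singles out a root. In the
  expansion of \<open>r\<close> at \<open>{a, b} \<union> T\<close> with root \<open>a\<close>, the
  sets that do not contain \<open>b\<close> give a double sum that is symmetric in \<open>a\<close>
  and \<open>b\<close>; hence so is the rest, which is the convolution of
  \<open>S \<mapsto> ursell r {a} (insert b S)\<close> with \<open>r\<close>.\<close>

lemma ursell_commute:
  fixes r :: "'i set \<Rightarrow> 'b::field"
  assumes "finite Y" "r {} \<noteq> 0" "a \<notin> Y" "b \<notin> Y" "a \<noteq> b"
  shows "ursell r {a} (insert b Y) = ursell r {b} (insert a Y)"
proof -
  have eq: "(\<Sum>S\<in>Pow T. ursell r {a} (insert b S) * r (T - S)) =
      r (insert a (insert b T)) -
      (\<Sum>S\<in>Pow T. \<Sum>U\<in>Pow (T - S). ursell r {a} S * ursell r {b} U * r (T - S - U))"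
    if T: "T \<subseteq> Y" and ab: "a \<notin> Y" "b \<notin> Y" "a \<noteq> b" for a b T
  proof -
    have fin: "finite T" "b \<notin> T" using assms T ab finite_subset by auto
    have "r (insert a (insert b T)) = (\<Sum>S\<in>Pow (insert b T). ursell r {a} S * r (insert b T - S))"
      using fin assms by (subst ursell_conv) (auto simp: insert_commute)
    also have "\<dots> = (\<Sum>S\<in>Pow T. ursell r {a} S * r (insert b T - S)) +
       (\<Sum>S\<in>Pow T. ursell r {a} (insert b S) * r (insert b T - insert b S))"
      by (rule sum_Pow_insert[OF fin])
    also have "(\<Sum>S\<in>Pow T. ursell r {a} (insert b S) * r (insert b T - insert b S)) =
        (\<Sum>S\<in>Pow T. ursell r {a} (insert b S) * r (T - S))"
      using fin by (intro sum.cong arg_cong2[where f = "(*)"] arg_cong[where f = r]) auto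
    also have "(\<Sum>S\<in>Pow T. ursell r {a} S * r (insert b T - S)) =
        (\<Sum>S\<in>Pow T. \<Sum>U\<in>Pow (T - S). ursell r {a} S * ursell r {b} U * r (T - S - U))"
    proof (rule sum.cong)
      fix S assume "S \<in> Pow T"
      then have "insert b T - S = {b} \<union> (T - S)" using fin by auto
      then have "r (insert b T - S) = (\<Sum>U\<in>Pow (T - S). ursell r {b} U * r (T - S - U))"
        using fin assms by (subst ursell_conv) auto
      then show "ursell r {a} S * r (insert b T - S) =
         (\<Sum>U\<in>Pow (T - S). ursell r {a} S * ursell r {b} U * r (T - S - U))"
        by (simp add: sum_distrib_left mult.assoc)
    qed simp
    finally show ?thesis by (simp add: algebra_simps)
  qed
  have swap: "(\<Sum>S\<in>Pow T. \<Sum>U\<in>Pow (T - S). f S * g U * r (T - S - U)) =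
      (\<Sum>S\<in>Pow T. \<Sum>U\<in>Pow (T - S). g S * f U * r (T - S - U))" if "T \<subseteq> Y" for f g T
  proof -
    have "finite T" using that assms finite_subset by auto
    have "(\<Sum>S\<in>Pow T. \<Sum>U\<in>Pow (T - S). f S * g U * r (T - S - U)) =
       (\<Sum>(S, U)\<in>(SIGMA S:Pow T. Pow (T - S)). f S * g U * r (T - S - U))"
      using \<open>finite T\<close> by (subst sum.Sigma) auto
    also have "\<dots> = (\<Sum>(S, U)\<in>(SIGMA S:Pow T. Pow (T - S)). g S * f U * r (T - S - U))"
      by (rule sum.reindex_bij_witness[where i = prod.swap and j = prod.swap])
        (auto simp: Diff_eq Int_ac mult.commute)
    also have "\<dots> = (\<Sum>S\<in>Pow T. \<Sum>U\<in>Pow (T - S). g S * f U * r (T - S - U))"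
      using \<open>finite T\<close> by (subst sum.Sigma) auto
    finally show ?thesis .
  qed
  show ?thesis
  proof (rule conv_unique[where r = r and f = "\<lambda>Y. ursell r {a} (insert b Y)"])
    fix T assume T: "T \<subseteq> Y"
    show "(\<Sum>S\<in>Pow T. ursell r {a} (insert b S) * r (T - S)) =
        (\<Sum>S\<in>Pow T. ursell r {b} (insert a S) * r (T - S))"
      using eq[OF T assms(3-5)] eq[OF T assms(4,3)] assms(5)
        swap[OF T, of "ursell r {a}" "ursell r {b}"]
      by (simp add: insert_commute)
  qed (use assms in auto)
qed

lemma ursell_scale:
  fixes r :: "'i set \<Rightarrow> 'b::field"
  assumes "finite X" "finite Y" "X \<inter> Y = {}" "r {} \<noteq> 0"
  shows "ursell (\<lambda>J. c ^ card J * r J) X Y = c ^ (card X + card Y) * ursell r X Y"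
proof (rule ursell_unique[where f = "\<lambda>Y. c ^ (card X + card Y) * ursell r X Y"])
  fix T assume T: "T \<subseteq> Y"
  then have fin: "finite T" using assms finite_subset by auto
  have "(\<Sum>S\<in>Pow T. c ^ (card X + card S) * ursell r X S * (c ^ card (T - S) * r (T - S))) =
      (\<Sum>S\<in>Pow T. c ^ (card X + card T) * (ursell r X S * r (T - S)))"
  proof (rule sum.cong)
    fix S assume "S \<in> Pow T"
    then have "card S + card (T - S) = card T"
      using fin by (metis Diff_partition PowD card_Un_disjoint Diff_disjoint finite_Diff finite_subset)
    then have "c ^ (card X + card T) = c ^ (card X + card S) * c ^ card (T - S)"
      by (simp flip: power_add add: add.assoc)
    then show "c ^ (card X + card S) * ursell r X S * (c ^ card (T - S) * r (T - S)) =
        c ^ (card X + card T) * (ursell r X S * r (T - S))" by simp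
  qed simp
  also have "\<dots> = c ^ (card X + card T) * r (X \<union> T)"
    using fin assms by (simp flip: sum_distrib_left add: ursell_conv)
  also have "card X + card T = card (X \<union> T)"
    using fin assms T by (subst card_Un_disjoint) auto
  finally show "(\<Sum>S\<in>Pow T. c ^ (card X + card S) * ursell r X S * (c ^ card (T - S) * r (T - S))) =
      c ^ card (X \<union> T) * r (X \<union> T)" .
qed (use assms in auto)

lemma ursell_of_real:
  assumes "finite Y" "r {} \<noteq> 0"
  shows "ursell (\<lambda>J. of_real (r J) :: 'b::real_field) X Y = of_real (ursell r X Y)"
proof (rule ursell_unique[where f = "\<lambda>Y. of_real (ursell r X Y)"])
  fix T assume "T \<subseteq> Y"
  then have "finite T" using assms finite_subset by auto
  then show "(\<Sum>S\<in>Pow T. of_real (ursell r X S) * of_real (r (T - S)) :: 'b) = of_real (r (X \<union> T))"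
    using assms by (simp flip: of_real_mult of_real_sum add: ursell_conv)
qed (use assms in auto)

lemma ursell_cong:
  fixes r :: "'i set \<Rightarrow> 'b::field"
  assumes "finite Y" "r {} \<noteq> 0" "\<And>J. J \<subseteq> X \<union> Y \<Longrightarrow> r J = r' J"
  shows "ursell r X Y = ursell r' X Y"
proof (rule ursell_unique[where r = r, OF assms(1,2)])
  fix T assume T: "T \<subseteq> Y"
  then have "finite T" using assms finite_subset by auto
  have "(\<Sum>S\<in>Pow T. ursell r' X S * r (T - S)) = (\<Sum>S\<in>Pow T. ursell r' X S * r' (T - S))"
    using T by (intro sum.cong arg_cong2[where f = "(*)"] assms(3)) auto
  also have "\<dots> = r' (X \<union> T)"
    using assms(2) assms(3)[of "{}"] \<open>finite T\<close> by (subst ursell_conv) auto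
  also have "\<dots> = r (X \<union> T)" using T by (intro assms(3)[symmetric]) auto
  finally show "(\<Sum>S\<in>Pow T. ursell r' X S * r (T - S)) = r (X \<union> T)" .
qed

lemma measurable_ursell:
  fixes r :: "'x \<Rightarrow> 'i set \<Rightarrow> real"
  assumes r: "\<And>J. (\<lambda>x. r x J) \<in> borel_measurable M"
  shows "(\<lambda>x. ursell (r x) X Y) \<in> borel_measurable M"
proof (cases "finite Y")
  case True
  then show ?thesis
  proof (induction Y rule: finite_psubset_induct)
    case (psubset Y)
    have [measurable]: "(\<lambda>x. ursell (r x) X S) \<in> borel_measurable M" if "S \<in> Pow Y - {Y}" for S
      using psubset that by blast
    note r[measurable]
    show ?case
      using psubset.hyps by (subst ursell.simps, simp, measurable)
  qed
qed (subst ursell.simps, simp)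

section \<open>Moebius transforms over the subsets of a finite set\<close>

definition mobius :: "('i set \<Rightarrow> real) \<Rightarrow> 'i set \<Rightarrow> real"
  where "mobius f S = (\<Sum>T\<in>Pow S. (- 1) ^ card (S - T) * f T)"

lemma sum_Pow_sign:
  assumes "finite S"
  shows "(\<Sum>T\<in>Pow S. (- 1) ^ card T) = (if S = {} then 1 else (0::real))"
  using assms
proof (induction S)
  case (insert b S)
  have "(\<Sum>T\<in>Pow S. (- 1) ^ card (insert b T)) = (\<Sum>T\<in>Pow S. - ((- 1) ^ card T) :: real)"
  proof (rule sum.cong)
    fix T assume "T \<in> Pow S"
    then have "finite T" "b \<notin> T" using insert finite_subset by auto
    then show "(- 1) ^ card (insert b T) = - ((- 1) ^ card T :: real)" by simp
  qed simp
  then show ?case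
    using insert by (simp add: sum_Pow_insert sum_negf)
qed simp

lemma sum_mobius:
  assumes "finite Y"
  shows "(\<Sum>S\<in>Pow Y. mobius f S) = f Y"
proof -
  have "(\<Sum>S\<in>Pow Y. mobius f S) = (\<Sum>T\<in>Pow Y. \<Sum>S\<in>Pow (Y - T). (- 1) ^ card S * f T)"
    unfolding mobius_def
    using sum_Pow_Pow[OF assms, of "\<lambda>T S _. (- 1) ^ card S * f T"] by simp
  also have "\<dots> = (\<Sum>T\<in>Pow Y. if T = Y then f Y else 0)"
  proof (rule sum.cong)
    fix T assume "T \<in> Pow Y"
    then have "Y - T = {} \<longleftrightarrow> T = Y" by auto
    then show "(\<Sum>S\<in>Pow (Y - T). (- 1) ^ card S * f T) = (if T = Y then f Y else 0)"
      using assms by (simp flip: sum_distrib_right add: sum_Pow_sign)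
  qed simp
  also have "\<dots> = f Y" using assms by (subst sum.delta) auto
  finally show ?thesis .
qed

text \<open>Setting \<open>f\<close> to 0 on the sets that miss \<open>B\<close> subtracts the sum
  over the subsets of \<open>S - B\<close>, whose signs differ from those of
  \<open>mobius f (S - B)\<close> by \<open>(- 1) ^ card B\<close>. Here \<open>B\<close> will be
  the set of points covered by one element of the measure space.\<close>

lemma mobius_hit:
  assumes "finite S" "B \<subseteq> S"
  shows "mobius (\<lambda>T. if T \<inter> B = {} then 0 else f T) S = mobius f S - (- 1) ^ card B * mobius f (S - B)"
proof -
  have "mobius (\<lambda>T. if T \<inter> B = {} then 0 else f T) S =
      (\<Sum>T\<in>Pow S. (- 1) ^ card (S - T) * f T - (if T \<inter> B = {} then (- 1) ^ card (S - T) * f T else 0))"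
    unfolding mobius_def by (intro sum.cong) auto
  also have "\<dots> = mobius f S - (\<Sum>T\<in>Pow S. if T \<inter> B = {} then (- 1) ^ card (S - T) * f T else 0)"
    by (simp add: sum_subtractf mobius_def)
  also have "(\<Sum>T\<in>Pow S. if T \<inter> B = {} then (- 1) ^ card (S - T) * f T else 0) =
      (\<Sum>T\<in>Pow (S - B). (- 1) ^ card (S - T) * f T)"
    using assms by (subst sum.inter_filter[symmetric]) (auto intro!: sum.cong)
  also have "\<dots> = (\<Sum>T\<in>Pow (S - B). (- 1) ^ card B * ((- 1) ^ card (S - B - T) * f T))"
  proof (rule sum.cong)
    fix T assume "T \<in> Pow (S - B)"
    then have "S - T = B \<union> (S - B - T)" "B \<inter> (S - B - T) = {}" using assms by auto
    then have "card (S - T) = card B + card (S - B - T)"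
      using assms by (metis card_Un_disjoint finite_Diff finite_subset)
    then show "(- 1) ^ card (S - T) * f T = (- 1) ^ card B * ((- 1) ^ card (S - B - T) * f T)"
      by (simp add: power_add)
  qed simp
  also have "\<dots> = (- 1) ^ card B * mobius f (S - B)"
    by (simp add: mobius_def sum_distrib_left)
  finally show ?thesis .
qed

section \<open>Integrals of Moebius transforms\<close>

text \<open>Configurations are total functions on the index set. \<open>override_on x y S\<close>
  keeps the points of \<open>x\<close> outside \<open>S\<close> fixed and lets those in
  \<open>S\<close> be integrated, so that roots and integrated points live in one
  configuration.\<close>

lemma measurable_override_on:
  assumes "\<And>i. x i \<in> space (N i)"
  shows "(\<lambda>y. override_on x y S) \<in> PiM S N \<rightarrow>\<^sub>M PiM UNIV N"
proof (rule measurable_PiM_single')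
  fix i
  show "(\<lambda>y. override_on x y S i) \<in> PiM S N \<rightarrow>\<^sub>M N i"
    using assms by (cases "i \<in> S") (auto simp: override_on_def)
qed (auto simp: override_on_def space_PiM PiE_def Pi_def assms)

lemma (in product_sigma_finite) nn_integral_fold_override_on:
  assumes "S \<inter> T = {}" "finite S" "finite T" "\<And>i. x i \<in> space (M i)"
    and F[measurable]: "F \<in> borel_measurable (PiM UNIV M)"
  shows "(\<integral>\<^sup>+y. F (override_on x y (S \<union> T)) \<partial>PiM (S \<union> T) M) =
    (\<integral>\<^sup>+s. \<integral>\<^sup>+t. F (override_on (override_on x s S) t T) \<partial>PiM T M \<partial>PiM S M)"
proof -
  note measurable_override_on[OF assms(4), measurable]
  have "override_on x (merge S T (s, t)) (S \<union> T) = override_on (override_on x s S) t T" for s t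
    using assms(1) by (auto simp: override_on_def merge_def fun_eq_iff)
  then show ?thesis
    using assms(1-3) by (subst product_nn_integral_fold) auto
qed

lemma mobius_one:
  assumes "finite S"
  shows "mobius (\<lambda>_. 1) S = (if S = {} then 1 else 0)"
proof -
  have "mobius (\<lambda>_. 1) S = (\<Sum>T\<in>Pow S. (- 1) ^ card T)"
    unfolding mobius_def
    by (rule sum.reindex_bij_witness[where i = "(-) S" and j = "(-) S"]) (auto simp: double_diff)
  then show ?thesis using sum_Pow_sign[OF assms] by simp
qed

lemma ennreal_abs_sums_le:
  fixes f :: "nat \<Rightarrow> real"
  assumes "f sums s"
  shows "ennreal \<bar>s\<bar> \<le> (\<Sum>n. ennreal \<bar>f n\<bar>)"
proof (cases "(\<Sum>n. ennreal \<bar>f n\<bar>) = top")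
  case False
  then have sm: "summable (\<lambda>n. \<bar>f n\<bar>)" by (intro summable_suminf_not_top) auto
  have "\<bar>s\<bar> \<le> (\<Sum>n. \<bar>f n\<bar>)"
    using summable_rabs[OF sm] assms by (simp add: sums_iff)
  then have "ennreal \<bar>s\<bar> \<le> ennreal (\<Sum>n. \<bar>f n\<bar>)" by (rule ennreal_leI)
  also have "\<dots> = (\<Sum>n. ennreal \<bar>f n\<bar>)"
    using sm by (intro suminf_ennreal2[symmetric]) auto
  finally show ?thesis .
qed simp

text \<open>The weights absorb binomial coefficients: with \<open>s = card S\<close> and
  \<open>c = card C\<close>, \<open>(s choose c) * weight z (S - C) = weight z S * z ^ c / fact
  c\<close>. Sums over subsets thus become truncated exponential series.\<close>

definition weight :: "real \<Rightarrow> 'i set \<Rightarrow> real" where "weight z S = fact (card S) / z ^ card S"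

lemma weight_sum:
  fixes l :: "nat \<Rightarrow> ennreal"
  assumes "finite S" "0 < z" and l: "\<And>s. (\<Sum>c=1..s. ennreal (z ^ c / fact c) * l c) \<le> g"
  shows "(\<Sum>C\<in>Pow S - {{}}. l (card C) * ennreal (weight z (S - C))) \<le> ennreal (weight z S) * g"
proof -
  define s where "s = card S"
  define u where "u c = (if c = 0 then 0 else l c * ennreal (fact (s - c) / z ^ (s - c)))" for c
  have "(\<Sum>C\<in>Pow S - {{}}. l (card C) * ennreal (weight z (S - C))) = (\<Sum>C\<in>Pow S - {{}}. u (card C))"
    using assms(1) finite_subset[of _ S]
    by (intro sum.cong) (auto simp: u_def weight_def s_def card_Diff_subset)
  also have "\<dots> = (\<Sum>C\<in>Pow S. u (card C))"
    using assms(1) by (intro sum.mono_neutral_left) (auto simp: u_def)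
  also have "\<dots> = (\<Sum>c\<le>s. of_nat (s choose c) * u c)"
    unfolding s_def by (rule sum_Pow_card[OF assms(1)])
  also have "\<dots> = (\<Sum>c=1..s. of_nat (s choose c) * u c)"
    by (intro sum.mono_neutral_right) (auto simp: u_def)
  also have "\<dots> = (\<Sum>c=1..s. ennreal (weight z S) * (ennreal (z ^ c / fact c) * l c))"
  proof (rule sum.cong)
    fix c assume c: "c \<in> {1..s}"
    have "of_nat (s choose c) * (fact (s - c) / z ^ (s - c)) = weight z S * (z ^ c / fact c)"
      using c assms(2) by (simp add: weight_def s_def[symmetric] binomial_fact power_diff field_simps)
    then have "ennreal (of_nat (s choose c)) * ennreal (fact (s - c) / z ^ (s - c)) =
        ennreal (weight z S) * ennreal (z ^ c / fact c)"
      using assms(2) by (simp flip: ennreal_mult add: weight_def)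
    then show "of_nat (s choose c) * u c = ennreal (weight z S) * (ennreal (z ^ c / fact c) * l c)"
      using c by (simp add: u_def ennreal_of_nat_eq_real_of_nat) (metis mult.assoc mult.commute)
  qed simp
  also have "\<dots> \<le> ennreal (weight z S) * g"
    using l[of s] by (simp flip: sum_distrib_left add: mult_left_mono)
  finally show ?thesis .
qed

section \<open>Points \<open>x\<close>, objects \<open>p\<close>, and the set \<open>A x\<close> of
  the objects that cover \<open>x\<close>\<close>

locale hitting =
  N: sigma_finite_measure N + Q: sigma_finite_measure Q
  for N :: "'x measure" and Q :: "'p measure" +
  fixes A :: "'x \<Rightarrow> 'p set"
  assumes space_N: "space N = UNIV"
    and pred_A: "Measurable.pred (N \<Otimes>\<^sub>M Q) (\<lambda>(x, p). p \<in> A x)"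
begin

sublocale PN: product_sigma_finite "\<lambda>_::'i. N"
  by standard

lemma pred_A' [measurable (raw)]:
  assumes [measurable]: "f \<in> L \<rightarrow>\<^sub>M N" "g \<in> L \<rightarrow>\<^sub>M Q"
  shows "Measurable.pred L (\<lambda>w. g w \<in> A (f w))"
proof -
  have "Measurable.pred L (\<lambda>w. (\<lambda>(x, p). p \<in> A x) (f w, g w))"
    by (intro measurable_compose[OF _ pred_A] measurable_Pair assms)
  then show ?thesis by simp
qed

definition ell :: "'p \<Rightarrow> ennreal" where "ell p = (\<integral>\<^sup>+x. indicator (A x) p \<partial>N)"

lemma ell_measurable [measurable]: "ell \<in> borel_measurable Q"
  unfolding ell_def indicator_def by measurable

end

text \<open>The assumption \<open>moments\<close> is the bound \<open>g\<close> for the integral of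
  \<open>exp (z * ell) - 1\<close>, stated through the partial sums of the exponential
  series.\<close>

locale finite_hitting = hitting N Q A for N :: "'x measure" and Q :: "'p measure" and A +
  fixes z g :: real
  assumes finite_Q: "finite_measure Q" and z_pos: "0 < z" and g_nonneg: "0 \<le> g"
    and moments: "(\<Sum>c=1..s. ennreal (z ^ c / fact c) * (\<integral>\<^sup>+p. ell p ^ c \<partial>Q)) \<le> ennreal g"
begin

sublocale FQ: finite_measure Q by (rule finite_Q)

definition hit_mass :: "('i \<Rightarrow> 'x) \<Rightarrow> 'i set \<Rightarrow> real"
  where "hit_mass x T = measure Q {p \<in> space Q. \<exists>j\<in>T. p \<in> A (x j)}"

text \<open>The term of order \<open>n\<close> in the exponential series of the kernel, up to the
  factor \<open>exp (- m) / fact n\<close>.\<close>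

definition hit_mobius :: "nat \<Rightarrow> 'i set \<Rightarrow> ('i \<Rightarrow> 'x) \<Rightarrow> real"
  where "hit_mobius n S x = mobius (\<lambda>T. hit_mass x T ^ n) S"

abbreviation "m \<equiv> measure Q (space Q)"

lemma hit_set:
  assumes "countable T"
  shows "{p \<in> space Q. \<exists>j\<in>T. p \<in> A (x j)} \<in> sets Q"
proof -
  have [measurable]: "(\<lambda>_. x j) \<in> Q \<rightarrow>\<^sub>M N" for j using space_N by auto
  show ?thesis using assms by measurable
qed

lemma hit_mass_measurable:
  fixes T :: "'i set"
  assumes "finite T"
  shows "(\<lambda>x. hit_mass x T) \<in> borel_measurable (PiM UNIV (\<lambda>_. N))"
proof -
  have [measurable]: "countable T" using assms by (rule countable_finite)
  have "Measurable.pred (PiM UNIV (\<lambda>_::'i. N) \<Otimes>\<^sub>M Q) (\<lambda>(x, p). \<exists>j\<in>T. p \<in> A (x j))"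
    by measurable
  then have "{w \<in> space (PiM UNIV (\<lambda>_::'i. N) \<Otimes>\<^sub>M Q). \<exists>j\<in>T. snd w \<in> A (fst w j)}
      \<in> sets (PiM UNIV (\<lambda>_::'i. N) \<Otimes>\<^sub>M Q)"
    by (simp add: pred_def case_prod_beta')
  from Q.measurable_emeasure_Pair[OF this]
  have "(\<lambda>x. emeasure Q {p \<in> space Q. \<exists>j\<in>T. p \<in> A (x j)}) \<in> borel_measurable (PiM UNIV (\<lambda>_. N))"
    by (simp add: space_pair_measure space_PiM space_N vimage_def PiE_def Pi_def cong: measurable_cong)
  then show ?thesis
    unfolding hit_mass_def measure_def by measurable
qed

lemma hit_mobius_measurable:
  assumes "finite S"
  shows "hit_mobius n S \<in> borel_measurable (PiM UNIV (\<lambda>_. N))"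
  unfolding hit_mobius_def mobius_def
  using hit_mass_measurable[OF finite_subset[OF _ assms]]
  by (intro borel_measurable_sum borel_measurable_times borel_measurable_power) auto

lemma hit_mass_cong: "(\<And>j. j \<in> T \<Longrightarrow> x j = y j) \<Longrightarrow> hit_mass x T = hit_mass y T"
  by (simp add: hit_mass_def)

lemma hit_mobius_cong: "(\<And>j. j \<in> S \<Longrightarrow> x j = y j) \<Longrightarrow> hit_mobius n S x = hit_mobius n S y"
  unfolding hit_mobius_def mobius_def
  by (intro sum.cong arg_cong2[where f = "(*)"] arg_cong[where f = "\<lambda>t. t ^ n"] hit_mass_cong) auto

lemma hit_mass_le: "hit_mass x T \<le> m"
  unfolding hit_mass_def by (intro FQ.finite_measure_mono) auto

text \<open>One factor of the power is written as an integral over \<open>p\<close> of the indicator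
  that \<open>p\<close> covers some point of \<open>T\<close>. For fixed \<open>p\<close> this
  indicator kills exactly the sets \<open>T\<close> disjoint from the set \<open>C p\<close> of
  covered points, so \<open>mobius_hit\<close> expresses the transform through the two transforms of
  order \<open>n\<close> at \<open>S\<close> and \<open>S - C p\<close>.\<close>

lemma hit_mobius_Suc_le:
  assumes "finite S"
  shows "ennreal \<bar>hit_mobius (Suc n) S x\<bar> \<le> ennreal m * ennreal \<bar>hit_mobius n S x\<bar> +
    (\<Sum>C\<in>Pow S - {{}}. ennreal \<bar>hit_mobius n (S - C) x\<bar> * (\<integral>\<^sup>+p. (\<Prod>j\<in>C. indicator (A (x j)) p) \<partial>Q))"
proof -
  have [measurable]: "(\<lambda>_. x j) \<in> Q \<rightarrow>\<^sub>M N" for j using space_N by auto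
  have [measurable]: "(\<lambda>p. indicator (A (x j)) p :: ennreal) \<in> borel_measurable Q" for j
    unfolding indicator_def by measurable
  define C where "C p = {j \<in> S. p \<in> A (x j)}" for p
  have C_sub: "C p \<subseteq> S" for p by (auto simp: C_def)
  define F where "F p = mobius (\<lambda>T. if T \<inter> C p = {} then 0 else hit_mass x T ^ n) S" for p
  have F_eq: "F p = (\<Sum>T\<in>Pow S. (- 1) ^ card (S - T) * (indicator {p \<in> space Q. \<exists>j\<in>T. p \<in> A (x j)} p * hit_mass x T ^ n))"
    if "p \<in> space Q" for p
    unfolding F_def mobius_def using that
    by (intro sum.cong arg_cong2[where f = "(*)"] refl) (auto simp: indicator_def C_def)
  have fin: "finite T" if "T \<in> Pow S" for T using that assms finite_subset by auto
  note hit = hit_set[OF countable_finite[OF fin]]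
  have int1: "integrable Q (indicator {p \<in> space Q. \<exists>j\<in>T. p \<in> A (x j)} :: 'p \<Rightarrow> real)"
    if "T \<in> Pow S" for T
    using hit[OF that] by (intro FQ.integrable_const_bound[where B = 1]) auto
  have "integrable Q (\<lambda>p. \<Sum>T\<in>Pow S. (- 1) ^ card (S - T) *
      (indicator {p \<in> space Q. \<exists>j\<in>T. p \<in> A (x j)} p * hit_mass x T ^ n) :: real)"
    using int1 by (intro Bochner_Integration.integrable_sum integrable_mult_right integrable_mult_left) auto
  then have int: "integrable Q F"
    by (subst Bochner_Integration.integrable_cong[OF refl F_eq]) auto
  have "hit_mobius (Suc n) S x = (\<Sum>T\<in>Pow S. (- 1) ^ card (S - T) * (hit_mass x T * hit_mass x T ^ n))"
    by (simp add: hit_mobius_def mobius_def)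
  also have "\<dots> = (\<Sum>T\<in>Pow S. \<integral>p. (- 1) ^ card (S - T) *
      (indicator {p \<in> space Q. \<exists>j\<in>T. p \<in> A (x j)} p * hit_mass x T ^ n) \<partial>Q)"
    by (intro sum.cong) (auto simp: hit_mass_def Int_def conj_ac cong: conj_cong)
  also have "\<dots> = (\<integral>p. (\<Sum>T\<in>Pow S. (- 1) ^ card (S - T) *
      (indicator {p \<in> space Q. \<exists>j\<in>T. p \<in> A (x j)} p * hit_mass x T ^ n)) \<partial>Q)"
    using int1 by (intro Bochner_Integration.integral_sum[symmetric] integrable_mult_right integrable_mult_left) auto
  also have "\<dots> = (\<integral>p. F p \<partial>Q)"
    by (intro Bochner_Integration.integral_cong refl F_eq[symmetric])
  finally have hit_mobius_eq: "hit_mobius (Suc n) S x = (\<integral>p. F p \<partial>Q)" .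
  \<comment> \<open>The single set \<open>C p\<close> is replaced by the sum over all nonempty
    \<open>C\<close> whose points are all covered by \<open>p\<close>. This overestimates, but each
    summand is a product over the points and can be integrated point by point.\<close>
  have F_le: "ennreal \<bar>F p\<bar> \<le> ennreal \<bar>hit_mobius n S x\<bar> +
      (\<Sum>C\<in>Pow S - {{}}. ennreal \<bar>hit_mobius n (S - C) x\<bar> * (\<Prod>j\<in>C. indicator (A (x j)) p))" for p
  proof (cases "C p = {}")
    case True
    then show ?thesis by (simp add: F_def mobius_def)
  next
    case False
    have "F p = hit_mobius n S x - (- 1) ^ card (C p) * hit_mobius n (S - C p) x"
      unfolding F_def hit_mobius_def using assms C_sub by (rule mobius_hit)
    then have "\<bar>F p\<bar> \<le> \<bar>hit_mobius n S x\<bar> + \<bar>hit_mobius n (S - C p) x\<bar>"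
      using abs_triangle_ineq4[of "hit_mobius n S x" "(- 1) ^ card (C p) * hit_mobius n (S - C p) x"]
      by (simp add: abs_mult power_abs)
    then have "ennreal \<bar>F p\<bar> \<le> ennreal \<bar>hit_mobius n S x\<bar> + ennreal \<bar>hit_mobius n (S - C p) x\<bar>"
      by (simp flip: ennreal_plus add: ennreal_leI)
    also have "ennreal \<bar>hit_mobius n (S - C p) x\<bar> =
        ennreal \<bar>hit_mobius n (S - C p) x\<bar> * (\<Prod>j\<in>C p. indicator (A (x j)) p)"
      by (simp add: C_def)
    also have "\<dots> \<le> (\<Sum>C\<in>Pow S - {{}}. ennreal \<bar>hit_mobius n (S - C) x\<bar> * (\<Prod>j\<in>C. indicator (A (x j)) p))"
      using False C_sub assms by (intro member_le_sum) auto
    finally show ?thesis by (auto intro: add_left_mono)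
  qed
  have "ennreal \<bar>hit_mobius (Suc n) S x\<bar> \<le> (\<integral>\<^sup>+p. ennreal \<bar>F p\<bar> \<partial>Q)"
    unfolding hit_mobius_eq using integral_norm_bound_ennreal[OF int] by simp
  also have "\<dots> \<le> (\<integral>\<^sup>+p. ennreal \<bar>hit_mobius n S x\<bar> +
      (\<Sum>C\<in>Pow S - {{}}. ennreal \<bar>hit_mobius n (S - C) x\<bar> * (\<Prod>j\<in>C. indicator (A (x j)) p)) \<partial>Q)"
    by (intro nn_integral_mono F_le)
  also have "\<dots> = ennreal m * ennreal \<bar>hit_mobius n S x\<bar> +
    (\<Sum>C\<in>Pow S - {{}}. ennreal \<bar>hit_mobius n (S - C) x\<bar> * (\<integral>\<^sup>+p. (\<Prod>j\<in>C. indicator (A (x j)) p) \<partial>Q))"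
  proof -
    have meas: "(\<lambda>p. \<Prod>j\<in>C. indicator (A (x j)) p :: ennreal) \<in> borel_measurable Q" for C
      by (intro borel_measurable_prod_ennreal) simp
    have "(\<integral>\<^sup>+p. ennreal \<bar>hit_mobius n S x\<bar> +
        (\<Sum>C\<in>Pow S - {{}}. ennreal \<bar>hit_mobius n (S - C) x\<bar> * (\<Prod>j\<in>C. indicator (A (x j)) p)) \<partial>Q) =
      (\<integral>\<^sup>+p. ennreal \<bar>hit_mobius n S x\<bar> \<partial>Q) + (\<integral>\<^sup>+p.
        (\<Sum>C\<in>Pow S - {{}}. ennreal \<bar>hit_mobius n (S - C) x\<bar> * (\<Prod>j\<in>C. indicator (A (x j)) p)) \<partial>Q)"
      using meas by (intro nn_integral_add) auto
    also have "(\<integral>\<^sup>+p. ennreal \<bar>hit_mobius n S x\<bar> \<partial>Q) = ennreal m * ennreal \<bar>hit_mobius n S x\<bar>"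
      by (simp add: FQ.emeasure_eq_measure mult.commute)
    also have "(\<integral>\<^sup>+p.
        (\<Sum>C\<in>Pow S - {{}}. ennreal \<bar>hit_mobius n (S - C) x\<bar> * (\<Prod>j\<in>C. indicator (A (x j)) p)) \<partial>Q) =
      (\<Sum>C\<in>Pow S - {{}}. \<integral>\<^sup>+p. ennreal \<bar>hit_mobius n (S - C) x\<bar> * (\<Prod>j\<in>C. indicator (A (x j)) p) \<partial>Q)"
      using meas by (intro nn_integral_sum) auto
    also have "\<dots> = (\<Sum>C\<in>Pow S - {{}}.
        ennreal \<bar>hit_mobius n (S - C) x\<bar> * (\<integral>\<^sup>+p. (\<Prod>j\<in>C. indicator (A (x j)) p) \<partial>Q))"
      using meas by (intro sum.cong refl nn_integral_cmult)
    finally show ?thesis .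
  qed
  finally show ?thesis .
qed

lemma prod_hit_integral:
  fixes C :: "'i set"
  assumes "finite C"
  shows "(\<integral>\<^sup>+s. \<integral>\<^sup>+p. (\<Prod>j\<in>C. indicator (A (s j)) p) \<partial>Q \<partial>PiM C (\<lambda>_. N)) = (\<integral>\<^sup>+p. ell p ^ card C \<partial>Q)"
proof -
  interpret C: finite_product_sigma_finite "\<lambda>_::'i. N" C by standard (use assms in auto)
  interpret QC: pair_sigma_finite Q "PiM C (\<lambda>_::'i. N)" by standard
  have [measurable]: "(\<lambda>w. indicator (A (snd w j)) (fst w) :: ennreal) \<in> borel_measurable (Q \<Otimes>\<^sub>M PiM C (\<lambda>_. N))"
    if "j \<in> C" for j unfolding indicator_def using that by measurable
  have "(\<integral>\<^sup>+s. \<integral>\<^sup>+p. (\<Prod>j\<in>C. indicator (A (s j)) p) \<partial>Q \<partial>PiM C (\<lambda>_. N)) =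
      (\<integral>\<^sup>+p. \<integral>\<^sup>+s. (\<Prod>j\<in>C. indicator (A (s j)) p) \<partial>PiM C (\<lambda>_. N) \<partial>Q)"
    by (intro QC.Fubini') (simp add: case_prod_beta')
  also have "\<dots> = (\<integral>\<^sup>+p. (\<Prod>j\<in>C. ell p) \<partial>Q)"
  proof (rule nn_integral_cong)
    fix p assume p: "p \<in> space Q"
    have [measurable]: "(\<lambda>_. p) \<in> N \<rightarrow>\<^sub>M Q" using p by auto
    show "(\<integral>\<^sup>+s. (\<Prod>j\<in>C. indicator (A (s j)) p) \<partial>PiM C (\<lambda>_. N)) = (\<Prod>j\<in>C. ell p)"
      unfolding ell_def
      by (subst PN.product_nn_integral_prod[OF assms, where f = "\<lambda>_ x. indicator (A x) p"])
        (auto simp: indicator_def)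
  qed
  finally show ?thesis by simp
qed

lemma moments_le:
  assumes "finite S"
  shows "(\<Sum>C\<in>Pow S - {{}}. (\<integral>\<^sup>+p. ell p ^ card C \<partial>Q) * ennreal (weight z (S - C))) \<le>
    ennreal (weight z S * g)"
proof -
  have "ennreal (weight z S * g) = ennreal (weight z S) * ennreal g"
    using g_nonneg z_pos by (intro ennreal_mult) (auto simp: weight_def)
  then show ?thesis using weight_sum[OF assms z_pos moments] by simp
qed

text \<open>Splitting off a factor costs \<open>m\<close> if all points are left to the other
  factors, and \<open>g\<close> in total, relative to the weights, if a nonempty set
  \<open>C\<close> is integrated out together with it. The second case must occur at least once when
  \<open>S\<close> is nonempty, because the transform of the constant 1 vanishes there; this is the
  subtracted \<open>m ^ n\<close>.\<close>

lemma hit_mobius_bound: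
  fixes x :: "'i \<Rightarrow> 'x"
  assumes "finite S"
  shows "(\<integral>\<^sup>+y. ennreal \<bar>hit_mobius n S (override_on x y S)\<bar> \<partial>PiM S (\<lambda>_. N)) \<le>
    ennreal (if S = {} then m ^ n else weight z S * ((m + g) ^ n - m ^ n))"
  using assms
proof (induction n arbitrary: S x)
  case 0
  show ?case
  proof (cases "S = {}")
    case False
    have "hit_mobius 0 S y = 0" for y
      using False by (simp add: hit_mobius_def mobius_one 0)
    then show ?thesis by simp
  qed (simp add: hit_mobius_def mobius_def PiM_empty)
next
  case (Suc n)
  note [measurable] = hit_mobius_measurable[OF finite_subset[OF _ Suc.prems]]
  note [measurable] = measurable_override_on[where N = "\<lambda>_. N", of x]
  let ?G = "(m + g) ^ n"
  let ?b = "\<lambda>S. \<integral>\<^sup>+y. ennreal \<bar>hit_mobius n S (override_on x y S)\<bar> \<partial>PiM S (\<lambda>_. N)"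
  let ?P = "\<lambda>C y. \<integral>\<^sup>+p. (\<Prod>j\<in>C. indicator (A (override_on x y S j)) p) \<partial>Q"
  have w: "weight z S \<ge> 0" for S :: "'i set" using z_pos by (simp add: weight_def)
  have le: "m ^ n \<le> ?G" using g_nonneg by (intro power_mono) auto
  show ?case
  proof (cases "S = {}")
    case True
    then show ?thesis by (simp add: hit_mobius_def mobius_def hit_mass_def)
  next
    case False
    have P_meas: "(\<lambda>y. \<integral>\<^sup>+p. (\<Prod>j\<in>C. indicator (A (y j)) p) \<partial>Q) \<in> borel_measurable (PiM UNIV (\<lambda>_. N))"
      if "finite C" for C :: "'i set"
      unfolding indicator_def using that by measurable
    \<comment> \<open>The subtracted \<open>m ^ n\<close> is dropped, so that the case
      \<open>C = S\<close>, where no point is left, obeys the same bound.\<close>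
    have b_le: "?b (S - C) \<le> ennreal (weight z (S - C)) * ennreal ?G" if "C \<in> Pow S - {{}}" for C
    proof -
      have "finite (S - C)" using Suc.prems by auto
      from Suc.IH[OF this, of x] have "?b (S - C) \<le>
        ennreal (if S - C = {} then m ^ n else weight z (S - C) * ((m + g) ^ n - m ^ n))" .
      also have "\<dots> \<le> ennreal (weight z (S - C) * ?G)"
      proof (rule ennreal_leI)
        have "weight z (S - C) * ((m + g) ^ n - m ^ n) \<le> weight z (S - C) * ?G"
          using w by (intro mult_left_mono) auto
        moreover have "m ^ n \<le> weight z (S - C) * ?G" if "S - C = {}"
          using le by (simp add: that weight_def)
        ultimately show "(if S - C = {} then m ^ n else weight z (S - C) * ((m + g) ^ n - m ^ n))
            \<le> weight z (S - C) * ?G" by simp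
      qed
      also have "\<dots> = ennreal (weight z (S - C)) * ennreal ?G"
        using w g_nonneg by (intro ennreal_mult) auto
      finally show ?thesis .
    qed
    have split: "(\<integral>\<^sup>+y. ennreal \<bar>hit_mobius n (S - C) (override_on x y S)\<bar> * ?P C y \<partial>PiM S (\<lambda>_. N)) =
        ?b (S - C) * (\<integral>\<^sup>+p. ell p ^ card C \<partial>Q)" if C: "C \<in> Pow S - {{}}" for C
    proof -
      have fin: "finite C" "finite (S - C)" and un: "C \<union> (S - C) = S"
        using C Suc.prems finite_subset by auto
      note P_meas[OF fin(1), measurable]
      have "(\<integral>\<^sup>+y. ennreal \<bar>hit_mobius n (S - C) (override_on x y S)\<bar> * ?P C y \<partial>PiM S (\<lambda>_. N)) =
          (\<integral>\<^sup>+s. \<integral>\<^sup>+t. ennreal \<bar>hit_mobius n (S - C) (override_on (override_on x s C) t (S - C))\<bar> *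
            (\<integral>\<^sup>+p. (\<Prod>j\<in>C. indicator (A (override_on (override_on x s C) t (S - C) j)) p) \<partial>Q)
            \<partial>PiM (S - C) (\<lambda>_. N) \<partial>PiM C (\<lambda>_. N))"
        by (rule PN.nn_integral_fold_override_on[of C "S - C" x
          "\<lambda>y. ennreal \<bar>hit_mobius n (S - C) y\<bar> * (\<integral>\<^sup>+p. (\<Prod>j\<in>C. indicator (A (y j)) p) \<partial>Q)",
          unfolded un]) (use fin in \<open>auto simp: space_N\<close>)
      also have "\<dots> = (\<integral>\<^sup>+s. \<integral>\<^sup>+t. ennreal \<bar>hit_mobius n (S - C) (override_on x t (S - C))\<bar> *
            (\<integral>\<^sup>+p. (\<Prod>j\<in>C. indicator (A (s j)) p) \<partial>Q) \<partial>PiM (S - C) (\<lambda>_. N) \<partial>PiM C (\<lambda>_. N))"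
        by (intro nn_integral_cong arg_cong2[where f = "(*)"] arg_cong[where f = "\<lambda>t. ennreal \<bar>t\<bar>"]
            hit_mobius_cong prod.cong) (auto simp: override_on_def)
      also have "\<dots> = (\<integral>\<^sup>+s. ?b (S - C) * (\<integral>\<^sup>+p. (\<Prod>j\<in>C. indicator (A (s j)) p) \<partial>Q) \<partial>PiM C (\<lambda>_. N))"
        using fin by (intro nn_integral_cong nn_integral_multc) (simp add: space_N)
      also have "\<dots> = ?b (S - C) * (\<integral>\<^sup>+p. ell p ^ card C \<partial>Q)"
        unfolding prod_hit_integral[OF fin(1), symmetric]
        by (intro nn_integral_cmult) (unfold indicator_def, measurable)
      finally show ?thesis .
    qed
    have "(\<integral>\<^sup>+y. ennreal \<bar>hit_mobius (Suc n) S (override_on x y S)\<bar> \<partial>PiM S (\<lambda>_. N)) \<le>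
      (\<integral>\<^sup>+y. ennreal m * ennreal \<bar>hit_mobius n S (override_on x y S)\<bar> +
      (\<Sum>C\<in>Pow S - {{}}. ennreal \<bar>hit_mobius n (S - C) (override_on x y S)\<bar> * ?P C y) \<partial>PiM S (\<lambda>_. N))"
      by (intro nn_integral_mono hit_mobius_Suc_le Suc.prems)
    also have "\<dots> = ennreal m * ?b S +
      (\<Sum>C\<in>Pow S - {{}}. \<integral>\<^sup>+y. ennreal \<bar>hit_mobius n (S - C) (override_on x y S)\<bar> * ?P C y \<partial>PiM S (\<lambda>_. N))"
    proof -
      have m: "(\<lambda>y. ennreal \<bar>hit_mobius n (S - C) (override_on x y S)\<bar> * ?P C y) \<in> borel_measurable (PiM S (\<lambda>_. N))"
        if "C \<in> Pow S - {{}}" for C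
      proof -
        have "finite C" using that Suc.prems finite_subset by auto
        note P_meas[OF this, measurable]
        show ?thesis by (measurable, auto simp: space_N)
      qed
      have "(\<lambda>y. ennreal \<bar>hit_mobius n S (override_on x y S)\<bar>) \<in> borel_measurable (PiM S (\<lambda>_. N))"
        by (measurable, auto simp: space_N)
      then have "(\<integral>\<^sup>+y. ennreal m * ennreal \<bar>hit_mobius n S (override_on x y S)\<bar> \<partial>PiM S (\<lambda>_. N)) = ennreal m * ?b S"
        and m1: "(\<lambda>y. ennreal m * ennreal \<bar>hit_mobius n S (override_on x y S)\<bar>) \<in> borel_measurable (PiM S (\<lambda>_. N))"
        by (auto intro: nn_integral_cmult)
      moreover have "(\<lambda>y. \<Sum>C\<in>Pow S - {{}}. ennreal \<bar>hit_mobius n (S - C) (override_on x y S)\<bar> * ?P C y)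
          \<in> borel_measurable (PiM S (\<lambda>_. N))"
        by (intro borel_measurable_sum m)
      moreover have "(\<integral>\<^sup>+y. (\<Sum>C\<in>Pow S - {{}}. ennreal \<bar>hit_mobius n (S - C) (override_on x y S)\<bar> * ?P C y)
            \<partial>PiM S (\<lambda>_. N)) =
          (\<Sum>C\<in>Pow S - {{}}. \<integral>\<^sup>+y. ennreal \<bar>hit_mobius n (S - C) (override_on x y S)\<bar> * ?P C y \<partial>PiM S (\<lambda>_. N))"
        by (intro nn_integral_sum m)
      ultimately show ?thesis
        by (subst nn_integral_add[OF m1]) simp_all
    qed
    also have "\<dots> \<le> ennreal m * ennreal (weight z S * (?G - m ^ n)) +
      (\<Sum>C\<in>Pow S - {{}}. ennreal (weight z (S - C)) * ennreal ?G * (\<integral>\<^sup>+p. ell p ^ card C \<partial>Q))"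
      using Suc.IH[OF Suc.prems, of x] False
      by (intro add_mono mult_left_mono sum_mono) (auto simp: split intro!: mult_right_mono b_le)
    also have "\<dots> = ennreal (m * (weight z S * (?G - m ^ n))) +
      ennreal ?G * (\<Sum>C\<in>Pow S - {{}}. (\<integral>\<^sup>+p. ell p ^ card C \<partial>Q) * ennreal (weight z (S - C)))"
      using w le by (simp add: ennreal_mult sum_distrib_left mult_ac)
    also have "\<dots> \<le> ennreal (m * (weight z S * (?G - m ^ n))) + ennreal ?G * ennreal (weight z S * g)"
      by (intro add_left_mono mult_left_mono moments_le Suc.prems) auto
    also have "\<dots> = ennreal (m * (weight z S * (?G - m ^ n)) + ?G * (weight z S * g))"
      using w le g_nonneg by (simp add: ennreal_mult ennreal_plus)
    also have "m * (weight z S * (?G - m ^ n)) + ?G * (weight z S * g) =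
      weight z S * ((m + g) ^ Suc n - m ^ Suc n)" by (simp add: algebra_simps)
    finally show ?thesis using False by simp
  qed
qed

text \<open>The exponent is minus the mass of the objects that cover no point of \<open>T\<close>.
  For the measure \<open>Q\<close> restricted to the objects that cover a root and miss the other
  roots this is the kernel of the recursion.\<close>

definition kern :: "'i set \<Rightarrow> ('i \<Rightarrow> 'x) \<Rightarrow> real"
  where "kern S x = mobius (\<lambda>T. exp (- (m - hit_mass x T))) S"

lemma kern_sums: "(\<lambda>n. exp (- m) / fact n * hit_mobius n S x) sums kern S x"
proof -
  have "(\<lambda>n. exp (- m) / fact n * hit_mass x T ^ n) sums exp (- (m - hit_mass x T))" for T
    using sums_mult[OF exp_converges[of "hit_mass x T"], of "exp (- m)"]
    by (simp add: exp_minus exp_diff field_simps)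
  then have "(\<lambda>n. \<Sum>T\<in>Pow S. (- 1) ^ card (S - T) * (exp (- m) / fact n * hit_mass x T ^ n)) sums
      (\<Sum>T\<in>Pow S. (- 1) ^ card (S - T) * exp (- (m - hit_mass x T)))"
    by (intro sums_sum sums_mult)
  then show ?thesis
    by (simp add: kern_def hit_mobius_def mobius_def sum_distrib_left mult_ac)
qed

text \<open>The bounds of the terms sum to \<open>exp (- m) * (exp (m + g) - exp m)\<close>, so the
  total mass \<open>m\<close> cancels. Only \<open>g\<close> remains, which allows one bound for all
  restrictions of the measure.\<close>

lemma kern_bound:
  fixes x :: "'i \<Rightarrow> 'x"
  assumes "finite S" "S \<noteq> {}"
  shows "(\<integral>\<^sup>+y. ennreal \<bar>kern S (override_on x y S)\<bar> \<partial>PiM S (\<lambda>_. N)) \<le> ennreal (weight z S * (exp g - 1))"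
proof -
  have w: "weight z S \<ge> 0" using z_pos by (simp add: weight_def)
  note [measurable] = hit_mobius_measurable[OF assms(1)]
  have [measurable]: "(\<lambda>y. override_on x y S) \<in> PiM S (\<lambda>_. N) \<rightarrow>\<^sub>M PiM UNIV (\<lambda>_. N)"
    by (rule measurable_override_on) (simp add: space_N)
  have le: "ennreal \<bar>kern S y\<bar> \<le> (\<Sum>n. ennreal (exp (- m) / fact n) * ennreal \<bar>hit_mobius n S y\<bar>)" for y :: "'i \<Rightarrow> 'x"
  proof -
    have "ennreal \<bar>kern S y\<bar> \<le> (\<Sum>n. ennreal \<bar>exp (- m) / fact n * hit_mobius n S y\<bar>)"
      by (rule ennreal_abs_sums_le kern_sums)+
    also have "\<dots> = (\<Sum>n. ennreal (exp (- m) / fact n) * ennreal \<bar>hit_mobius n S y\<bar>)"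
      unfolding abs_mult by (intro suminf_cong) (subst ennreal_mult, auto)
    finally show ?thesis .
  qed
  have "(\<integral>\<^sup>+y. ennreal \<bar>kern S (override_on x y S)\<bar> \<partial>PiM S (\<lambda>_. N)) \<le>
    (\<integral>\<^sup>+y. (\<Sum>n. ennreal (exp (- m) / fact n) * ennreal \<bar>hit_mobius n S (override_on x y S)\<bar>) \<partial>PiM S (\<lambda>_. N))"
    by (intro nn_integral_mono le)
  also have "\<dots> = (\<Sum>n. ennreal (exp (- m) / fact n) *
      (\<integral>\<^sup>+y. ennreal \<bar>hit_mobius n S (override_on x y S)\<bar> \<partial>PiM S (\<lambda>_. N)))"
    by (subst nn_integral_suminf) (auto simp: nn_integral_cmult)
  also have "\<dots> \<le> (\<Sum>n. ennreal (exp (- m) / fact n) * ennreal (weight z S * ((m + g) ^ n - m ^ n)))"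
    using hit_mobius_bound[OF assms(1), of _ x] assms(2)
    by (intro suminf_le mult_left_mono) auto
  also have "\<dots> = (\<Sum>n. ennreal (exp (- m) / fact n * (weight z S * ((m + g) ^ n - m ^ n))))"
    using w g_nonneg by (intro suminf_cong ennreal_mult[symmetric]) (auto simp: power_mono)
  also have "\<dots> = ennreal (weight z S * (exp g - 1))"
  proof (rule suminf_ennreal_eq)
    show "0 \<le> exp (- m) / fact n * (weight z S * ((m + g) ^ n - m ^ n))" for n
      using w g_nonneg by (simp add: power_mono)
    have eq: "exp (- m) * (exp (m + g) - exp m) = exp g - 1"
      by (simp add: right_diff_distrib flip: exp_add)
    have "(\<lambda>n. weight z S * (exp (- m) * ((m + g) ^ n /\<^sub>R fact n - m ^ n /\<^sub>R fact n))) sums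
      (weight z S * (exp (- m) * (exp (m + g) - exp m)))"
      by (intro sums_mult sums_diff exp_converges)
    then show "(\<lambda>n. exp (- m) / fact n * (weight z S * ((m + g) ^ n - m ^ n))) sums (weight z S * (exp g - 1))"
      unfolding eq by (simp add: field_simps)
  qed
  finally show ?thesis .
qed

lemma kern_empty: "\<bar>kern {} x\<bar> \<le> 1"
  by (simp add: kern_def mobius_def hit_mass_le)

end

section \<open>The Kirkwood--Salsburg recursion\<close>

text \<open>In the grain model \<open>Q\<close> is an infinite measure and only the pairs that cover
  a given point have finite mass. The moments are accordingly taken over \<open>A x\<close>, with
  the same \<open>g\<close> for every \<open>x\<close>.\<close>

locale hitting_moments = hitting N Q A for N :: "'x measure" and Q :: "'p measure" and A +
  fixes z g :: real
  assumes finite_A: "emeasure Q {p \<in> space Q. p \<in> A x} < \<infinity>" and z_pos: "0 < z" and g_nonneg: "0 \<le> g"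
    and moments: "(\<Sum>c=1..s. ennreal (z ^ c / fact c) * (\<integral>\<^sup>+p. indicator (A x) p * ell p ^ c \<partial>Q)) \<le> ennreal g"
begin

lemma hit_sets:
  assumes "countable T"
  shows "{p \<in> space Q. \<exists>j\<in>T. p \<in> A (x j)} \<in> sets Q"
proof -
  have [measurable]: "(\<lambda>_. x j) \<in> Q \<rightarrow>\<^sub>M N" for j using space_N by auto
  show ?thesis using assms by measurable
qed

lemma A_sets: "{p \<in> space Q. p \<in> A x} \<in> sets Q"
  using hit_sets[of "{()}" "\<lambda>_. x"] by simp

definition V :: "('i \<Rightarrow> 'x) \<Rightarrow> 'i set \<Rightarrow> real"
  where "V x J = measure Q {p \<in> space Q. \<exists>j\<in>J. p \<in> A (x j)}"

definition rho :: "('i \<Rightarrow> 'x) \<Rightarrow> 'i set \<Rightarrow> real"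
  where "rho x J = exp (- V x J)"

lemma rho_empty [simp]: "rho x {} = 1"
  by (simp add: rho_def V_def)

lemma V_cong: "(\<And>j. j \<in> J \<Longrightarrow> x j = y j) \<Longrightarrow> V x J = V y J"
  by (simp add: V_def)

lemma rho_cong: "(\<And>j. j \<in> J \<Longrightarrow> x j = y j) \<Longrightarrow> rho x J = rho y J"
  unfolding rho_def using V_cong[of J x y] by simp

lemma finite_V:
  fixes x :: "'i \<Rightarrow> 'x"
  assumes "finite J"
  shows "emeasure Q {p \<in> space Q. \<exists>j\<in>J. p \<in> A (x j)} < \<infinity>"
proof -
  have "emeasure Q (\<Union>j\<in>J. {p \<in> space Q. p \<in> A (x j)}) \<le> (\<Sum>j\<in>J. emeasure Q {p \<in> space Q. p \<in> A (x j)})"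
    by (intro emeasure_subadditive_finite assms image_subsetI A_sets)
  also have "\<dots> < \<infinity>"
    using finite_A by (subst infinity_ennreal_def, subst ennreal_sum_less_top) (auto simp: assms)
  also have "(\<Union>j\<in>J. {p \<in> space Q. p \<in> A (x j)}) = {p \<in> space Q. \<exists>j\<in>J. p \<in> A (x j)}" by auto
  finally show ?thesis .
qed

text \<open>The kernel of the Kirkwood--Salsburg recursion: the Moebius transform of
  \<open>T \<mapsto> \<rho>(a \<union> X \<union> T) / \<rho>(X \<union> T)\<close>.\<close>

definition mayer :: "'i \<Rightarrow> 'i set \<Rightarrow> 'i set \<Rightarrow> ('i \<Rightarrow> 'x) \<Rightarrow> real"
  where "mayer a X S x = mobius (\<lambda>T. exp (- (V x (insert a (X \<union> T)) - V x (X \<union> T)))) S"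

text \<open>The difference of the two values of \<open>V\<close> is the mass of the objects that
  cover \<open>a\<close> and miss the points of \<open>X\<close> and \<open>T\<close>. After
  restricting \<open>Q\<close> to the set \<open>B\<close> of those that cover \<open>a\<close> and
  miss \<open>X\<close>, the kernel is \<open>kern\<close> of a finite measure.\<close>

lemma mayer_bound:
  fixes x :: "'i \<Rightarrow> 'x"
  assumes fin: "finite X" "finite S" and disj: "a \<notin> S" "X \<inter> S = {}"
  shows "S \<noteq> {} \<Longrightarrow> (\<integral>\<^sup>+y. ennreal \<bar>mayer a X S (override_on x y S)\<bar> \<partial>PiM S (\<lambda>_. N))
      \<le> ennreal (weight z S * (exp g - 1))"
    and "\<bar>mayer a X {} x\<bar> \<le> 1"
proof -
  define B where "B = {p \<in> space Q. p \<in> A (x a) \<and> \<not> (\<exists>j\<in>X. p \<in> A (x j))}"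
  have B_alt: "B = {p \<in> space Q. p \<in> A (x a)} - {p \<in> space Q. \<exists>j\<in>X. p \<in> A (x j)}"
    by (auto simp: B_def)
  have B [measurable]: "B \<in> sets Q"
    unfolding B_alt by (intro sets.Diff A_sets hit_sets countable_finite fin)
  define mu where "mu = density Q (indicator B)"
  have sets_mu [simp, measurable_cong]: "sets mu = sets Q" and space_mu [simp]: "space mu = space Q"
    by (auto simp: mu_def)
  have emu: "emeasure mu C = emeasure Q (B \<inter> C)" if "C \<in> sets Q" for C
    unfolding mu_def using B that by (rule emeasure_restricted)
  then have mu_eq: "measure mu C = measure Q (B \<inter> C)" if "C \<in> sets Q" for C
    using that by (simp add: measure_def)
  have B_space: "B \<inter> space Q = B" by (auto simp: B_def)
  have B_fin: "emeasure Q B < \<infinity>"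
    by (rule le_less_trans[OF emeasure_mono finite_A[of "x a"]]) (auto simp: B_alt intro: A_sets)
  interpret mu: finite_measure mu
    using B_fin by (intro finite_measureI) (auto simp: emu B_space)
  have "finite_hitting N mu A z g"
  proof (unfold_locales)
    show "space N = UNIV" by (rule space_N)
    show "Measurable.pred (N \<Otimes>\<^sub>M mu) (\<lambda>(x, p). p \<in> A x)"
      using pred_A by (simp cong: measurable_cong_sets sets_pair_measure_cong)
    fix s :: nat
    \<comment> \<open>\<open>B\<close> lies in the set of the objects that cover the root, so
      restricting can only decrease the moments; the roots in \<open>X\<close> leave no trace in the
      bound.\<close>
    have "(\<integral>\<^sup>+p. ell p ^ c \<partial>mu) \<le> (\<integral>\<^sup>+p. indicator (A (x a)) p * ell p ^ c \<partial>Q)" for c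
    proof -
      have "indicator B p * ell p ^ c \<le> indicator (A (x a)) p * ell p ^ c" for p
        by (auto simp: B_def indicator_def)
      then show ?thesis
        unfolding mu_def by (subst nn_integral_density) (simp_all add: nn_integral_mono)
    qed
    then have "(\<Sum>c=1..s. ennreal (z ^ c / fact c) * (\<integral>\<^sup>+p. ell p ^ c \<partial>mu)) \<le>
      (\<Sum>c=1..s. ennreal (z ^ c / fact c) * (\<integral>\<^sup>+p. indicator (A (x a)) p * ell p ^ c \<partial>Q))"
      by (intro sum_mono mult_left_mono) auto
    with moments show "(\<Sum>c=1..s. ennreal (z ^ c / fact c) * (\<integral>\<^sup>+p. ell p ^ c \<partial>mu)) \<le> ennreal g"
      by (rule order_trans[rotated])
  qed (use z_pos g_nonneg mu.emeasure_finite in auto)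
  then interpret FH: finite_hitting N mu A z g .
  \<comment> \<open>\<open>B\<close> was formed with the positions of the roots in \<open>x\<close>;
    the integrated configurations agree with \<open>x\<close> there.\<close>
  have eq: "mayer a X S y = FH.kern S y" if S: "finite S" and y: "\<And>j. j \<in> insert a X \<Longrightarrow> y j = x j" for S y
    unfolding mayer_def FH.kern_def mobius_def
  proof (intro sum.cong arg_cong2[where f = "(*)"] arg_cong[where f = exp] arg_cong[where f = uminus] refl)
    fix T assume "T \<in> Pow S"
    then have T: "finite T" using S finite_subset by auto
    note hit = hit_sets[OF countable_finite, of T y, OF T]
    have "V y (insert a (X \<union> T)) - V y (X \<union> T) =
        measure Q ({p \<in> space Q. \<exists>j\<in>insert a (X \<union> T). p \<in> A (y j)} - {p \<in> space Q. \<exists>j\<in>X \<union> T. p \<in> A (y j)})"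
      unfolding V_def
    proof (intro measure_Diff[symmetric] hit_sets countable_finite)
      show "emeasure Q {p \<in> space Q. \<exists>j\<in>insert a (X \<union> T). p \<in> A (y j)} \<noteq> \<infinity>"
        using finite_V[of "insert a (X \<union> T)" y] T fin by simp
    qed (use T fin in auto)
    also have "{p \<in> space Q. \<exists>j\<in>insert a (X \<union> T). p \<in> A (y j)} - {p \<in> space Q. \<exists>j\<in>X \<union> T. p \<in> A (y j)} =
        B - {p \<in> space Q. \<exists>j\<in>T. p \<in> A (y j)}"
      unfolding B_def using y by (auto simp: ball_Un)
    also have "measure Q \<dots> = measure Q B - measure Q (B \<inter> {p \<in> space Q. \<exists>j\<in>T. p \<in> A (y j)})"
    proof -
      have "measure Q (B - B \<inter> {p \<in> space Q. \<exists>j\<in>T. p \<in> A (y j)}) =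
          measure Q B - measure Q (B \<inter> {p \<in> space Q. \<exists>j\<in>T. p \<in> A (y j)})"
        using B_fin hit by (intro measure_Diff) (auto simp: less_top)
      moreover have "B - B \<inter> {p \<in> space Q. \<exists>j\<in>T. p \<in> A (y j)} = B - {p \<in> space Q. \<exists>j\<in>T. p \<in> A (y j)}"
        by auto
      ultimately show ?thesis by simp
    qed
    also have "\<dots> = FH.m - FH.hit_mass y T"
      using hit by (simp add: FH.hit_mass_def mu_eq B_space)
    finally show "V y (insert a (X \<union> T)) - V y (X \<union> T) = FH.m - FH.hit_mass y T" .
  qed
  show "(\<integral>\<^sup>+y. ennreal \<bar>mayer a X S (override_on x y S)\<bar> \<partial>PiM S (\<lambda>_. N))
      \<le> ennreal (weight z S * (exp g - 1))" if "S \<noteq> {}"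
  proof -
    have "mayer a X S (override_on x y S) = FH.kern S (override_on x y S)" for y
      using disj by (intro eq fin) (auto simp: override_on_def)
    then show ?thesis using FH.kern_bound[OF fin(2) that, of x] by simp
  qed
  show "\<bar>mayer a X {} x\<bar> \<le> 1" using FH.kern_empty[of x] by (subst eq) auto
qed

lemma V_measurable:
  fixes J :: "'i set"
  assumes "finite J"
  shows "(\<lambda>x. V x J) \<in> borel_measurable (PiM UNIV (\<lambda>_. N))"
proof -
  have [measurable]: "countable J" using assms by (rule countable_finite)
  have "Measurable.pred (PiM UNIV (\<lambda>_::'i. N) \<Otimes>\<^sub>M Q) (\<lambda>(x, p). \<exists>j\<in>J. p \<in> A (x j))"
    by measurable
  then have "{w \<in> space (PiM UNIV (\<lambda>_::'i. N) \<Otimes>\<^sub>M Q). \<exists>j\<in>J. snd w \<in> A (fst w j)}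
      \<in> sets (PiM UNIV (\<lambda>_::'i. N) \<Otimes>\<^sub>M Q)"
    by (simp add: pred_def case_prod_beta')
  from Q.measurable_emeasure_Pair[OF this]
  have "(\<lambda>x. emeasure Q {p \<in> space Q. \<exists>j\<in>J. p \<in> A (x j)}) \<in> borel_measurable (PiM UNIV (\<lambda>_. N))"
    by (simp add: space_pair_measure space_PiM space_N vimage_def PiE_def Pi_def cong: measurable_cong)
  then show ?thesis
    unfolding V_def measure_def by measurable
qed

lemma rho_measurable:
  assumes "finite J"
  shows "(\<lambda>x. rho x J) \<in> borel_measurable (PiM UNIV (\<lambda>_. N))"
  unfolding rho_def using V_measurable[OF assms] by measurable

lemma mayer_measurable:
  assumes "finite X" "finite S"
  shows "mayer a X S \<in> borel_measurable (PiM UNIV (\<lambda>_. N))"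
proof -
  have "finite T" if "T \<in> Pow S" for T using that assms finite_subset by auto
  then show ?thesis
    unfolding mayer_def[abs_def] mobius_def using assms(1)
    by (intro borel_measurable_sum borel_measurable_times borel_measurable_const
      borel_measurable_exp[THEN measurable_compose[rotated]] borel_measurable_uminus borel_measurable_diff V_measurable) auto
qed

lemma ursell_rho_measurable:
  assumes "finite X" "finite Y"
  shows "(\<lambda>x. ursell (rho x) X Y) \<in> borel_measurable (PiM UNIV (\<lambda>_. N))"
proof -
  let ?r = "\<lambda>x J. if finite J then rho x J else 0"
  have "ursell (rho x) X Y = ursell (?r x) X Y" for x
    using assms by (intro ursell_cong) (auto simp: finite_subset)
  moreover have "(\<lambda>x. ursell (?r x) X Y) \<in> borel_measurable (PiM UNIV (\<lambda>_. N))"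
  proof (rule measurable_ursell)
    show "(\<lambda>x. if finite J then rho x J else 0) \<in> borel_measurable (PiM UNIV (\<lambda>_. N))" for J :: "'i set"
      using rho_measurable by (cases "finite J") auto
  qed
  ultimately show ?thesis by simp
qed

section \<open>The recursion and its integrated form\<close>

lemma ursell_rho_insert:
  assumes "finite Y"
  shows "ursell (rho x) (insert a X) Y = (\<Sum>S\<in>Pow Y. mayer a X S x * ursell (rho x) (X \<union> S) (Y - S))"
proof (rule ursell_insert[OF assms])
  fix T assume "T \<subseteq> Y"
  then have "finite T" using assms finite_subset by auto
  then show "rho x (insert a (X \<union> T)) = rho x (X \<union> T) * (\<Sum>S\<in>Pow T. mayer a X S x)"
    unfolding mayer_def by (subst sum_mobius) (auto simp: rho_def simp flip: exp_add)
qed simp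

lemma mayer_cong:
  assumes "\<And>j. j \<in> insert a (X \<union> S) \<Longrightarrow> x j = y j"
  shows "mayer a X S x = mayer a X S y"
  unfolding mayer_def mobius_def
  using assms by (intro sum.cong arg_cong2[where f = "(*)"] arg_cong[where f = exp]
    arg_cong[where f = uminus] arg_cong2[where f = "(-)"] V_cong refl) auto

text \<open>One recursion step under the integral. The points of \<open>S\<close> turn into roots
  and are integrated last; those of \<open>Y - S\<close> are integrated first, while the points of
  \<open>S\<close> are frozen. For this reason the bound \<open>b S\<close> has to hold for every
  configuration \<open>x\<close>, after which it leaves the outer integral as a constant.\<close>

lemma ursell_integral_le:
  fixes x :: "'i \<Rightarrow> 'x"
  assumes fin: "finite X" "finite Y" and disj: "a \<notin> Y" "X \<inter> Y = {}"
  defines "I \<equiv> \<lambda>X Y x. \<integral>\<^sup>+y. ennreal \<bar>ursell (rho (override_on x y Y)) X Y\<bar> \<partial>PiM Y (\<lambda>_. N)"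
  assumes b: "\<And>S x. S \<subseteq> Y \<Longrightarrow> I (X \<union> S) (Y - S) x \<le> ennreal (b S)" and b0: "\<And>S. 0 \<le> b S"
  shows "I (insert a X) Y x \<le> ennreal (b {} + (exp g - 1) * (\<Sum>S\<in>Pow Y - {{}}. weight z S * b S))"
proof -
  have w: "weight z S \<ge> 0" for S :: "'i set" using z_pos by (simp add: weight_def)
  have g: "exp g - 1 \<ge> 0" using g_nonneg by simp
  have finS: "finite S" if "S \<subseteq> Y" for S using that fin finite_subset by auto
  have [measurable]: "(\<lambda>y. override_on x y S) \<in> PiM S (\<lambda>_. N) \<rightarrow>\<^sub>M PiM UNIV (\<lambda>_. N)" for x S
    by (rule measurable_override_on) (simp add: space_N)
  have meas: "(\<lambda>y. ennreal \<bar>mayer a X S y\<bar> * ennreal \<bar>ursell (rho y) (X \<union> S) (Y - S)\<bar>)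
      \<in> borel_measurable (PiM UNIV (\<lambda>_. N))" if "S \<subseteq> Y" for S
    using mayer_measurable[OF fin(1) finS[OF that], of a]
      ursell_rho_measurable[OF finite_UnI[OF fin(1) finS[OF that]] finite_Diff[OF fin(2)]] by measurable
  have split: "(\<integral>\<^sup>+y. ennreal \<bar>mayer a X S (override_on x y Y)\<bar> *
      ennreal \<bar>ursell (rho (override_on x y Y)) (X \<union> S) (Y - S)\<bar> \<partial>PiM Y (\<lambda>_. N)) \<le>
      (\<integral>\<^sup>+s. ennreal \<bar>mayer a X S (override_on x s S)\<bar> \<partial>PiM S (\<lambda>_. N)) * ennreal (b S)"
    if S: "S \<subseteq> Y" for S
  proof -
    have un: "S \<union> (Y - S) = Y" using S by auto
    have [measurable]: "mayer a X S \<in> borel_measurable (PiM UNIV (\<lambda>_. N))"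
      using fin finS[OF S] by (intro mayer_measurable)
    have [measurable]: "(\<lambda>x. ursell (rho x) (X \<union> S) (Y - S)) \<in> borel_measurable (PiM UNIV (\<lambda>_. N))"
      using fin finS[OF S] by (intro ursell_rho_measurable) auto
    have "(\<integral>\<^sup>+y. ennreal \<bar>mayer a X S (override_on x y Y)\<bar> *
      ennreal \<bar>ursell (rho (override_on x y Y)) (X \<union> S) (Y - S)\<bar> \<partial>PiM Y (\<lambda>_. N)) =
      (\<integral>\<^sup>+s. \<integral>\<^sup>+t. ennreal \<bar>mayer a X S (override_on (override_on x s S) t (Y - S))\<bar> *
      ennreal \<bar>ursell (rho (override_on (override_on x s S) t (Y - S))) (X \<union> S) (Y - S)\<bar>
        \<partial>PiM (Y - S) (\<lambda>_. N) \<partial>PiM S (\<lambda>_. N))"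
      by (rule PN.nn_integral_fold_override_on[of S "Y - S" x
        "\<lambda>y. ennreal \<bar>mayer a X S y\<bar> * ennreal \<bar>ursell (rho y) (X \<union> S) (Y - S)\<bar>", unfolded un])
        (use fin finS[OF S] meas[OF S] in \<open>auto simp: space_N\<close>)
    also have "\<dots> = (\<integral>\<^sup>+s. \<integral>\<^sup>+t. ennreal \<bar>mayer a X S (override_on x s S)\<bar> *
      ennreal \<bar>ursell (rho (override_on (override_on x s S) t (Y - S))) (X \<union> S) (Y - S)\<bar>
        \<partial>PiM (Y - S) (\<lambda>_. N) \<partial>PiM S (\<lambda>_. N))"
      using disj S by (intro nn_integral_cong arg_cong2[where f = "(*)"] arg_cong[where f = "\<lambda>t. ennreal \<bar>t\<bar>"]
          mayer_cong refl) (auto simp: override_on_def)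
    also have "\<dots> = (\<integral>\<^sup>+s. ennreal \<bar>mayer a X S (override_on x s S)\<bar> *
        I (X \<union> S) (Y - S) (override_on x s S) \<partial>PiM S (\<lambda>_. N))"
      unfolding I_def by (intro nn_integral_cong nn_integral_cmult) measurable
    also have "\<dots> \<le> (\<integral>\<^sup>+s. ennreal \<bar>mayer a X S (override_on x s S)\<bar> * ennreal (b S) \<partial>PiM S (\<lambda>_. N))"
      by (intro nn_integral_mono mult_left_mono b S) auto
    also have "\<dots> = (\<integral>\<^sup>+s. ennreal \<bar>mayer a X S (override_on x s S)\<bar> \<partial>PiM S (\<lambda>_. N)) * ennreal (b S)"
      by (intro nn_integral_multc) measurable
    finally show ?thesis .
  qed
  have "I (insert a X) Y x \<le> (\<integral>\<^sup>+y. (\<Sum>S\<in>Pow Y. ennreal \<bar>mayer a X S (override_on x y Y)\<bar> *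
      ennreal \<bar>ursell (rho (override_on x y Y)) (X \<union> S) (Y - S)\<bar>) \<partial>PiM Y (\<lambda>_. N))"
    unfolding I_def
  proof (intro nn_integral_mono)
    fix y
    let ?u = "override_on x y Y"
    have "\<bar>ursell (rho ?u) (insert a X) Y\<bar> \<le> (\<Sum>S\<in>Pow Y. \<bar>mayer a X S ?u\<bar> * \<bar>ursell (rho ?u) (X \<union> S) (Y - S)\<bar>)"
      unfolding ursell_rho_insert[OF fin(2)] abs_mult[symmetric] by (rule sum_abs)
    then have "ennreal \<bar>ursell (rho ?u) (insert a X) Y\<bar> \<le>
        ennreal (\<Sum>S\<in>Pow Y. \<bar>mayer a X S ?u\<bar> * \<bar>ursell (rho ?u) (X \<union> S) (Y - S)\<bar>)"
      by (rule ennreal_leI)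
    also have "\<dots> = (\<Sum>S\<in>Pow Y. ennreal \<bar>mayer a X S ?u\<bar> * ennreal \<bar>ursell (rho ?u) (X \<union> S) (Y - S)\<bar>)"
      by (subst sum_ennreal[symmetric]) (auto simp: ennreal_mult)
    finally show "ennreal \<bar>ursell (rho ?u) (insert a X) Y\<bar> \<le> \<dots>" .
  qed
  also have "\<dots> = (\<Sum>S\<in>Pow Y. \<integral>\<^sup>+y. ennreal \<bar>mayer a X S (override_on x y Y)\<bar> *
      ennreal \<bar>ursell (rho (override_on x y Y)) (X \<union> S) (Y - S)\<bar> \<partial>PiM Y (\<lambda>_. N))"
  proof (intro nn_integral_sum)
    fix S assume "S \<in> Pow Y"
    then show "(\<lambda>y. ennreal \<bar>mayer a X S (override_on x y Y)\<bar> *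
      ennreal \<bar>ursell (rho (override_on x y Y)) (X \<union> S) (Y - S)\<bar>) \<in> borel_measurable (PiM Y (\<lambda>_. N))"
      by (intro measurable_compose[OF _ meas]) auto
  qed
  also have "\<dots> \<le> (\<Sum>S\<in>Pow Y. ennreal ((if S = {} then 1 else weight z S * (exp g - 1)) * b S))"
  proof (rule sum_mono)
    fix S assume "S \<in> Pow Y"
    then have S: "S \<subseteq> Y" by auto
    have "(\<integral>\<^sup>+s. ennreal \<bar>mayer a X S (override_on x s S)\<bar> \<partial>PiM S (\<lambda>_. N)) \<le>
        ennreal (if S = {} then 1 else weight z S * (exp g - 1))"
    proof (cases "S = {}")
      case True
      then show ?thesis using mayer_bound(2)[of X "{}" a x] fin by (simp add: PiM_empty)
    next
      case False
      with disj S show ?thesis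
        using mayer_bound(1)[OF fin(1) finS[OF S], of a x] by auto
    qed
    then have "(\<integral>\<^sup>+s. ennreal \<bar>mayer a X S (override_on x s S)\<bar> \<partial>PiM S (\<lambda>_. N)) * ennreal (b S) \<le>
        ennreal (if S = {} then 1 else weight z S * (exp g - 1)) * ennreal (b S)"
      by (rule mult_right_mono) auto
    also have "\<dots> = ennreal ((if S = {} then 1 else weight z S * (exp g - 1)) * b S)"
      using w g b0 by (intro ennreal_mult[symmetric]) auto
    finally show "(\<integral>\<^sup>+y. ennreal \<bar>mayer a X S (override_on x y Y)\<bar> *
      ennreal \<bar>ursell (rho (override_on x y Y)) (X \<union> S) (Y - S)\<bar> \<partial>PiM Y (\<lambda>_. N)) \<le> \<dots>"
      using split[OF S] by (rule order_trans[rotated])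
  qed
  also have "\<dots> = ennreal (\<Sum>S\<in>Pow Y. (if S = {} then 1 else weight z S * (exp g - 1)) * b S)"
    using w g b0 by (intro sum_ennreal) auto
  also have "(\<Sum>S\<in>Pow Y. (if S = {} then 1 else weight z S * (exp g - 1)) * b S) =
      b {} + (exp g - 1) * (\<Sum>S\<in>Pow Y - {{}}. weight z S * b S)"
    using fin(2) by (subst sum.remove[of _ "{}"]) (auto simp: sum_distrib_left mult_ac intro!: sum.cong)
  finally show ?thesis .
qed

text \<open>All sets \<open>S\<close> with \<open>c\<close> points together contribute
  \<open>weight (z / 4) Y * (1 / 2) ^ c\<close>: the factor \<open>2 ^ c\<close> for the new roots
  is set against \<open>4 ^ c\<close> gained by passing from base \<open>4 / z\<close> to base
  \<open>1 / z\<close>. The sum over \<open>c \<ge> 1\<close> is at most 1, which is the reason for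
  the number 4.\<close>

lemma weight_geometric:
  assumes "finite Y"
  shows "(\<Sum>S\<in>Pow Y - {{}}. weight z S * (2 ^ card S * weight (z / 4) (Y - S))) \<le> weight (z / 4) Y"
proof -
  define n where "n = card Y"
  define u where "u c = (if c = 0 then 0 else fact c / z ^ c * (2 ^ c * (fact (n - c) / (z / 4) ^ (n - c))))" for c
  have "(\<Sum>S\<in>Pow Y - {{}}. weight z S * (2 ^ card S * weight (z / 4) (Y - S))) = (\<Sum>S\<in>Pow Y - {{}}. u (card S))"
    using assms finite_subset[of _ Y]
    by (intro sum.cong) (auto simp: u_def weight_def n_def card_Diff_subset)
  also have "\<dots> = (\<Sum>S\<in>Pow Y. u (card S))"
    using assms by (intro sum.mono_neutral_left) (auto simp: u_def)
  also have "\<dots> = (\<Sum>c\<le>n. of_nat (n choose c) * u c)"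
    unfolding n_def by (rule sum_Pow_card[OF assms])
  also have "\<dots> = (\<Sum>c=1..n. of_nat (n choose c) * u c)"
    by (intro sum.mono_neutral_right) (auto simp: u_def)
  also have "\<dots> = (\<Sum>c=1..n. weight (z / 4) Y * (1 / 2) ^ c)"
  proof (rule sum.cong)
    fix c assume c: "c \<in> {1..n}"
    have "(4::real) ^ n = 4 ^ (n - c) * 4 ^ c"
      using c by (simp flip: power_add)
    also have "(4::real) ^ c = 2 ^ c * 2 ^ c"
      by (simp flip: power_mult_distrib)
    finally have "(4::real) ^ n = 4 ^ (n - c) * 2 ^ c * 2 ^ c" by simp
    then show "of_nat (n choose c) * u c = weight (z / 4) Y * (1 / 2) ^ c"
      using c z_pos
      by (simp add: u_def weight_def n_def[symmetric] binomial_fact power_diff power_divide field_simps)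
  qed simp
  also have "\<dots> = weight (z / 4) Y * (\<Sum>c=1..n. (1 / 2) ^ c)"
    by (simp add: sum_distrib_left)
  also have "\<dots> \<le> weight (z / 4) Y * 1"
  proof (rule mult_left_mono)
    have "(\<Sum>c=1..n. (1 / 2) ^ c) = 1 - (1 / 2 :: real) ^ n"
      by (induction n) auto
    then show "(\<Sum>c=1..n. (1 / 2) ^ c) \<le> (1::real)" by simp
  qed (use z_pos in \<open>auto simp: weight_def\<close>)
  finally show ?thesis by simp
qed

text \<open>Every step removes one root, so the total number of points decreases. Let
  \<open>X'\<close> be the remaining roots. The term \<open>S = {}\<close> and the sum of all others
  are both at most \<open>2 ^ card X' * weight (z / 4) Y\<close>, the latter since
  \<open>exp g - 1 \<le> 1\<close>; together they restore the factor 2 of the removed root.\<close>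

lemma ursell_integral_bound:
  fixes x :: "'i \<Rightarrow> 'x"
  assumes "exp g \<le> 2" and "finite X" "finite Y" "X \<inter> Y = {}"
  shows "(\<integral>\<^sup>+y. ennreal \<bar>ursell (rho (override_on x y Y)) X Y\<bar> \<partial>PiM Y (\<lambda>_. N)) \<le>
    ennreal (2 ^ card X * weight (z / 4) Y)"
  using assms(2-4)
proof (induction "card X + card Y" arbitrary: X Y x rule: less_induct)
  case less
  have w: "weight (z / 4) S \<ge> 0" for S :: "'i set" using z_pos by (simp add: weight_def)
  show ?case
  proof (cases "X = {}")
    case True
    then show ?thesis
      using less.prems by (simp add: ursell_empty weight_def PiM_empty)
  next
    case False
    then obtain a X' where X: "X = insert a X'" "a \<notin> X'" by (meson Set.set_insert ex_in_conv)
    have fin: "finite X'" "finite Y" "a \<notin> Y" "X' \<inter> Y = {}" using less.prems X by auto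
    have "(\<integral>\<^sup>+y. ennreal \<bar>ursell (rho (override_on x y Y)) X Y\<bar> \<partial>PiM Y (\<lambda>_. N)) \<le>
      ennreal (2 ^ card X' * 2 ^ card ({}::'i set) * weight (z / 4) (Y - {}) + (exp g - 1) * (\<Sum>S\<in>Pow Y - {{}}. weight z S *
        (2 ^ card X' * 2 ^ card S * weight (z / 4) (Y - S))))"
      unfolding X
    proof (rule ursell_integral_le[OF fin])
      fix S x assume S: "S \<subseteq> Y"
      then have "finite S" using fin finite_subset by auto
      then have c: "card (X' \<union> S) = card X' + card S" "card (Y - S) = card Y - card S" "card S \<le> card Y"
        using fin S by (auto simp: card_Un_disjnt disjnt_def card_Diff_subset card_mono intro!: card_Un_disjoint)
      have "(\<integral>\<^sup>+y. ennreal \<bar>ursell (rho (override_on x y (Y - S))) (X' \<union> S) (Y - S)\<bar> \<partial>PiM (Y - S) (\<lambda>_. N))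
          \<le> ennreal (2 ^ card (X' \<union> S) * weight (z / 4) (Y - S))"
        using fin S \<open>finite S\<close> X c by (intro less.hyps) auto
      then show "(\<integral>\<^sup>+y. ennreal \<bar>ursell (rho (override_on x y (Y - S))) (X' \<union> S) (Y - S)\<bar> \<partial>PiM (Y - S) (\<lambda>_. N))
          \<le> ennreal (2 ^ card X' * 2 ^ card S * weight (z / 4) (Y - S))"
        by (simp add: c power_add)
    qed (use w in auto)
    also have "\<dots> \<le> ennreal (2 ^ card X * weight (z / 4) Y)"
    proof (rule ennreal_leI)
      have "(\<Sum>S\<in>Pow Y - {{}}. weight z S * (2 ^ card X' * 2 ^ card S * weight (z / 4) (Y - S))) =
         2 ^ card X' * (\<Sum>S\<in>Pow Y - {{}}. weight z S * (2 ^ card S * weight (z / 4) (Y - S)))"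
        by (simp add: sum_distrib_left mult_ac)
      also have "\<dots> \<le> 2 ^ card X' * weight (z / 4) Y"
        by (intro mult_left_mono weight_geometric fin) auto
      finally have le: "(\<Sum>S\<in>Pow Y - {{}}. weight z S * (2 ^ card X' * 2 ^ card S * weight (z / 4) (Y - S)))
          \<le> 2 ^ card X' * weight (z / 4) Y" .
      have "(exp g - 1) * (\<Sum>S\<in>Pow Y - {{}}. weight z S * (2 ^ card X' * 2 ^ card S * weight (z / 4) (Y - S)))
          \<le> 1 * (2 ^ card X' * weight (z / 4) Y)"
        using assms(1) g_nonneg w z_pos by (intro mult_mono le sum_nonneg) (auto simp: weight_def)
      then show "2 ^ card X' * 2 ^ card ({}::'i set) * weight (z / 4) (Y - {}) + (exp g - 1) * (\<Sum>S\<in>Pow Y - {{}}. weight z S *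
        (2 ^ card X' * 2 ^ card S * weight (z / 4) (Y - S))) \<le> 2 ^ card X * weight (z / 4) Y"
        using X fin by simp
    qed
    finally show ?thesis .
  qed
qed

text \<open>When the only root is removed, the term \<open>S = {}\<close> has no roots left and
  vanishes. All other terms carry the factor \<open>exp g - 1\<close>, which becomes the factor
  \<open>\<lambda> M(a)\<close> of \<open>H(a)\<close>.\<close>

lemma ursell_singleton_bound:
  fixes x :: "'i \<Rightarrow> 'x"
  assumes "exp g \<le> 2" "finite Y" "a \<notin> Y" "Y \<noteq> {}"
  shows "(\<integral>\<^sup>+y. ennreal \<bar>ursell (rho (override_on x y Y)) {a} Y\<bar> \<partial>PiM Y (\<lambda>_. N)) \<le>
    ennreal ((exp g - 1) * weight (z / 4) Y)"
proof -
  let ?b = "\<lambda>S. if S = {} then 0 else 2 ^ card S * weight (z / 4) (Y - S)"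
  have w: "weight (z / 4) S \<ge> 0" for S :: "'i set" using z_pos by (simp add: weight_def)
  have "(\<integral>\<^sup>+y. ennreal \<bar>ursell (rho (override_on x y Y)) {a} Y\<bar> \<partial>PiM Y (\<lambda>_. N)) \<le>
      ennreal (?b {} + (exp g - 1) * (\<Sum>S\<in>Pow Y - {{}}. weight z S * ?b S))"
  proof (rule ursell_integral_le)
    fix S x assume S: "S \<subseteq> Y"
    show "(\<integral>\<^sup>+y. ennreal \<bar>ursell (rho (override_on x y (Y - S))) ({} \<union> S) (Y - S)\<bar> \<partial>PiM (Y - S) (\<lambda>_. N))
          \<le> ennreal (?b S)"
    proof (cases "S = {}")
      case True
      then show ?thesis using assms by (simp add: ursell_empty)
    next
      case False
      then show ?thesis
        using ursell_integral_bound[of S "Y - S" x] assms S finite_subset[OF S] by auto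
    qed
  qed (use assms w in auto)
  also have "\<dots> \<le> ennreal ((exp g - 1) * weight (z / 4) Y)"
  proof (rule ennreal_leI)
    have "(\<Sum>S\<in>Pow Y - {{}}. weight z S * ?b S) =
        (\<Sum>S\<in>Pow Y - {{}}. weight z S * (2 ^ card S * weight (z / 4) (Y - S)))"
      by (intro sum.cong) auto
    also have "\<dots> \<le> weight (z / 4) Y" by (rule weight_geometric[OF assms(2)])
    finally show "?b {} + (exp g - 1) * (\<Sum>S\<in>Pow Y - {{}}. weight z S * ?b S) \<le> (exp g - 1) * weight (z / 4) Y"
      using g_nonneg by (simp add: mult_left_mono)
  qed
  finally show ?thesis .
qed

end

section \<open>Mixed cumulants\<close>

text \<open>If differentiating \<open>r\<close> inserts \<open>l\<close> into its index set, so does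
  differentiating its Ursell functions. Apply the quotient rule to the recursive definition; the
  result is recognised by splitting the defining relation for \<open>insert l T\<close> according to
  whether \<open>S\<close> contains \<open>l\<close>.\<close>

lemma has_vector_derivative_ursell:
  fixes r :: "real \<Rightarrow> 'i set \<Rightarrow> complex"
  assumes "finite T" "l \<notin> X \<union> T" "r t {} \<noteq> 0"
    and r: "\<And>J. J \<subseteq> X \<union> T \<Longrightarrow> ((\<lambda>t. r t J) has_vector_derivative r t (insert l J)) (at t)"
  shows "((\<lambda>t. ursell (r t) X T) has_vector_derivative ursell (r t) X (insert l T)) (at t)"
  using assms(1,2) r
proof (induction T rule: finite_psubset_induct)
  case (psubset T)
  let ?U = "\<lambda>t. ursell (r t) X"
  let ?P = "Pow T - {T}"
  have IH: "((\<lambda>t. ?U t S) has_vector_derivative ?U t (insert l S)) (at t)" if "S \<in> ?P" for S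
    using that psubset.prems by (intro psubset.IH) auto
  have fin: "finite T" "l \<notin> T" using psubset by auto
  define G where "G t = r t (X \<union> T) - (\<Sum>S\<in>?P. ?U t S * r t (T - S))" for t
  define G' where "G' = r t (insert l (X \<union> T)) -
    (\<Sum>S\<in>?P. ?U t S * r t (insert l (T - S)) + ?U t (insert l S) * r t (T - S))"
  have G: "(G has_vector_derivative G') (at t)"
    unfolding G_def G'_def
  proof (intro has_vector_derivative_diff has_vector_derivative_sum)
    fix S assume "S \<in> ?P"
    then show "((\<lambda>t. ?U t S * r t (T - S)) has_vector_derivative
        ?U t S * r t (insert l (T - S)) + ?U t (insert l S) * r t (T - S)) (at t)"
      by (intro has_vector_derivative_mult IH psubset.prems) auto
  qed (intro psubset.prems subset_refl)
  have U_eq: "?U t T = G t / r t {}" for t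
    using fin by (subst ursell.simps) (simp add: G_def)
  have r0: "((\<lambda>t. r t {}) has_vector_derivative r t {l}) (at t)"
    using psubset.prems(2)[of "{}"] by simp
  have "((\<lambda>t. G t / r t {}) has_vector_derivative (G' - ?U t T * r t {l}) / r t {}) (at t)"
    using has_derivative_divide[OF G[unfolded has_vector_derivative_def] r0[unfolded has_vector_derivative_def] assms(3)]
    unfolding has_vector_derivative_def U_eq
    by (rule has_derivative_eq_rhs) (simp add: fun_eq_iff field_simps scaleR_conv_of_real assms(3))
  also have "(G' - ?U t T * r t {l}) / r t {} = ?U t (insert l T)"
  proof -
    have "r t (insert l (X \<union> T)) = (\<Sum>S\<in>Pow (insert l T). ?U t S * r t (insert l T - S))"
      using fin assms(3) by (subst ursell_conv) auto
    also have "\<dots> = (\<Sum>S\<in>Pow T. ?U t S * r t (insert l T - S)) +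
        (\<Sum>S\<in>Pow T. ?U t (insert l S) * r t (insert l T - insert l S))"
      by (rule sum_Pow_insert[OF fin])
    also have "(\<Sum>S\<in>Pow T. ?U t S * r t (insert l T - S)) = (\<Sum>S\<in>Pow T. ?U t S * r t (insert l (T - S)))"
      using fin by (intro sum.cong arg_cong2[where f = "(*)"] arg_cong[where f = "r t"]) auto
    also have "(\<Sum>S\<in>Pow T. ?U t (insert l S) * r t (insert l T - insert l S)) =
        (\<Sum>S\<in>Pow T. ?U t (insert l S) * r t (T - S))"
      using fin by (intro sum.cong arg_cong2[where f = "(*)"] arg_cong[where f = "r t"]) auto
    finally have "G' = ?U t T * r t {l} + ?U t (insert l T) * r t {}"
      unfolding G'_def
      by (simp add: sum_Pow_split[OF fin(1)] sum.distrib)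
    then show ?thesis using assms(3) by simp
  qed
  finally show ?case by (simp add: U_eq)
qed

lemma has_vector_derivative_quadratic:
  fixes f :: "real \<Rightarrow> 'a::real_normed_vector"
  assumes "\<And>u. norm (f u - f t - (u - t) *\<^sub>R d) \<le> C * (u - t)\<^sup>2"
  shows "(f has_vector_derivative d) (at t)"
  unfolding has_vector_derivative_def
proof (rule has_derivativeI_sandwich[of 1])
  show "norm (f u - f t - (u - t) *\<^sub>R d) / norm (u - t) \<le> C * \<bar>u - t\<bar>" if "u \<noteq> t" for u
    using assms[of u] that by (simp add: field_simps power2_eq_square abs_mult_self_eq)
  have "((\<lambda>u. C * \<bar>u - t\<bar>) \<longlongrightarrow> C * \<bar>t - t\<bar>) (at t)" by (intro tendsto_intros)
  then show "((\<lambda>u. C * \<bar>u - t\<bar>) \<longlongrightarrow> 0) (at t)" by simp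
qed (auto intro: bounded_linear_scaleR_left)

text \<open>Differentiation under the integral through a Taylor estimate uniform in
  \<open>\<omega>\<close>: as \<open>Y\<close> and \<open>B\<close> are bounded by 1, the remainder
  is at most \<open>(u - t)^2\<close>. The prefactor \<open>B\<close> collects what earlier
  derivatives have produced.\<close>

lemma has_vector_derivative_fun_upd_exp_integral:
  fixes Y :: "'i \<Rightarrow> 'w \<Rightarrow> real" and B :: "'w \<Rightarrow> complex"
  assumes "prob_space M"
    and [measurable]: "\<And>j. Y j \<in> borel_measurable M" "B \<in> borel_measurable M"
    and Y: "\<And>j \<omega>. \<bar>Y j \<omega>\<bar> \<le> 1" and B: "\<And>\<omega>. cmod (B \<omega>) \<le> 1" and l: "finite I" "l \<in> I"
  shows "((\<lambda>t. \<integral>\<omega>. B \<omega> * exp (- \<i> * complex_of_real (\<Sum>j\<in>I. (s(l := t)) j * Y j \<omega>)) \<partial>M)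
    has_vector_derivative
      (\<integral>\<omega>. (- \<i> * Y l \<omega> * B \<omega>) * exp (- \<i> * complex_of_real (\<Sum>j\<in>I. (s(l := t)) j * Y j \<omega>)) \<partial>M)) (at t)"
proof (rule has_vector_derivative_quadratic[where C = 1])
  fix u
  interpret prob_space M by fact
  define e where "e t \<omega> = exp (- \<i> * complex_of_real (\<Sum>j\<in>I. (s(l := t)) j * Y j \<omega>))" for t \<omega>
  have e_norm: "cmod (e t \<omega>) = 1" for t \<omega> by (simp add: e_def norm_exp_eq_Re)
  have [measurable]: "e t \<in> borel_measurable M" for t unfolding e_def by measurable
  have int: "integrable M (\<lambda>\<omega>. B \<omega> * e t \<omega>)" "integrable M (\<lambda>\<omega>. (- \<i> * Y l \<omega> * B \<omega>) * e t \<omega>)" for t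
    using B Y by (auto intro!: integrable_const_bound[where B = 1] AE_I2 mult_le_one simp: norm_mult e_norm)
  have e_u: "e u \<omega> = e t \<omega> * exp (- \<i> * complex_of_real ((u - t) * Y l \<omega>))" for \<omega>
  proof -
    have "(\<Sum>j\<in>I. (s(l := v)) j * Y j \<omega>) = v * Y l \<omega> + (\<Sum>j\<in>I - {l}. s j * Y j \<omega>)" for v
      using l by (subst sum.remove[OF l]) auto
    then show ?thesis
      unfolding e_def by (simp add: algebra_simps flip: exp_add)
  qed
  have "cmod (B \<omega> * e u \<omega> - B \<omega> * e t \<omega> - (u - t) *\<^sub>R ((- \<i> * Y l \<omega> * B \<omega>) * e t \<omega>)) \<le> (u - t)\<^sup>2" for \<omega>
  proof -
    define x where "x = - ((u - t) * Y l \<omega>)"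
    have "B \<omega> * e u \<omega> - B \<omega> * e t \<omega> - (u - t) *\<^sub>R ((- \<i> * Y l \<omega> * B \<omega>) * e t \<omega>) =
       B \<omega> * e t \<omega> * (iexp x - (\<Sum>k\<le>1. (\<i> * x) ^ k / fact k))"
      by (simp add: e_u x_def algebra_simps scaleR_conv_of_real)
    also have "cmod \<dots> \<le> 1 * (\<bar>x\<bar> ^ Suc 1 / fact (Suc 1))"
      unfolding norm_mult e_norm using B[of \<omega>] by (intro mult_mono iexp_approx1) auto
    also have "\<dots> \<le> x\<^sup>2" using zero_le_power2[of x] by (simp add: power2_eq_square)
    also have "\<dots> \<le> (u - t)\<^sup>2"
      using Y[of l \<omega>] mult_left_le[of "\<bar>Y l \<omega>\<bar>" "\<bar>u - t\<bar>"] unfolding x_def by (simp add: abs_le_square_iff[symmetric] abs_mult)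
    finally show ?thesis .
  qed note le = this
  have "cmod (\<integral>\<omega>. B \<omega> * e u \<omega> - B \<omega> * e t \<omega> - (u - t) *\<^sub>R ((- \<i> * Y l \<omega> * B \<omega>) * e t \<omega>) \<partial>M) \<le>
      (\<integral>\<omega>. (u - t)\<^sup>2 \<partial>M)"
    using le int by (intro order_trans[OF integral_norm_bound integral_mono]) auto
  then show "cmod ((\<integral>\<omega>. B \<omega> * exp (- \<i> * complex_of_real (\<Sum>j\<in>I. (s(l := u)) j * Y j \<omega>)) \<partial>M) -
      (\<integral>\<omega>. B \<omega> * exp (- \<i> * complex_of_real (\<Sum>j\<in>I. (s(l := t)) j * Y j \<omega>)) \<partial>M) -
      (u - t) *\<^sub>R (\<integral>\<omega>. (- \<i> * Y l \<omega> * B \<omega>) * exp (- \<i> * complex_of_real (\<Sum>j\<in>I. (s(l := t)) j * Y j \<omega>)) \<partial>M))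
      \<le> 1 * (u - t)\<^sup>2"
    unfolding e_def[symmetric] using int by (simp add: prob_space)
qed

text \<open>The logarithmic derivative at \<open>s\<^sub>k\<close> is an Ursell function of the exponentially weighted moments
  \<open>E s\<close>, and each further derivative adds its index to the set. Passing from \<open>Y\<close> to \<open>1 - Y\<close>
  only adds a linear term to the logarithm.\<close>

lemma mixed_cumulant_one_minus:
  fixes Y :: "nat \<Rightarrow> 'w \<Rightarrow> real"
  assumes M: "prob_space M"
    and Ym[measurable]: "\<And>j. Y j \<in> borel_measurable M"
    and Y: "\<And>j \<omega>. 0 \<le> Y j \<omega>" "\<And>j \<omega>. Y j \<omega> \<le> 1" and k: "2 \<le> k"
  shows "mixed_cumulant M k (\<lambda>j \<omega>. 1 - Y j \<omega>) =
    (- 1) ^ k * complex_of_real (ursell (\<lambda>J. \<integral>\<omega>. (\<Prod>j\<in>J. Y j \<omega>) \<partial>M) {k} {1..<k})"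
proof -
  interpret prob_space M by fact
  define E where "E s J = (\<integral>\<omega>. (\<Prod>j\<in>J. - \<i> * Y j \<omega>) *
    exp (- \<i> * complex_of_real (\<Sum>j\<in>{1..k}. s j * Y j \<omega>)) \<partial>M)" for s J
  define U where "U s T = ursell (E s) {k} T" for s T
  \<comment> \<open>On this cube the \<open>k\<close> coordinates have absolute sum below 1. Both
    characteristic functions then stay within distance 1 of 1, hence away from 0 and inside the
    domain where \<open>Ln\<close> is differentiable.\<close>
  define N where "N = {s :: nat \<Rightarrow> real. \<forall>j\<in>{1..k}. \<bar>s j\<bar> < 1 / (k + 1)}"
  define \<Phi> where "\<Phi> s = (\<integral>\<omega>. exp (\<i> * complex_of_real (\<Sum>j=1..k. s j * (1 - Y j \<omega>))) \<partial>M)" for s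
  have E_deriv: "((\<lambda>t. E (s(l := t)) J) has_vector_derivative E (s(l := t)) (insert l J)) (at t)"
    if "finite J" "l \<in> {1..k}" "l \<notin> J" for s l J t
  proof -
    have "cmod (\<Prod>j\<in>J. - \<i> * Y j \<omega>) \<le> 1" for \<omega>
      using Y by (auto simp: norm_mult prod_norm[symmetric] intro!: prod_le_1)
    note norm_le = this
    have eq: "(\<Prod>j\<in>insert l J. - \<i> * Y j \<omega>) = - \<i> * Y l \<omega> * (\<Prod>j\<in>J. - \<i> * Y j \<omega>)" for \<omega>
      using that by simp
    show ?thesis
      unfolding E_def eq
    proof (rule has_vector_derivative_fun_upd_exp_integral[OF M Ym _ _ norm_le])
      show "\<bar>Y j \<omega>\<bar> \<le> 1" for j \<omega> using Y[of j \<omega>] by simp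
      show "(\<lambda>\<omega>. \<Prod>j\<in>J. - \<i> * Y j \<omega>) \<in> borel_measurable M" by measurable
    qed (use that in auto)
  qed
  have sum_less: "(\<Sum>j\<in>{1..k}. \<bar>s j\<bar>) < 1" if "s \<in> N" for s
  proof -
    have "(\<Sum>j\<in>{1..k}. \<bar>s j\<bar>) \<le> (\<Sum>j\<in>{1..k}. 1 / (k + 1))"
      using that by (intro sum_mono) (auto simp: N_def intro: less_imp_le)
    also have "\<dots> < 1" by simp
    finally show ?thesis .
  qed
  have close: "cmod ((\<integral>\<omega>. exp (\<i> * complex_of_real (f \<omega>)) \<partial>M) - 1) < 1"
    if [measurable]: "f \<in> borel_measurable M" and f: "\<And>\<omega>. \<bar>f \<omega>\<bar> \<le> c" and "c < 1" for f c
  proof -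
    have int: "integrable M (\<lambda>\<omega>. exp (\<i> * complex_of_real (f \<omega>)))"
      by (intro integrable_const_bound[where B = 1]) auto
    have "cmod (\<integral>\<omega>. exp (\<i> * complex_of_real (f \<omega>)) - 1 \<partial>M) \<le> (\<integral>\<omega>. c \<partial>M)"
    proof (rule order_trans[OF integral_norm_bound integral_mono])
      fix \<omega>
      have "cmod (exp (\<i> * complex_of_real (f \<omega>)) - 1) \<le> \<bar>f \<omega>\<bar>"
        using iexp_approx1[of "f \<omega>" 0] by simp
      also have "\<dots> \<le> c" by (rule f)
      finally show "cmod (exp (\<i> * complex_of_real (f \<omega>)) - 1) \<le> c" .
    qed (use int in auto)
    with int \<open>c < 1\<close> show ?thesis by (simp add: prob_space)
  qed
  have E0: "E s {} \<noteq> 0" if "s \<in> N" for s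
  proof -
    have "\<bar>- (\<Sum>j\<in>{1..k}. s j * Y j \<omega>)\<bar> \<le> (\<Sum>j\<in>{1..k}. \<bar>s j\<bar>)" for \<omega>
      using Y by (auto intro!: sum_abs[THEN order_trans] sum_mono mult_left_le simp: abs_mult)
    from close[OF _ this sum_less[OF that]] have "cmod (E s {} - 1) < 1" by (simp add: E_def)
    then show ?thesis by auto
  qed
  have \<Phi>0: "\<Phi> s \<notin> \<real>\<^sub>\<le>\<^sub>0" if "s \<in> N" for s
  proof -
    have "\<bar>\<Sum>j\<in>{1..k}. s j * (1 - Y j \<omega>)\<bar> \<le> (\<Sum>j\<in>{1..k}. \<bar>s j\<bar>)" for \<omega>
      using Y by (auto intro!: sum_abs[THEN order_trans] sum_mono mult_left_le simp: abs_mult)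
    from close[OF _ this sum_less[OF that]] have "cmod (\<Phi> s - 1) < 1" by (simp add: \<Phi>_def)
    then have "Re (\<Phi> s) > 0"
      using abs_Re_le_cmod[of "\<Phi> s - 1"] by simp
    then show ?thesis by (auto simp: complex_nonpos_Reals_iff)
  qed
  have \<Phi>_eq: "\<Phi> s = exp (\<i> * complex_of_real (\<Sum>j=1..k. s j)) * E s {}" for s
  proof -
    have "exp (\<i> * complex_of_real (\<Sum>j=1..k. s j * (1 - Y j \<omega>))) =
      exp (\<i> * complex_of_real (\<Sum>j=1..k. s j)) * exp (- \<i> * complex_of_real (\<Sum>j\<in>{1..k}. s j * Y j \<omega>))" for \<omega>
      by (simp add: right_diff_distrib sum_subtractf algebra_simps flip: exp_add)
    then show ?thesis by (simp add: \<Phi>_def E_def)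
  qed
  have U_deriv: "((\<lambda>t. U (s(l := t)) T) has_vector_derivative U s (insert l T)) (at (s l))"
    if "s \<in> N" "finite T" "l \<in> {1..<k}" "l \<notin> T" for s l T
    using has_vector_derivative_ursell[of T l "{k}" "\<lambda>t. E (s(l := t))" "s l"] E_deriv[of _ l s "s l"] that E0[OF that(1)]
      finite_subset[of _ "{k} \<union> T"]
    by (auto simp: U_def)
  have upd: "open {- 1 / (k + 1) <..< 1 / (k + 1) :: real}" "s l \<in> {- 1 / (k + 1) <..< 1 / (k + 1)}"
      "\<And>t. t \<in> {- 1 / (k + 1) <..< 1 / (k + 1)} \<Longrightarrow> s(l := t) \<in> N" if "s \<in> N" "l \<in> {1..k}" for s l
  proof -
    have "\<bar>s l\<bar> < 1 / (k + 1)" using that unfolding N_def by blast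
    then show "s l \<in> {- 1 / (k + 1) <..< 1 / (k + 1)}" by (simp add: abs_less_iff minus_less_iff)
    show "s(l := t) \<in> N" if "t \<in> {- 1 / (k + 1) <..< 1 / (k + 1)}" for t
    proof -
      have "\<bar>t\<bar> < 1 / (k + 1)" using that by (simp add: abs_less_iff minus_less_iff)
      with \<open>s \<in> N\<close> show ?thesis by (simp add: N_def)
    qed
  qed simp
  \<comment> \<open>The derivatives are taken from the highest index downwards, so after those at
    \<open>k\<close> down to \<open>Suc j\<close> the index set is \<open>{Suc j..<k}\<close>. The
    constant \<open>c\<close> stands for the \<open>\<i>\<close> left by the linear term; the next
    derivative kills it, and since \<open>k \<ge> 2\<close> there is a next one.\<close>
  have step: "mixed_partial j f (\<lambda>_. 0) = U (\<lambda>_. 0) {1..<k}"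
    if "j < k" "\<And>s. s \<in> N \<Longrightarrow> f s = c + U s {Suc j..<k}" "j = 0 \<Longrightarrow> c = 0" for j f c
    using that
  proof (induction j arbitrary: f c)
    case 0
    have "(\<lambda>_. 0) \<in> N" by (simp add: N_def)
    with 0 show ?case by simp
  next
    case (Suc j)
    have "partial_deriv (Suc j) f s = 0 + U s {Suc j..<k}" if s: "s \<in> N" for s
    proof -
      have "((\<lambda>t. c + U (s(Suc j := t)) {Suc (Suc j)..<k}) has_vector_derivative 0 + U s (insert (Suc j) {Suc (Suc j)..<k}))
          (at (s (Suc j)))"
        using Suc.prems s by (intro has_vector_derivative_add U_deriv has_vector_derivative_const) auto
      also have "insert (Suc j) {Suc (Suc j)..<k} = {Suc j..<k}" using Suc.prems by auto
      finally have "((\<lambda>t. f (s(Suc j := t))) has_vector_derivative 0 + U s {Suc j..<k}) (at (s (Suc j)))"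
      proof (rule has_vector_derivative_transform_within_open[OF _ upd(1,2)[OF s, of "Suc j"]])
        fix t assume "t \<in> {- 1 / (k + 1) <..< 1 / (k + 1)}"
        then have "s(Suc j := t) \<in> N" using Suc.prems by (intro upd(3)[OF s]) auto
        then show "c + U (s(Suc j := t)) {Suc (Suc j)..<k} = f (s(Suc j := t))"
          by (rule Suc.prems(2)[symmetric])
      qed (use Suc.prems in auto)
      then show ?thesis
        unfolding partial_deriv_def by (rule vector_derivative_at)
    qed
    with Suc.prems show ?case by (simp add: Suc.IH[of _ 0])
  qed
  obtain k' where k': "k = Suc k'" "k' \<noteq> 0" using k by (cases k) auto
  have "mixed_partial k (\<lambda>s. Ln (\<Phi> s)) (\<lambda>_. 0) = mixed_partial k' (partial_deriv k (\<lambda>s. Ln (\<Phi> s))) (\<lambda>_. 0)"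
    by (simp add: k')
  also have "\<dots> = U (\<lambda>_. 0) {1..<k}"
  proof (rule step)
    fix s assume s: "s \<in> N"
    have exp_deriv: "((\<lambda>t. exp (\<i> * complex_of_real (\<Sum>j=1..k. (s(k := t)) j))) has_vector_derivative
        \<i> * exp (\<i> * complex_of_real (\<Sum>j=1..k. s j))) (at (s k))"
    proof -
      have eq: "(\<Sum>j=1..k. (s(k := t)) j) = t + (\<Sum>j\<in>{1..k} - {k}. s j)" for t
        using k by (subst sum.remove[of _ k]) auto
      have "((\<lambda>z. exp (\<i> * (z + complex_of_real (\<Sum>j\<in>{1..k} - {k}. s j)))) has_field_derivative
        \<i> * exp (\<i> * complex_of_real (\<Sum>j=1..k. s j))) (at (complex_of_real (s k)))"
        using eq[of "s k"] by (auto intro!: derivative_eq_intros)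
      then have "((\<lambda>t. exp (\<i> * (complex_of_real t + complex_of_real (\<Sum>j\<in>{1..k} - {k}. s j)))) has_vector_derivative
        \<i> * exp (\<i> * complex_of_real (\<Sum>j=1..k. s j))) (at (s k))"
        by (rule has_vector_derivative_real_field)
      then show ?thesis unfolding eq by (simp add: add.commute)
    qed
    have "((\<lambda>t. \<Phi> (s(k := t))) has_vector_derivative
       exp (\<i> * complex_of_real (\<Sum>j=1..k. s j)) * E s {k} + \<i> * exp (\<i> * complex_of_real (\<Sum>j=1..k. s j)) * E s {}) (at (s k))"
      unfolding \<Phi>_eq using has_vector_derivative_mult[OF exp_deriv E_deriv[of "{}" k s "s k"]] k by simp
    from field_vector_diff_chain_at[OF this, of Ln] \<Phi>0[OF s]
    have "((\<lambda>t. Ln (\<Phi> (s(k := t)))) has_vector_derivative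
      (exp (\<i> * complex_of_real (\<Sum>j=1..k. s j)) * E s {k} + \<i> * exp (\<i> * complex_of_real (\<Sum>j=1..k. s j)) * E s {}) *
        inverse (\<Phi> s)) (at (s k))"
      by (simp add: has_field_derivative_Ln o_def)
    also have "(exp (\<i> * complex_of_real (\<Sum>j=1..k. s j)) * E s {k} + \<i> * exp (\<i> * complex_of_real (\<Sum>j=1..k. s j)) * E s {}) *
        inverse (\<Phi> s) = \<i> + U s {Suc k'..<k}"
      using E0[OF s] by (simp add: \<Phi>_eq k' U_def ursell.simps[of _ _ "{}"] field_simps)
    finally show "partial_deriv k (\<lambda>s. Ln (\<Phi> s)) s = \<i> + U s {Suc k'..<k}"
      unfolding partial_deriv_def by (rule vector_derivative_at)
  qed (use k' in auto)
  also have "U (\<lambda>_. 0) {1..<k} = (- \<i>) ^ k * complex_of_real (ursell (\<lambda>J. \<integral>\<omega>. (\<Prod>j\<in>J. Y j \<omega>) \<partial>M) {k} {1..<k})"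
  proof -
    have "E (\<lambda>_. 0) J = (- \<i>) ^ card J * complex_of_real (\<integral>\<omega>. (\<Prod>j\<in>J. Y j \<omega>) \<partial>M)" for J
    proof -
      have "(\<Prod>j\<in>J. - \<i> * Y j \<omega>) = (- \<i>) ^ card J * complex_of_real (\<Prod>j\<in>J. Y j \<omega>)" for \<omega>
        unfolding prod.distrib by simp
      then show ?thesis
        by (simp add: E_def del: of_real_prod flip: integral_complex_of_real)
    qed
    then have "U (\<lambda>_. 0) {1..<k} = ursell (\<lambda>J. (- \<i>) ^ card J * complex_of_real (\<integral>\<omega>. (\<Prod>j\<in>J. Y j \<omega>) \<partial>M)) {k} {1..<k}"
      unfolding U_def by presburger
    also have "\<dots> = (- \<i>) ^ (card {k} + card {1..<k}) *
        ursell (\<lambda>J. complex_of_real (\<integral>\<omega>. (\<Prod>j\<in>J. Y j \<omega>) \<partial>M)) {k} {1..<k}"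
      by (rule ursell_scale) (auto simp: prob_space)
    also have "card {k} + card {1..<k} = k" using k by simp
    finally show ?thesis by (subst (asm) ursell_of_real) (auto simp: prob_space)
  qed
  finally have "mixed_partial k (\<lambda>s. Ln (\<Phi> s)) (\<lambda>_. 0) =
    (- \<i>) ^ k * complex_of_real (ursell (\<lambda>J. \<integral>\<omega>. (\<Prod>j\<in>J. Y j \<omega>) \<partial>M) {k} {1..<k})" .
  moreover have "inverse (\<i> ^ k) * (- \<i>) ^ k = (- 1) ^ k"
    by (simp add: power_mult_distrib[symmetric] flip: power_inverse)
  ultimately show ?thesis
    unfolding mixed_cumulant_def \<Phi>_def by (simp add: mult.assoc[symmetric])
qed

section \<open>Measurability on the space of compact sets\<close>

lemma space_compacts_borel [simp]: "space compacts_borel = compacts"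
  by (simp add: compacts_borel_def space_measure_of_conv)

lemma infdist_hausdorff_le:
  assumes "K \<in> compacts" "L \<in> compacts"
  shows "infdist q L \<le> infdist q K + hausdorff_dist K L"
proof -
  have "closed K" "K \<noteq> {}" using assms by (auto simp: compacts_def compact_imp_closed)
  then obtain k where k: "k \<in> K" "infdist q K = dist q k"
    using infdist_attains_inf[of K q] by auto
  have "infdist q L \<le> infdist k L + dist q k" by (rule infdist_triangle)
  also have "infdist k L \<le> hausdorff_dist K L"
    using hausdorff_dist_le_iff[OF assms, of "hausdorff_dist K L"] k by auto
  finally show ?thesis using k by simp
qed

lemma infdist_less_sets: "{K \<in> compacts. infdist q K < t} \<in> sets compacts_borel"
proof -
  interpret H: Metric_space "compacts :: 'a::euclidean_space set set" hausdorff_dist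
    by (rule Metric_space_hausdorff)
  have "openin H.mtopology {K \<in> compacts. infdist q K < t}"
    unfolding H.openin_mtopology
  proof safe
    fix K :: "'a set" assume K: "K \<in> compacts" "infdist q K < t"
    have "H.mball K (t - infdist q K) \<subseteq> {K \<in> compacts. infdist q K < t}"
      using infdist_hausdorff_le[OF K(1), of _ q] by (fastforce simp: H.in_mball)
    with K show "\<exists>r>0. H.mball K r \<subseteq> {K \<in> compacts. infdist q K < t}"
      by (intro exI[of _ "t - infdist q K"]) auto
  qed
  then show ?thesis
    unfolding compacts_borel_def by (intro in_measure_of) (auto simp: H.openin_mtopology)
qed

text \<open>The Hausdorff metric makes \<open>K \<mapsto> infdist q K\<close> measurable for each
  fixed \<open>q\<close>. Joint measurability of membership follows by writing it with countably
  many such \<open>q\<close>: \<open>x\<close> lies in the closed set \<open>K\<close> iff points of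
  a countable dense set come arbitrarily close to \<open>x\<close> and to \<open>K\<close> at
  once.\<close>

lemma pred_mem_compacts:
  "Measurable.pred (borel \<Otimes>\<^sub>M compacts_borel) (\<lambda>(x :: 'a::euclidean_space, K). x \<in> K)"
proof -
  obtain D :: "'a set" where D: "countable D" "\<And>U. open U \<Longrightarrow> U \<noteq> {} \<Longrightarrow> \<exists>d\<in>D. d \<in> U"
    by (rule countable_dense_setE) auto
  have [measurable]: "Measurable.pred compacts_borel (\<lambda>K. infdist q K < t)" for q :: 'a and t
    using infdist_less_sets[of q t] by (simp add: pred_def)
  have eq: "x \<in> K \<longleftrightarrow> (\<forall>n::nat. \<exists>q\<in>D. dist x q < 1 / (real n + 1) \<and> infdist q K < 1 / (real n + 1))"
    if "K \<in> compacts" for x K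
  proof
    assume x: "x \<in> K"
    show "\<forall>n::nat. \<exists>q\<in>D. dist x q < 1 / (real n + 1) \<and> infdist q K < 1 / (real n + 1)"
    proof
      fix n :: nat
      obtain q where q: "q \<in> D" "q \<in> ball x (1 / (real n + 1))"
        using D(2)[of "ball x (1 / (real n + 1))"] by auto
      then have "infdist q K < 1 / (real n + 1)"
        using infdist_le[OF x, of q] by (simp add: dist_commute)
      with q show "\<exists>q\<in>D. dist x q < 1 / (real n + 1) \<and> infdist q K < 1 / (real n + 1)" by auto
    qed
  next
    assume *: "\<forall>n::nat. \<exists>q\<in>D. dist x q < 1 / (real n + 1) \<and> infdist q K < 1 / (real n + 1)"
    have "infdist x K \<le> 0"
    proof (rule ccontr)
      assume "\<not> infdist x K \<le> 0"
      then obtain n where n: "2 / infdist x K < real n" "infdist x K > 0"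
        using reals_Archimedean2 by auto
      from * obtain q where "dist x q < 1 / (real n + 1)" "infdist q K < 1 / (real n + 1)" by auto
      then have "infdist x K < 2 / (real n + 1)"
        using infdist_triangle[of x K q] add_divide_distrib[of 1 1 "real n + 1"] by linarith
      with n show False by (simp add: field_simps)
    qed
    with that show "x \<in> K"
      using in_closed_iff_infdist_zero[of K x] infdist_nonneg[of x K]
      by (auto simp: compacts_def compact_imp_closed)
  qed
  note D(1)[measurable]
  have "Measurable.pred (borel \<Otimes>\<^sub>M compacts_borel)
      (\<lambda>w::'a \<times> 'a set. \<forall>n::nat. \<exists>q\<in>D. dist (fst w) q < 1 / (real n + 1) \<and> infdist q (snd w) < 1 / (real n + 1))"
    by measurable
  then show ?thesis
    by (rule subst[OF measurable_cong, rotated]) (auto simp: space_pair_measure eq)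
qed

section \<open>Product functionals of Poisson processes\<close>

lemma prod_card_eq:
  fixes f :: "'l \<Rightarrow> real"
  assumes "finite I"
  shows "(\<Prod>i\<in>I. \<Prod>l\<in>L. if x i \<in> B l then f l else 1) = (\<Prod>l\<in>L. f l ^ card {i \<in> I. x i \<in> B l})"
proof -
  have "(\<Prod>i\<in>I. \<Prod>l\<in>L. if x i \<in> B l then f l else 1) = (\<Prod>l\<in>L. \<Prod>i\<in>I. if x i \<in> B l then f l else 1)"
    by (rule prod.swap)
  also have "\<dots> = (\<Prod>l\<in>L. f l ^ card {i \<in> I. x i \<in> B l})"
  proof (rule prod.cong)
    fix l
    have "(\<Prod>i\<in>I. if x i \<in> B l then f l else 1) = (\<Prod>i\<in>{i \<in> I. x i \<in> B l}. f l)"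
      using assms by (intro prod.mono_neutral_cong_right) auto
    then show "(\<Prod>i\<in>I. if x i \<in> B l then f l else 1) = f l ^ card {i \<in> I. x i \<in> B l}" by simp
  qed simp
  finally show ?thesis .
qed

lemma point_count_eq: "point_count X B \<omega> = emeasure (count_space UNIV) {i. X i \<omega> \<in> B}"
proof -
  have "point_count X B \<omega> = (\<Sum>i. indicator {i. X i \<omega> \<in> B} i)"
    by (simp add: point_count_def indicator_def)
  also have "\<dots> = (\<integral>\<^sup>+i. indicator {i. X i \<omega> \<in> B} i \<partial>count_space UNIV)"
    by (rule nn_integral_count_space_nat[symmetric])
  finally show ?thesis by simp
qed

text \<open>The infinite product over all points. For \<open>0 \<le> p \<le> 1\<close> the partial
  products decrease, so the infimum is their limit; the expectation is the probability generating
  functional of the process.\<close>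

definition product_functional :: "(nat \<Rightarrow> 'w \<Rightarrow> 'b) \<Rightarrow> ('b \<Rightarrow> real) \<Rightarrow> 'w \<Rightarrow> ennreal"
  where "product_functional X p \<omega> = (INF m. ennreal (\<Prod>i<m. 1 - p (X i \<omega>)))"

lemma decseq_prod:
  fixes f :: "nat \<Rightarrow> real"
  assumes "\<And>i. 0 \<le> f i" "\<And>i. f i \<le> 1"
  shows "decseq (\<lambda>m. \<Prod>i<m. f i)"
  using assms by (intro decseq_SucI) (auto intro!: mult_left_le prod_nonneg)

section \<open>The generating functional of a Poisson process\<close>

context prob_space
begin

text \<open>The power \<open>(1 - c) ^ N\<close> is written as a sum over the possible values of
  \<open>N\<close>, because \<open>N\<close> takes values in the extended reals; an infinite count
  contributes 0.\<close>

lemma poisson_pgf: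
  fixes X :: "nat \<Rightarrow> 'a \<Rightarrow> 'b::euclidean_space"
  assumes "stationary_poisson_process lam X" and B: "B \<in> sets borel" "bounded B"
    and c: "0 \<le> c" "c \<le> 1"
  defines "N \<equiv> point_count X B"
  shows "(\<integral>\<^sup>+\<omega>. (\<Sum>k. ennreal ((1 - c) ^ k) * indicator {of_nat k} (N \<omega>)) \<partial>M) =
      ennreal (exp (- lam * c * measure lborel B))"
    and "AE \<omega> in M. N \<omega> < \<infinity>" and "N \<in> borel_measurable M"
proof -
  have [measurable]: "X i \<in> borel_measurable M" for i
    using assms(1) by (simp add: stationary_poisson_process_def)
  show [measurable]: "N \<in> borel_measurable M"
    unfolding N_def point_count_def using B(1) by measurable
  define r where "r = lam * measure lborel B"
  have prob: "prob {\<omega> \<in> space M. N \<omega> = of_nat k} = r ^ k / fact k * exp (- r)" for k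
    using assms(1) B unfolding stationary_poisson_process_def N_def r_def by auto
  have pgf: "(\<integral>\<^sup>+\<omega>. (\<Sum>k. ennreal ((1 - c) ^ k) * indicator {of_nat k} (N \<omega>)) \<partial>M) = ennreal (exp (- c * r))"
    if c: "0 \<le> c" "c \<le> 1" for c
  proof -
    have "(\<integral>\<^sup>+\<omega>. (\<Sum>k. ennreal ((1 - c) ^ k) * indicator {of_nat k} (N \<omega>)) \<partial>M) =
        (\<Sum>k. \<integral>\<^sup>+\<omega>. ennreal ((1 - c) ^ k) * indicator {of_nat k} (N \<omega>) \<partial>M)"
      by (rule nn_integral_suminf) measurable
    also have "\<dots> = (\<Sum>k. ennreal ((1 - c) ^ k * (r ^ k / fact k * exp (- r))))"
    proof (rule suminf_cong)
      fix k
      have "(\<integral>\<^sup>+\<omega>. ennreal ((1 - c) ^ k) * indicator {of_nat k} (N \<omega>) \<partial>M) =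
          ennreal ((1 - c) ^ k) * (\<integral>\<^sup>+\<omega>. indicator {of_nat k} (N \<omega>) \<partial>M)"
        by (rule nn_integral_cmult) measurable
      also have "(\<integral>\<^sup>+\<omega>. indicator {of_nat k} (N \<omega>) \<partial>M) =
          (\<integral>\<^sup>+\<omega>. indicator {\<omega> \<in> space M. N \<omega> = of_nat k} \<omega> \<partial>M)"
        by (intro nn_integral_cong) (auto simp: indicator_def)
      also have "\<dots> = ennreal (prob {\<omega> \<in> space M. N \<omega> = of_nat k})"
        by (subst nn_integral_indicator) (auto simp: emeasure_eq_measure)
      also have "ennreal ((1 - c) ^ k) * \<dots> = ennreal ((1 - c) ^ k * prob {\<omega> \<in> space M. N \<omega> = of_nat k})"
        using c by (intro ennreal_mult[symmetric]) auto
      finally show "(\<integral>\<^sup>+\<omega>. ennreal ((1 - c) ^ k) * indicator {of_nat k} (N \<omega>) \<partial>M) =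
          ennreal ((1 - c) ^ k * (r ^ k / fact k * exp (- r)))"
        by (simp add: prob)
    qed
    also have "\<dots> = ennreal (exp (- c * r))"
    proof (rule suminf_ennreal_eq)
      show "0 \<le> (1 - c) ^ k * (r ^ k / fact k * exp (- r))" for k
        using c unfolding prob[symmetric] by auto
      have "(\<lambda>k. exp (- r) * (((1 - c) * r) ^ k /\<^sub>R fact k)) sums (exp (- r) * exp ((1 - c) * r))"
        by (intro sums_mult exp_converges)
      also have "exp (- r) * exp ((1 - c) * r) = exp (- c * r)"
        by (simp add: algebra_simps flip: exp_add)
      finally show "(\<lambda>k. (1 - c) ^ k * (r ^ k / fact k * exp (- r))) sums exp (- c * r)"
        unfolding power_mult_distrib by (simp add: field_simps)
    qed
    finally show ?thesis .
  qed
  show "(\<integral>\<^sup>+\<omega>. (\<Sum>k. ennreal ((1 - c) ^ k) * indicator {of_nat k} (N \<omega>)) \<partial>M) =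
      ennreal (exp (- lam * c * measure lborel B))"
    using pgf[OF c] by (simp add: r_def mult_ac)
  have le: "(\<Sum>k. ennreal ((1 - 0) ^ k) * indicator {of_nat k} (N \<omega>)) \<le> indicator {\<omega> \<in> space M. N \<omega> < \<infinity>} \<omega>"
    if "\<omega> \<in> space M" for \<omega>
  proof (cases "\<exists>k. N \<omega> = of_nat k")
    case True
    then obtain k0 where k0: "N \<omega> = of_nat k0" by auto
    have "(\<Sum>k. ennreal ((1 - 0) ^ k) * indicator {of_nat k} (N \<omega>)) = (\<Sum>k. if k = k0 then 1 else 0)"
      by (intro suminf_cong) (auto simp: k0 indicator_def)
    also have "\<dots> = 1" using sums_single[of k0 "\<lambda>_. 1 :: ennreal"] by (simp add: sums_iff)
    moreover have "\<omega> \<in> {\<omega> \<in> space M. N \<omega> < \<infinity>}" using that by (simp add: k0 ennreal_of_nat_eq_real_of_nat)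
    ultimately show ?thesis by (simp only: indicator_simps order_refl)
  next
    case False
    then have "(\<Sum>k. ennreal ((1 - 0) ^ k) * indicator {of_nat k} (N \<omega>)) = (\<Sum>k::nat. 0)"
      by (intro suminf_cong) (auto simp: indicator_def)
    then show ?thesis by simp
  qed
  \<comment> \<open>For \<open>c = 0\<close> the generating function is the sum of the Poisson
    probabilities. As this is 1, no mass is left for an infinite count.\<close>
  have "1 = (\<integral>\<^sup>+\<omega>. (\<Sum>k. ennreal ((1 - 0) ^ k) * indicator {of_nat k} (N \<omega>)) \<partial>M)"
    by (subst pgf) auto
  also have "\<dots> \<le> (\<integral>\<^sup>+\<omega>. indicator {\<omega> \<in> space M. N \<omega> < \<infinity>} \<omega> \<partial>M)"
    by (intro nn_integral_mono le)
  also have "\<dots> = emeasure M {\<omega> \<in> space M. N \<omega> < \<infinity>}"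
    by (rule nn_integral_indicator) measurable
  finally have "emeasure M {\<omega> \<in> space M. N \<omega> < \<infinity>} = 1"
    by (intro antisym) (auto simp: emeasure_le_1)
  then have "prob {\<omega> \<in> space M. N \<omega> < \<infinity>} = 1" by (simp add: measure_def)
  then show "AE \<omega> in M. N \<omega> < \<infinity>"
    by (subst prob_Collect_eq_1[symmetric]) auto
qed

text \<open>For a simple \<open>p\<close> the product is \<open>(1 - e l) ^ N l\<close> multiplied
  over the nonzero values \<open>e l\<close> of \<open>p\<close>, where \<open>N l\<close> counts
  the points in the level set \<open>B l\<close>. The level sets are disjoint and bounded, so the
  counts are independent and Poisson distributed.\<close>

lemma product_functional_simple:
  fixes X :: "nat \<Rightarrow> 'a \<Rightarrow> 'b::euclidean_space"
  assumes X: "stationary_poisson_process lam X"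
    and p: "simple_function borel p" "\<And>x. 0 \<le> p x" "\<And>x. p x \<le> 1"
    and bdd: "bounded {x. p x \<noteq> 0}"
  shows "(\<integral>\<^sup>+\<omega>. product_functional X p \<omega> \<partial>M) = ennreal (exp (- lam * (\<integral>x. p x \<partial>lborel)))"
proof -
  have "finite (range p - {0})" using p(1) by (simp add: simple_function_def)
  then obtain e :: "nat \<Rightarrow> real" and n where e: "bij_betw e {..<n} (range p - {0})"
    using ex_bij_betw_nat_finite atLeast0LessThan by metis
  define B where "B l = p -` {e l}" for l
  have B: "B l \<in> sets borel" "bounded (B l)" if "l < n" for l
  proof -
    show "B l \<in> sets borel"
      using simple_functionD(2)[OF p(1), of "{e l}"] by (simp add: B_def)
    have "e l \<noteq> 0" using e that by (auto simp: bij_betw_def)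
    then have "B l \<subseteq> {x. p x \<noteq> 0}" by (auto simp: B_def)
    then show "bounded (B l)" using bdd bounded_subset by blast
  qed
  have inj: "e l = e l' \<longleftrightarrow> l = l'" if "l < n" "l' < n" for l l'
    using e that by (auto simp: bij_betw_def inj_on_def)
  have disj: "disjoint_family_on B {..<n}"
    by (auto simp: disjoint_family_on_def B_def inj)
  have e01: "0 \<le> e l" "e l \<le> 1" if "l < n" for l
  proof -
    have "e l \<in> range p" using e that by (auto simp: bij_betw_def)
    then show "0 \<le> e l" "e l \<le> 1" using p by auto
  qed
  have sing: "(\<Prod>l<n. if x \<in> B l then 1 - e l else 1) = 1 - p x"
    "(\<Sum>l<n. e l * indicator (B l) x) = p x" for x
  proof -
    have im: "e ` {..<n} = range p - {0}" using e by (rule bij_betw_imp_surj_on)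
    have "p x = 0 \<or> p x \<in> e ` {..<n}" unfolding im by simp
    then consider "p x = 0" | l0 where "l0 < n" "p x = e l0" by auto
    then have "(\<Prod>l<n. if x \<in> B l then 1 - e l else 1) = 1 - p x \<and> (\<Sum>l<n. e l * indicator (B l) x) = p x"
    proof cases
      case 1
      have "p x \<noteq> e l" if "l < n" for l
      proof -
        have "e l \<in> range p - {0}" unfolding im[symmetric] using that by simp
        with 1 show ?thesis by auto
      qed
      then have "x \<notin> B l" if "l < n" for l using that by (auto simp: B_def)
      then show ?thesis using 1 by simp
    next
      case 2
      then have mem: "x \<in> B l \<longleftrightarrow> l = l0" if "l < n" for l
        using inj that by (auto simp: B_def)
      have "(\<Prod>l<n. if x \<in> B l then 1 - e l else 1) = (\<Prod>l<n. if l = l0 then 1 - e l else 1)"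
        by (rule prod.cong) (use mem in auto)
      moreover have "(\<Sum>l<n. e l * indicator (B l) x) = (\<Sum>l<n. if l = l0 then e l else 0)"
        by (rule sum.cong) (use mem in \<open>auto simp: indicator_def\<close>)
      ultimately show ?thesis using 2 by (simp add: sum.delta prod.delta)
    qed
    then show "(\<Prod>l<n. if x \<in> B l then 1 - e l else 1) = 1 - p x"
      "(\<Sum>l<n. e l * indicator (B l) x) = p x" by auto
  qed
  define N where "N l = point_count X (B l)" for l
  \<comment> \<open>\<open>\<phi> l\<close> extends \<open>k \<mapsto> (1 - e l) ^ k\<close> by 0 to
    a Borel function of the extended count, so that it can be composed with independent
    variables.\<close>
  define \<phi> where "\<phi> l t = (\<Sum>k. ennreal ((1 - e l) ^ k) * indicator {of_nat k} t)" for l and t :: ennreal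
  have \<phi>_meas [measurable]: "\<phi> l \<in> borel_measurable borel" for l
    unfolding \<phi>_def by measurable
  have \<phi>_nat: "\<phi> l (of_nat k0) = ennreal ((1 - e l) ^ k0)" for l k0
  proof -
    have "\<phi> l (of_nat k0) = (\<Sum>k. if k = k0 then ennreal ((1 - e l) ^ k) else 0)"
      unfolding \<phi>_def by (intro suminf_cong) (auto simp: indicator_def)
    then show ?thesis
      using sums_single[of k0 "\<lambda>k. ennreal ((1 - e l) ^ k)"] by (simp add: sums_iff)
  qed
  have F_eq: "product_functional X p \<omega> = (\<Prod>l<n. \<phi> l (N l \<omega>))" if fin: "\<forall>l\<in>{..<n}. N l \<omega> < \<infinity>" for \<omega>
  proof -
    have fin': "finite {i. X i \<omega> \<in> B l}" if "l < n" for l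
    proof (rule ccontr)
      assume "infinite {i. X i \<omega> \<in> B l}"
      then have "N l \<omega> = \<infinity>" by (simp add: N_def point_count_eq)
      moreover have "N l \<omega> < \<infinity>" using fin that by blast
      ultimately show False by simp
    qed
    then have N_eq: "N l \<omega> = of_nat (card {i. X i \<omega> \<in> B l})" if "l < n" for l
      using that by (simp add: N_def point_count_eq emeasure_count_space_finite)
    \<comment> \<open>Almost surely only finitely many indices belong to points in the level sets.
      Beyond the last of them the partial products are constant, so the order of the enumeration
      does not matter.\<close>
    have "finite (\<Union>l<n. {i. X i \<omega> \<in> B l})" using fin' by auto
    then obtain m0 where m0: "(\<Union>l<n. {i. X i \<omega> \<in> B l}) \<subseteq> {..<m0}"
      using finite_nat_iff_bounded by blast
    define a where "a m = (\<Prod>i<m. 1 - p (X i \<omega>))" for m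
    have "a m = (\<Prod>l<n. (1 - e l) ^ card {i. X i \<omega> \<in> B l})" if "m0 \<le> m" for m
    proof -
      have "a m = (\<Prod>l<n. (1 - e l) ^ card {i \<in> {..<m}. X i \<omega> \<in> B l})"
        unfolding a_def sing(1)[symmetric] by (rule prod_card_eq) simp
      also have "\<dots> = (\<Prod>l<n. (1 - e l) ^ card {i. X i \<omega> \<in> B l})"
      proof (intro prod.cong refl arg_cong2[where f = "(^)"] arg_cong[where f = card])
        fix l assume "l \<in> {..<n}"
        then have "{i. X i \<omega> \<in> B l} \<subseteq> {..<m}" using m0 that by force
        then show "{i \<in> {..<m}. X i \<omega> \<in> B l} = {i. X i \<omega> \<in> B l}" by auto
      qed
      finally show ?thesis .
    qed
    then have "eventually (\<lambda>m. ennreal (a m) = ennreal (\<Prod>l<n. (1 - e l) ^ card {i. X i \<omega> \<in> B l})) sequentially"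
      by (auto simp: eventually_sequentially intro!: exI[of _ m0])
    then have "(\<lambda>m. ennreal (a m)) \<longlonglongrightarrow> ennreal (\<Prod>l<n. (1 - e l) ^ card {i. X i \<omega> \<in> B l})"
      by (rule tendsto_eventually)
    moreover have "decseq (\<lambda>m. ennreal (a m))"
      using decseq_prod[of "\<lambda>i. 1 - p (X i \<omega>)"] p
      unfolding a_def by (auto simp: decseq_def intro!: ennreal_leI)
    then have "(\<lambda>m. ennreal (a m)) \<longlonglongrightarrow> product_functional X p \<omega>"
      unfolding product_functional_def a_def by (rule LIMSEQ_INF)
    ultimately have "product_functional X p \<omega> = ennreal (\<Prod>l<n. (1 - e l) ^ card {i. X i \<omega> \<in> B l})"
      using LIMSEQ_unique by blast
    also have "\<dots> = (\<Prod>l<n. ennreal ((1 - e l) ^ card {i. X i \<omega> \<in> B l}))"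
      using e01 by (intro prod_ennreal[symmetric]) auto
    also have "\<dots> = (\<Prod>l<n. \<phi> l (N l \<omega>))"
      using N_eq \<phi>_nat by (intro prod.cong) auto
    finally show ?thesis .
  qed
  have "AE \<omega> in M. \<forall>l\<in>{..<n}. N l \<omega> < \<infinity>"
  proof (rule AE_finite_allI)
    fix l assume "l \<in> {..<n}"
    then show "AE \<omega> in M. N l \<omega> < \<infinity>"
      unfolding N_def using B e01 by (intro poisson_pgf(2)[OF X, where c = "e l"]) auto
  qed simp
  then have "(\<integral>\<^sup>+\<omega>. product_functional X p \<omega> \<partial>M) = (\<integral>\<^sup>+\<omega>. (\<Prod>l<n. \<phi> l (N l \<omega>)) \<partial>M)"
    by (intro nn_integral_cong_AE) (auto simp: F_eq)
  also have "\<dots> = (\<Prod>l<n. \<integral>\<^sup>+\<omega>. \<phi> l (N l \<omega>) \<partial>M)"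
  proof (rule indep_vars_nn_integral)
    have "indep_vars (\<lambda>_. borel) N {..<n}"
      using X B disj unfolding stationary_poisson_process_def N_def[abs_def] by auto
    then show "indep_vars (\<lambda>_. borel) (\<lambda>l \<omega>. \<phi> l (N l \<omega>)) {..<n}"
      by (rule indep_vars_compose2) measurable
  qed auto
  also have "\<dots> = (\<Prod>l<n. ennreal (exp (- lam * e l * measure lborel (B l))))"
    unfolding \<phi>_def N_def using B e01 by (intro prod.cong poisson_pgf(1)[OF X]) auto
  also have "\<dots> = ennreal (exp (\<Sum>l<n. - lam * e l * measure lborel (B l)))"
    by (subst prod_ennreal) (auto simp: exp_sum)
  also have "(\<Sum>l<n. - lam * e l * measure lborel (B l)) = - lam * (\<Sum>l<n. e l * measure lborel (B l))"
    by (simp add: sum_distrib_left mult_ac sum_negf)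
  also have "(\<Sum>l<n. e l * measure lborel (B l)) = (\<integral>x. (\<Sum>l<n. e l * indicator (B l) x) \<partial>lborel)"
  proof -
    have "emeasure lborel (B l) < \<infinity>" if "l < n" for l
      using emeasure_bounded_finite[OF B(2)[OF that]] .
    then have "(\<integral>x. (\<Sum>l<n. e l * indicator (B l) x) \<partial>lborel) = (\<Sum>l<n. \<integral>x. e l * indicator (B l) x \<partial>lborel)"
      using B by (intro Bochner_Integration.integral_sum integrable_mult_right integrable_real_indicator) auto
    also have "\<dots> = (\<Sum>l<n. e l * measure lborel (B l))"
      by (intro sum.cong) simp_all
    finally show ?thesis by simp
  qed
  also have "\<dots> = (\<integral>x. p x \<partial>lborel)" unfolding sing(2) ..
  finally show ?thesis .
qed

text \<open>Monotone approximation of \<open>p\<close> from below by simple functions, cut off to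
  balls since the process is only described on bounded sets. The functional decreases along the
  approximation, and the two infima, over approximations and over partial products, commute.\<close>

lemma product_functional_integral:
  fixes X :: "nat \<Rightarrow> 'a \<Rightarrow> 'b::euclidean_space"
  assumes X: "stationary_poisson_process lam X"
    and p [measurable]: "p \<in> borel_measurable borel" and p01: "\<And>x. 0 \<le> p x" "\<And>x. p x \<le> 1"
    and int: "integrable lborel p"
  shows "(\<integral>\<^sup>+\<omega>. product_functional X p \<omega> \<partial>M) = ennreal (exp (- lam * (\<integral>x. p x \<partial>lborel)))"
proof -
  have [measurable]: "X i \<in> borel_measurable M" for i
    using X by (simp add: stationary_poisson_process_def)
  obtain f where f': "incseq f" "\<forall>i. simple_function borel (f i)" "\<forall>x. bdd_above (range (\<lambda>i. f i x))"
      "\<forall>i x. 0 \<le> f i x" "p = (SUP i. f i)"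
    using borel_measurable_implies_simple_function_sequence_real[OF p p01(1)] by blast
  have f: "\<And>i. simple_function borel (f i)" "incseq f" "\<And>i x. f i x \<in> {0..}" "\<And>x. (SUP i. f i x) = p x"
     "\<And>x. bdd_above (range (\<lambda>i. f i x))"
    using f'(1-4) by (auto simp only: f'(5) SUP_apply atLeast_iff)
  define g where "g n x = f n x * indicator (cball 0 (real n)) x" for n x
  have f_lim: "(\<lambda>i. f i x) \<longlonglongrightarrow> p x" for x
    unfolding f(4)[symmetric] using f(2,5) by (intro LIMSEQ_incseq_SUP) (auto simp: incseq_def le_fun_def)
  have f_le: "f i x \<le> p x" for i x
    unfolding f(4)[symmetric] using f(5) by (intro cSUP_upper) auto
  have g_simple: "simple_function borel (g n)" for n
    unfolding g_def by (intro simple_function_mult f simple_function_indicator) auto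
  have g01: "0 \<le> g n x" "g n x \<le> p x" "g n x \<le> 1" for n x
  proof -
    show "0 \<le> g n x" using f(3)[of n x] by (auto simp: g_def)
    show "g n x \<le> p x" using f_le[of n x] p01(1)[of x] by (auto simp: g_def indicator_def)
    then show "g n x \<le> 1" using p01(2)[of x] by simp
  qed
  have g_lim: "(\<lambda>n. g n x) \<longlonglongrightarrow> p x" for x
  proof -
    have "eventually (\<lambda>n. f n x = g n x) sequentially"
    proof -
      obtain n0 :: nat where "norm x \<le> n0" using real_arch_simple by blast
      then show ?thesis
        by (auto simp: eventually_sequentially g_def indicator_def intro!: exI[of _ n0])
    qed
    from Lim_transform_eventually[OF f_lim this] show ?thesis .
  qed
  have g_mono: "g m x \<le> g n x" if "m \<le> n" for m n x
  proof -
    have "f m x \<le> f n x" using f(2) that by (auto simp: incseq_def le_fun_def)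
    then show ?thesis using that f(3)[of n x] by (auto simp: g_def indicator_def)
  qed
  have [measurable]: "g n \<in> borel_measurable borel" for n
    using g_simple by (rule borel_measurable_simple_function)
  have g_bdd: "bounded {x. g n x \<noteq> 0}" for n
    by (rule bounded_subset[of "cball 0 (real n)"]) (auto simp: g_def indicator_def)
  have dec: "decseq (\<lambda>n \<omega>. product_functional X (g n) \<omega>)"
  proof (rule decseq_SucI, rule le_funI)
    fix n \<omega>
    show "product_functional X (g (Suc n)) \<omega> \<le> product_functional X (g n) \<omega>"
      unfolding product_functional_def using g_mono[of n "Suc n"] g01
      by (intro INF_mono' ennreal_leI prod_mono) auto
  qed
  have inf_eq: "(INF n. product_functional X (g n) \<omega>) = product_functional X p \<omega>" for \<omega>
  proof -
    have "(INF n. product_functional X (g n) \<omega>) = (INF m. INF n. ennreal (\<Prod>i<m. 1 - g n (X i \<omega>)))"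
      unfolding product_functional_def by (rule INF_commute)
    also have "(\<lambda>m. INF n. ennreal (\<Prod>i<m. 1 - g n (X i \<omega>))) = (\<lambda>m. ennreal (\<Prod>i<m. 1 - p (X i \<omega>)))"
    proof
      fix m
      have "(\<lambda>n. ennreal (\<Prod>i<m. 1 - g n (X i \<omega>))) \<longlonglongrightarrow> ennreal (\<Prod>i<m. 1 - p (X i \<omega>))"
        by (intro tendsto_ennrealI tendsto_prod tendsto_diff tendsto_const g_lim)
      moreover have "decseq (\<lambda>n. ennreal (\<Prod>i<m. 1 - g n (X i \<omega>)))"
        using g_mono g01 by (auto simp: decseq_def intro!: ennreal_leI prod_mono)
      then have "(\<lambda>n. ennreal (\<Prod>i<m. 1 - g n (X i \<omega>))) \<longlonglongrightarrow> (INF n. ennreal (\<Prod>i<m. 1 - g n (X i \<omega>)))"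
        by (rule LIMSEQ_INF)
      ultimately show "(INF n. ennreal (\<Prod>i<m. 1 - g n (X i \<omega>))) = ennreal (\<Prod>i<m. 1 - p (X i \<omega>))"
        using LIMSEQ_unique by blast
    qed
    finally show ?thesis by (simp add: product_functional_def)
  qed
  have "(\<integral>\<^sup>+\<omega>. product_functional X p \<omega> \<partial>M) = (INF n. \<integral>\<^sup>+\<omega>. product_functional X (g n) \<omega> \<partial>M)"
    unfolding inf_eq[symmetric]
  proof (rule nn_integral_monotone_convergence_INF_decseq[OF dec])
    show "product_functional X (g n) \<in> borel_measurable M" for n
      unfolding product_functional_def[abs_def] by measurable
    show "(\<integral>\<^sup>+\<omega>. product_functional X (g 0) \<omega> \<partial>M) < \<infinity>"
      using product_functional_simple[OF X g_simple g01(1,3) g_bdd, of 0] by simp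
  qed
  also have "\<dots> = (INF n. ennreal (exp (- lam * (\<integral>x. g n x \<partial>lborel))))"
    using product_functional_simple[OF X g_simple g01(1,3) g_bdd] by simp
  also have "\<dots> = ennreal (exp (- lam * (\<integral>x. p x \<partial>lborel)))"
  proof (rule LIMSEQ_unique)
    have "(\<lambda>n. \<integral>x. g n x \<partial>lborel) \<longlonglongrightarrow> (\<integral>x. p x \<partial>lborel)"
      using g01 by (intro integral_dominated_convergence[where w = p] int) (auto simp: g_lim)
    then show "(\<lambda>n. ennreal (exp (- lam * (\<integral>x. g n x \<partial>lborel)))) \<longlonglongrightarrow> ennreal (exp (- lam * (\<integral>x. p x \<partial>lborel)))"
      by (intro tendsto_intros)
    have "decseq (\<lambda>n. \<integral>\<^sup>+\<omega>. product_functional X (g n) \<omega> \<partial>M)"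
      using le_funD[OF decseq_SucD[OF dec]] by (intro decseq_SucI nn_integral_mono) simp
    then show "(\<lambda>n. ennreal (exp (- lam * (\<integral>x. g n x \<partial>lborel)))) \<longlonglongrightarrow>
        (INF n. ennreal (exp (- lam * (\<integral>x. g n x \<partial>lborel))))"
      unfolding product_functional_simple[OF X g_simple g01(1,3) g_bdd] by (rule LIMSEQ_INF)
  qed
  finally show ?thesis .
qed

end

section \<open>Void probabilities\<close>

context poisson_grain_model
begin

definition law :: "'a set measure" where "law = distr M compacts_borel Z\<^sub>0"

sublocale law: prob_space law
  unfolding law_def by (rule prob_space_distr[OF typical_grain])

lemma sets_law [simp, measurable_cong]: "sets law = sets compacts_borel" and space_law [simp]: "space law = compacts"
  by (simp_all add: law_def)

lemma X_measurable [measurable]: "X i \<in> borel_measurable M"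
  using points by (simp add: stationary_poisson_process_def)

lemma Z_measurable [measurable]: "Z i \<in> M \<rightarrow>\<^sub>M compacts_borel"
  using grains_indep by (simp add: indep_vars_def2)

lemma X_seq_measurable [measurable]: "(\<lambda>\<omega> i. X i \<omega>) \<in> M \<rightarrow>\<^sub>M PiM UNIV (\<lambda>_. borel)"
  by (intro measurable_PiM_single') (auto simp: space_PiM)

lemma Z_seq_measurable [measurable]: "(\<lambda>\<omega> i. Z i \<omega>) \<in> M \<rightarrow>\<^sub>M PiM UNIV (\<lambda>_. compacts_borel)"
  using measurable_space[OF Z_measurable] by (intro measurable_PiM_single') (auto simp: space_PiM)

lemma distr_points_grains:
  defines "PX \<equiv> PiM UNIV (\<lambda>_. borel)" and "PZ \<equiv> PiM UNIV (\<lambda>_. compacts_borel)"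
  shows "distr M PX (\<lambda>\<omega> i. X i \<omega>) \<Otimes>\<^sub>M distr M PZ (\<lambda>\<omega> i. Z i \<omega>) =
    distr M (PX \<Otimes>\<^sub>M PZ) (\<lambda>\<omega>. ((\<lambda>i. X i \<omega>), (\<lambda>i. Z i \<omega>)))"
proof (rule pair_measure_eqI)
  have [measurable]: "(\<lambda>\<omega> i. X i \<omega>) \<in> M \<rightarrow>\<^sub>M PX" "(\<lambda>\<omega> i. Z i \<omega>) \<in> M \<rightarrow>\<^sub>M PZ"
    by (simp_all add: PX_def PZ_def)
  show "sigma_finite_measure (distr M PX (\<lambda>\<omega> i. X i \<omega>))" "sigma_finite_measure (distr M PZ (\<lambda>\<omega> i. Z i \<omega>))"
    by (intro prob_space_imp_sigma_finite prob_space_distr; measurable)+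
  show "sets (distr M PX (\<lambda>\<omega> i. X i \<omega>) \<Otimes>\<^sub>M distr M PZ (\<lambda>\<omega> i. Z i \<omega>)) =
    sets (distr M (PX \<Otimes>\<^sub>M PZ) (\<lambda>\<omega>. ((\<lambda>i. X i \<omega>), (\<lambda>i. Z i \<omega>))))"
    by (simp cong: sets_pair_measure_cong)
  fix A B
  assume "A \<in> sets (distr M PX (\<lambda>\<omega> i. X i \<omega>))" "B \<in> sets (distr M PZ (\<lambda>\<omega> i. Z i \<omega>))"
  then have AB [measurable]: "A \<in> sets PX" "B \<in> sets PZ" by auto
  let ?A = "(\<lambda>\<omega> i. X i \<omega>) -` A \<inter> space M" and ?B = "(\<lambda>\<omega> i. Z i \<omega>) -` B \<inter> space M"
  have "prob (?A \<inter> ?B) = prob ?A * prob ?B"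
    using AB by (intro indep_setD[OF points_grains_indep]) (auto simp: PX_def PZ_def)
  moreover have "(\<lambda>\<omega>. ((\<lambda>i. X i \<omega>), (\<lambda>i. Z i \<omega>))) -` (A \<times> B) \<inter> space M = ?A \<inter> ?B" by auto
  ultimately show "emeasure (distr M PX (\<lambda>\<omega> i. X i \<omega>)) A * emeasure (distr M PZ (\<lambda>\<omega> i. Z i \<omega>)) B =
    emeasure (distr M (PX \<Otimes>\<^sub>M PZ) (\<lambda>\<omega>. ((\<lambda>i. X i \<omega>), (\<lambda>i. Z i \<omega>)))) (A \<times> B)"
    by (simp add: emeasure_distr emeasure_eq_measure ennreal_mult)
qed

text \<open>The sequences of points and grains are independent as a whole, so the points may be
  fixed while the grains, which are independent among themselves, are averaged out one by
  one.\<close>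

lemma nn_integral_marked_prod:
  assumes g [measurable]: "case_prod g \<in> borel_measurable (borel \<Otimes>\<^sub>M compacts_borel)"
  shows "(\<integral>\<^sup>+\<omega>. (\<Prod>i<m. g (X i \<omega>) (Z i \<omega>)) \<partial>M) = (\<integral>\<^sup>+\<omega>. (\<Prod>i<m. \<integral>\<^sup>+K. g (X i \<omega>) K \<partial>law) \<partial>M)"
proof -
  let ?PX = "PiM UNIV (\<lambda>_::nat. borel :: 'a measure)" and ?PZ = "PiM UNIV (\<lambda>_::nat. compacts_borel :: 'a set measure)"
  let ?X = "\<lambda>\<omega> i. X i \<omega>" and ?Z = "\<lambda>\<omega> i. Z i \<omega>"
  have distr: "distr M ?PX ?X \<Otimes>\<^sub>M distr M ?PZ ?Z = distr M (?PX \<Otimes>\<^sub>M ?PZ) (\<lambda>\<omega>. (?X \<omega>, ?Z \<omega>))"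
    by (rule distr_points_grains)
  interpret DZ: prob_space "distr M ?PZ ?Z" by (rule prob_space_distr) measurable
  have "(\<integral>\<^sup>+\<omega>. (\<Prod>i<m. g (X i \<omega>) (Z i \<omega>)) \<partial>M) =
      (\<integral>\<^sup>+w. (\<Prod>i<m. g (fst w i) (snd w i)) \<partial>distr M (?PX \<Otimes>\<^sub>M ?PZ) (\<lambda>\<omega>. (?X \<omega>, ?Z \<omega>)))"
    by (subst nn_integral_distr) auto
  also have "\<dots> = (\<integral>\<^sup>+w. (\<Prod>i<m. g (fst w i) (snd w i)) \<partial>(distr M ?PX ?X \<Otimes>\<^sub>M distr M ?PZ ?Z))"
    unfolding distr ..
  also have "\<dots> = (\<integral>\<^sup>+x. \<integral>\<^sup>+z. (\<Prod>i<m. g (x i) (z i)) \<partial>distr M ?PZ ?Z \<partial>distr M ?PX ?X)"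
    by (subst DZ.nn_integral_fst[symmetric]) auto
  also have "\<dots> = (\<integral>\<^sup>+x. (\<Prod>i<m. \<integral>\<^sup>+K. g (x i) K \<partial>law) \<partial>distr M ?PX ?X)"
  proof (rule nn_integral_cong)
    fix x :: "nat \<Rightarrow> 'a"
    have [measurable]: "g u \<in> borel_measurable compacts_borel" for u
      using measurable_Pair2[OF g, of u] by simp
    have "(\<integral>\<^sup>+z. (\<Prod>i<m. g (x i) (z i)) \<partial>distr M ?PZ ?Z) = (\<integral>\<^sup>+\<omega>. (\<Prod>i<m. g (x i) (Z i \<omega>)) \<partial>M)"
      by (subst nn_integral_distr) auto
    also have "\<dots> = (\<Prod>i<m. \<integral>\<^sup>+\<omega>. g (x i) (Z i \<omega>) \<partial>M)"
    proof (rule indep_vars_nn_integral)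
      have "indep_vars (\<lambda>_. compacts_borel) Z {..<m}"
        using grains_indep by (rule indep_vars_subset) auto
      then show "indep_vars (\<lambda>_. borel) (\<lambda>i \<omega>. g (x i) (Z i \<omega>)) {..<m}"
        by (rule indep_vars_compose2) measurable
    qed auto
    also have "\<dots> = (\<Prod>i<m. \<integral>\<^sup>+K. g (x i) K \<partial>law)"
    proof (rule prod.cong)
      fix i
      have "(\<integral>\<^sup>+\<omega>. g (x i) (Z i \<omega>) \<partial>M) = (\<integral>\<^sup>+K. g (x i) K \<partial>distr M compacts_borel (Z i))"
        by (subst nn_integral_distr) auto
      then show "(\<integral>\<^sup>+\<omega>. g (x i) (Z i \<omega>) \<partial>M) = (\<integral>\<^sup>+K. g (x i) K \<partial>law)"
        by (simp add: grains_copies law_def)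
    qed simp
    finally show "(\<integral>\<^sup>+z. (\<Prod>i<m. g (x i) (z i)) \<partial>distr M ?PZ ?Z) = (\<Prod>i<m. \<integral>\<^sup>+K. g (x i) K \<partial>law)" .
  qed
  also have "\<dots> = (\<integral>\<^sup>+\<omega>. (\<Prod>i<m. \<integral>\<^sup>+K. g (X i \<omega>) K \<partial>law) \<partial>M)"
  proof (rule nn_integral_distr)
    have "(\<lambda>u. \<integral>\<^sup>+K. g u K \<partial>law) \<in> borel_measurable borel"
      by (rule law.borel_measurable_nn_integral) measurable
    note this[measurable]
    show "(\<lambda>x. \<Prod>i<m. \<integral>\<^sup>+K. g (x i) K \<partial>law) \<in> borel_measurable (distr M ?PX ?X)"
      by measurable
  qed measurable
  finally show ?thesis .
qed

section \<open>The intensity measure of the pairs (grain, germ)\<close>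

definition hits :: "'a \<Rightarrow> ('a set \<times> 'a) set" where "hits x = {(K, u). x - u \<in> K}"

definition Q :: "('a set \<times> 'a) measure"
  where "Q = law \<Otimes>\<^sub>M density lborel (\<lambda>_. ennreal intensity)"

lemma sets_Q [measurable_cong]: "sets Q = sets (compacts_borel \<Otimes>\<^sub>M borel)"
  unfolding Q_def by (intro sets_pair_measure_cong) auto

lemma space_Q [simp]: "space Q = compacts \<times> UNIV"
  by (simp add: Q_def space_pair_measure)

lemma sigma_finite_scaled: "sigma_finite_measure (density lborel (\<lambda>_. ennreal intensity))"
  by (subst sigma_finite_measure.sigma_finite_iff_density_finite[OF sigma_finite_lborel]) auto

sublocale Q: sigma_finite_measure Q
proof -
  interpret D: sigma_finite_measure "density lborel (\<lambda>_::'a. ennreal intensity)" by (rule sigma_finite_scaled)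
  interpret pair_sigma_finite law "density lborel (\<lambda>_::'a. ennreal intensity)" ..
  show "sigma_finite_measure Q" unfolding Q_def by (rule sigma_finite_measure_axioms)
qed

lemma nn_integral_Q:
  assumes [measurable]: "f \<in> borel_measurable (compacts_borel \<Otimes>\<^sub>M borel)"
  shows "(\<integral>\<^sup>+w. f w \<partial>Q) = ennreal intensity * (\<integral>\<^sup>+K. \<integral>\<^sup>+u. f (K, u) \<partial>lborel \<partial>law)"
    and "(\<integral>\<^sup>+w. f w \<partial>Q) = ennreal intensity * (\<integral>\<^sup>+u. \<integral>\<^sup>+K. f (K, u) \<partial>law \<partial>lborel)"
proof -
  interpret D: sigma_finite_measure "density lborel (\<lambda>_::'a. ennreal intensity)" by (rule sigma_finite_scaled)
  interpret LL: pair_sigma_finite law lborel ..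
  have m: "(\<lambda>u. f (K, u)) \<in> borel_measurable borel" if "K \<in> compacts" for K
  proof -
    have [measurable]: "K \<in> space compacts_borel" using that by simp
    show ?thesis by measurable
  qed
  have "(\<integral>\<^sup>+w. f w \<partial>Q) = (\<integral>\<^sup>+K. \<integral>\<^sup>+u. f (K, u) \<partial>density lborel (\<lambda>_. ennreal intensity) \<partial>law)"
    unfolding Q_def by (rule D.nn_integral_fst[symmetric]) (simp cong: measurable_cong_sets sets_pair_measure_cong)
  also have "\<dots> = (\<integral>\<^sup>+K. ennreal intensity * (\<integral>\<^sup>+u. f (K, u) \<partial>lborel) \<partial>law)"
    using m by (intro nn_integral_cong) (simp add: nn_integral_density nn_integral_cmult)
  also have "\<dots> = ennreal intensity * (\<integral>\<^sup>+K. \<integral>\<^sup>+u. f (K, u) \<partial>lborel \<partial>law)"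
    by (intro nn_integral_cmult lborel.borel_measurable_nn_integral) (simp cong: measurable_cong_sets sets_pair_measure_cong)
  finally show 1: "(\<integral>\<^sup>+w. f w \<partial>Q) = ennreal intensity * (\<integral>\<^sup>+K. \<integral>\<^sup>+u. f (K, u) \<partial>lborel \<partial>law)" .
  have "(\<integral>\<^sup>+K. \<integral>\<^sup>+u. f (K, u) \<partial>lborel \<partial>law) = (\<integral>\<^sup>+u. \<integral>\<^sup>+K. f (K, u) \<partial>law \<partial>lborel)"
    by (intro LL.Fubini'[symmetric]) (simp cong: measurable_cong_sets sets_pair_measure_cong)
  with 1 show "(\<integral>\<^sup>+w. f w \<partial>Q) = ennreal intensity * (\<integral>\<^sup>+u. \<integral>\<^sup>+K. f (K, u) \<partial>law \<partial>lborel)"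
    by simp
qed

lemma pred_hits: "Measurable.pred (lborel \<Otimes>\<^sub>M Q) (\<lambda>(x, p). p \<in> hits x)"
proof -
  have "Measurable.pred (lborel \<Otimes>\<^sub>M Q) (\<lambda>w. (\<lambda>(x, K). x \<in> K) (fst w - snd (snd w), fst (snd w)))"
    by (intro measurable_compose[OF _ pred_mem_compacts]) measurable
  then show ?thesis by (simp add: hits_def case_prod_beta')
qed

sublocale H: hitting lborel Q hits
  by unfold_locales (auto simp: pred_hits)

lemma emeasure_reflect:
  assumes "K \<in> sets borel"
  shows "(\<integral>\<^sup>+u. indicator K (x - u) \<partial>lborel) = emeasure lborel (K :: 'a set)"
proof -
  have "lborel = distr lborel borel (\<lambda>u. x - u)"
    using lborel_affine[of "- 1" x] by (simp add: density_1)
  then have "emeasure lborel K = (\<integral>\<^sup>+u. indicator K u \<partial>distr lborel borel (\<lambda>u. x - u))"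
    using assms by simp
  then show ?thesis
    using assms by (subst (asm) nn_integral_distr) auto
qed

lemma emeasure_translate:
  assumes "K \<in> sets borel"
  shows "(\<integral>\<^sup>+x. indicator K (x - u) \<partial>lborel) = emeasure lborel (K :: 'a set)"
proof -
  have "(\<integral>\<^sup>+x. indicator K (x - u) \<partial>lborel) = (\<integral>\<^sup>+x. indicator K x \<partial>distr lborel borel ((+) (- u)))"
    using assms by (subst nn_integral_distr) auto
  then show ?thesis using assms by (simp add: lborel_distr_plus)
qed

lemma compacts_borel_set: "K \<in> compacts \<Longrightarrow> K \<in> sets borel"
  by (auto simp: compacts_def intro: borel_compact)

lemma ell_eq: "K \<in> compacts \<Longrightarrow> H.ell (K, u) = emeasure lborel K"
  unfolding H.ell_def using emeasure_translate[OF compacts_borel_set, of K u]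
  by (simp add: hits_def indicator_def)

text \<open>The volume of \<open>K\<close> is the measure of a section of the (reflected) membership
  relation, so its measurability in \<open>K\<close> comes from that of the relation.\<close>

lemma volume_measurable [measurable]: "emeasure lborel \<in> borel_measurable (compacts_borel :: 'a set measure)"
proof -
  have "(\<lambda>K. \<integral>\<^sup>+u. indicator (hits 0) (K, u) \<partial>lborel) \<in> borel_measurable (compacts_borel :: 'a set measure)"
  proof (rule lborel.borel_measurable_nn_integral)
    have "Measurable.pred (compacts_borel \<Otimes>\<^sub>M borel) (\<lambda>(K, u). - u \<in> (K :: 'a set))"
      using measurable_compose[OF _ pred_mem_compacts, of "\<lambda>w. (- snd w, fst w)" "compacts_borel \<Otimes>\<^sub>M borel"]
      by (simp add: case_prod_beta')
    then show "(\<lambda>(K, u). indicator (hits 0) (K, u)) \<in> borel_measurable (compacts_borel \<Otimes>\<^sub>M (lborel :: 'a measure))"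
      unfolding hits_def indicator_def by (simp add: case_prod_beta' cong: measurable_cong_sets sets_pair_measure_cong)
  qed
  moreover have "(\<integral>\<^sup>+u. indicator (hits 0) (K, u) \<partial>lborel) = emeasure lborel K"
    if "K \<in> space compacts_borel" for K :: "'a set"
    using emeasure_reflect[OF compacts_borel_set, of K 0] that by (simp add: hits_def indicator_def)
  ultimately show ?thesis by (subst measurable_cong[symmetric])
qed

lemma pred_hits' [measurable]: "Measurable.pred (compacts_borel \<Otimes>\<^sub>M borel) (\<lambda>p. p \<in> hits x)"
proof -
  have "Measurable.pred (compacts_borel \<Otimes>\<^sub>M borel) (\<lambda>w. (\<lambda>(x, K). x \<in> K) (x - snd w, fst w))"
    by (intro measurable_compose[OF _ pred_mem_compacts]) measurable
  then show ?thesis by (simp add: hits_def case_prod_beta')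
qed

text \<open>The germs for which a translate of \<open>K\<close> covers \<open>x\<close> form a
  reflected copy of \<open>K\<close>. Integrating over them yields one more factor of the volume,
  hence the exponent \<open>Suc c\<close>.\<close>

lemma moment_eq:
  "(\<integral>\<^sup>+p. indicator (hits x) p * H.ell p ^ c \<partial>Q) = ennreal intensity * (\<integral>\<^sup>+K. emeasure lborel K ^ Suc c \<partial>law)"
proof -
  have "H.ell \<in> borel_measurable (compacts_borel \<Otimes>\<^sub>M borel)"
    using H.ell_measurable by (simp cong: measurable_cong_sets add: sets_Q)
  note [measurable] = this
  have "(\<integral>\<^sup>+p. indicator (hits x) p * H.ell p ^ c \<partial>Q) =
      ennreal intensity * (\<integral>\<^sup>+K. \<integral>\<^sup>+u. indicator (hits x) (K, u) * H.ell (K, u) ^ c \<partial>lborel \<partial>law)"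
    by (rule nn_integral_Q(1)) (unfold indicator_def, measurable)
  also have "(\<integral>\<^sup>+K. \<integral>\<^sup>+u. indicator (hits x) (K, u) * H.ell (K, u) ^ c \<partial>lborel \<partial>law) =
      (\<integral>\<^sup>+K. emeasure lborel K ^ Suc c \<partial>law)"
  proof (rule nn_integral_cong)
    fix K assume "K \<in> space law"
    then have K: "K \<in> compacts" by simp
    note [measurable] = compacts_borel_set[OF K]
    have "(\<integral>\<^sup>+u. indicator (hits x) (K, u) * H.ell (K, u) ^ c \<partial>lborel) =
        (\<integral>\<^sup>+u. indicator K (x - u) * emeasure lborel K ^ c \<partial>lborel)"
      using K by (intro nn_integral_cong) (simp add: ell_eq hits_def indicator_def)
    also have "\<dots> = (\<integral>\<^sup>+u. indicator K (x - u) \<partial>lborel) * emeasure lborel K ^ c"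
      by (rule nn_integral_multc) measurable
    finally show "(\<integral>\<^sup>+u. indicator (hits x) (K, u) * H.ell (K, u) ^ c \<partial>lborel) = emeasure lborel K ^ Suc c"
      by (simp add: emeasure_reflect)
  qed
  finally show ?thesis .
qed

text \<open>A point is vacant iff every single grain misses it. Given the germs, averaging over the
  grains replaces the factor of a germ at \<open>u\<close> by \<open>1 - p u\<close>, with
  \<open>p u\<close> the probability that a grain placed there covers some \<open>x j\<close>; the
  generating functional then yields the exponential of minus \<open>intensity\<close> times the
  integral of \<open>p\<close>, which is the \<open>Q\<close>-mass of the covering pairs.\<close>

lemma void_probability:
  fixes J :: "'i set"
  assumes J: "finite J" and fin: "(\<integral>\<^sup>+K. emeasure lborel K \<partial>law) < \<infinity>"
  shows "(\<integral>\<omega>. (\<Prod>j\<in>J. 1 - indicator (grain_union X Z \<omega>) (x j)) \<partial>M) =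
    exp (- measure Q {p \<in> space Q. \<exists>j\<in>J. p \<in> hits (x j)})"
proof -
  define S where "S = {p \<in> space Q. \<exists>j\<in>J. p \<in> hits (x j)}"
  have [measurable]: "countable J" using J by (rule countable_finite)
  have S_pred [measurable]: "Measurable.pred (compacts_borel \<Otimes>\<^sub>M borel) (\<lambda>p. \<exists>j\<in>J. p \<in> hits (x j))"
    by measurable
  have S_sets: "S \<in> sets Q"
  proof -
    have "{p \<in> space (compacts_borel \<Otimes>\<^sub>M borel). \<exists>j\<in>J. p \<in> hits (x j)} \<in> sets (compacts_borel \<Otimes>\<^sub>M borel)"
      using S_pred unfolding pred_def .
    then show ?thesis by (simp add: S_def sets_Q space_pair_measure)
  qed
  define miss :: "'a \<Rightarrow> 'a set \<Rightarrow> ennreal" where "miss u K = (if \<exists>j\<in>J. (K, u) \<in> hits (x j) then 0 else 1)" for u K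
  have miss_meas [measurable]: "case_prod miss \<in> borel_measurable (borel \<Otimes>\<^sub>M compacts_borel)"
  proof -
    have "Measurable.pred (borel \<Otimes>\<^sub>M compacts_borel) (\<lambda>w. \<exists>j\<in>J. (snd w, fst w) \<in> hits (x j))"
      by (rule measurable_compose[OF _ S_pred]) measurable
    then show ?thesis unfolding miss_def by (simp add: case_prod_beta')
  qed
  define p where "p u = measure law {K \<in> space law. \<exists>j\<in>J. (K, u) \<in> hits (x j)}" for u
  have sec [measurable]: "{K \<in> space law. \<exists>j\<in>J. (K, u) \<in> hits (x j)} \<in> sets law" for u
  proof -
    have "Measurable.pred compacts_borel (\<lambda>K. \<exists>j\<in>J. (K, u) \<in> hits (x j))"
      by (rule measurable_compose[OF _ S_pred, of "\<lambda>K. (K, u)"]) measurable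
    then show ?thesis by (simp add: pred_def)
  qed
  have p01: "0 \<le> p u" "p u \<le> 1" for u by (auto simp: p_def)
  have p_nn: "ennreal (p u) = (\<integral>\<^sup>+K. indicator S (K, u) \<partial>law)" for u
  proof -
    have "(\<integral>\<^sup>+K. indicator S (K, u) \<partial>law) = (\<integral>\<^sup>+K. indicator {K \<in> space law. \<exists>j\<in>J. (K, u) \<in> hits (x j)} K \<partial>law)"
      by (intro nn_integral_cong) (auto simp: S_def indicator_def)
    then show ?thesis using sec by (simp add: p_def law.emeasure_eq_measure)
  qed
  have S_ind: "indicator S \<in> borel_measurable (compacts_borel \<Otimes>\<^sub>M borel)"
    using S_sets by (simp add: sets_Q)
  have p_meas [measurable]: "p \<in> borel_measurable borel"
  proof -
    have "(\<lambda>u. \<integral>\<^sup>+K. indicator S (K, u) \<partial>law) \<in> borel_measurable borel"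
    proof (rule law.borel_measurable_nn_integral)
      have "(\<lambda>w. indicator S (snd w, fst w) :: ennreal) \<in> borel_measurable (borel \<Otimes>\<^sub>M compacts_borel)"
        by (rule measurable_compose[OF _ S_ind]) measurable
      then show "(\<lambda>(u, K). indicator S (K, u) :: ennreal) \<in> borel_measurable (borel \<Otimes>\<^sub>M law)"
        by (simp add: case_prod_beta' cong: measurable_cong_sets sets_pair_measure_cong)
    qed
    then have "(\<lambda>u. enn2real (ennreal (p u))) \<in> borel_measurable borel" unfolding p_nn by measurable
    then show ?thesis using p01 by simp
  qed
  have Q_S: "emeasure Q S = ennreal intensity * (\<integral>\<^sup>+u. ennreal (p u) \<partial>lborel)"
    using nn_integral_Q(2)[OF S_ind] S_sets by (simp add: p_nn)
  have Q_fin: "emeasure Q S < \<infinity>"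
  proof -
    have "emeasure Q S = (\<integral>\<^sup>+p. indicator S p \<partial>Q)" using S_sets by simp
    \<comment> \<open>Union bound over the points; the power 0 brings each term into the form of
      \<open>moment_eq\<close>.\<close>
    also have "\<dots> \<le> (\<integral>\<^sup>+p. (\<Sum>j\<in>J. indicator (hits (x j)) p * H.ell p ^ 0) \<partial>Q)"
    proof (intro nn_integral_mono)
      fix p
      show "indicator S p \<le> (\<Sum>j\<in>J. indicator (hits (x j)) p * H.ell p ^ 0 :: ennreal)"
      proof (cases "p \<in> S")
        case True
        then obtain j where j: "j \<in> J" "p \<in> hits (x j)" by (auto simp: S_def)
        have "1 = (indicator (hits (x j)) p :: ennreal)" using j by simp
        also have "\<dots> \<le> (\<Sum>j\<in>J. indicator (hits (x j)) p)"
          using j J by (intro member_le_sum) auto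
        finally show ?thesis using True by simp
      qed simp
    qed
    also have "\<dots> = (\<Sum>j\<in>J. \<integral>\<^sup>+p. indicator (hits (x j)) p * H.ell p ^ 0 \<partial>Q)"
    proof (rule nn_integral_sum)
      have [measurable]: "Measurable.pred Q (\<lambda>p. p \<in> hits y)" for y
        using pred_hits'[of y] by (simp add: pred_def sets_Q space_pair_measure)
      show "(\<lambda>p. indicator (hits (x j)) p * H.ell p ^ 0) \<in> borel_measurable Q" for j
        unfolding indicator_def by measurable
    qed
    also have "\<dots> = (\<Sum>j\<in>J. ennreal intensity * (\<integral>\<^sup>+K. emeasure lborel K \<partial>law))"
      unfolding moment_eq by simp
    also have "\<dots> < \<infinity>"
      using fin J by (auto simp: ennreal_mult_less_top less_top ennreal_of_nat_eq_real_of_nat)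
    finally show ?thesis .
  qed
  have int_fin: "(\<integral>\<^sup>+u. ennreal (p u) \<partial>lborel) < \<infinity>"
    using Q_fin intensity_pos unfolding Q_S by (auto simp: ennreal_mult_less_top ennreal_eq_0_iff)
  have p_int: "integrable lborel p"
    using int_fin p01 by (intro integrableI_nonneg) auto
  have Q_eq: "measure Q S = intensity * (\<integral>u. p u \<partial>lborel)"
  proof -
    have "(\<integral>\<^sup>+u. ennreal (p u) \<partial>lborel) = ennreal (\<integral>u. p u \<partial>lborel)"
      using p_int p01 by (intro nn_integral_eq_integral) auto
    then have "emeasure Q S = ennreal (intensity * (\<integral>u. p u \<partial>lborel))"
      using Q_S intensity_pos p01 by (simp add: ennreal_mult integral_nonneg_AE)
    then show ?thesis
      using intensity_pos p01 by (simp add: measure_def integral_nonneg_AE)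
  qed
  have miss_nn: "(\<integral>\<^sup>+K. miss u K \<partial>law) = ennreal (1 - p u)" for u
  proof -
    have "(\<integral>\<^sup>+K. miss u K \<partial>law) = (\<integral>\<^sup>+K. indicator (space law - {K \<in> space law. \<exists>j\<in>J. (K, u) \<in> hits (x j)}) K \<partial>law)"
      by (intro nn_integral_cong) (auto simp: miss_def indicator_def)
    also have "\<dots> = emeasure law (space law - {K \<in> space law. \<exists>j\<in>J. (K, u) \<in> hits (x j)})"
      by (intro nn_integral_indicator sets.Diff sets.top sec)
    also have "\<dots> = ennreal (1 - p u)"
      unfolding law.emeasure_eq_measure p_def using sec by (subst law.prob_compl) auto
    finally show ?thesis .
  qed
  define \<eta> where "\<eta> \<omega> = (\<Prod>j\<in>J. 1 - indicator (grain_union X Z \<omega>) (x j) :: real)" for \<omega>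
  have prod_fin: "(\<integral>\<^sup>+\<omega>. (\<Prod>i<m. miss (X i \<omega>) (Z i \<omega>)) \<partial>M) = (\<integral>\<^sup>+\<omega>. ennreal (\<Prod>i<m. 1 - p (X i \<omega>)) \<partial>M)" for m
    unfolding nn_integral_marked_prod[OF miss_meas] miss_nn
    using p01 by (intro nn_integral_cong prod_ennreal) auto
  have \<eta>_eq: "ennreal (\<eta> \<omega>) = (INF m. \<Prod>i<m. miss (X i \<omega>) (Z i \<omega>))" for \<omega>
  proof -
    have mem: "y \<in> grain_union X Z \<omega> \<longleftrightarrow> (\<exists>i. (Z i \<omega>, X i \<omega>) \<in> hits y)" for y
    proof -
      have "y \<in> (\<lambda>x. x + X i \<omega>) ` Z i \<omega> \<longleftrightarrow> y - X i \<omega> \<in> Z i \<omega>" for i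
        by (auto intro!: image_eqI[of _ _ "y - X i \<omega>"])
      then show ?thesis by (simp add: grain_union_def hits_def)
    qed
    show ?thesis
    proof (cases "\<exists>i. \<exists>j\<in>J. (Z i \<omega>, X i \<omega>) \<in> hits (x j)")
      case True
      then obtain i j where ij: "j \<in> J" "(Z i \<omega>, X i \<omega>) \<in> hits (x j)" by auto
      have "\<eta> \<omega> = 0"
        unfolding \<eta>_def using ij J mem[of "x j"] by (intro prod_zero bexI[of _ j]) auto
      moreover have "(\<Prod>i<Suc i. miss (X i \<omega>) (Z i \<omega>)) = 0"
        using ij by (intro prod_zero bexI[of _ i]) (auto simp: miss_def)
      moreover have "(INF m. \<Prod>i<m. miss (X i \<omega>) (Z i \<omega>)) \<le> (\<Prod>i<Suc i. miss (X i \<omega>) (Z i \<omega>))"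
        by (rule INF_lower) simp
      ultimately have "\<eta> \<omega> = 0" "(INF m. \<Prod>i<m. miss (X i \<omega>) (Z i \<omega>)) \<le> 0" by (simp_all only:)
      then show ?thesis by simp
    next
      case False
      then have "\<eta> \<omega> = 1" unfolding \<eta>_def using mem by (intro prod.neutral) auto
      moreover have "(\<Prod>i<m. miss (X i \<omega>) (Z i \<omega>)) = 1" for m
        using False by (intro prod.neutral) (auto simp: miss_def)
      ultimately show ?thesis by simp
    qed
  qed
  have [measurable]: "(\<lambda>\<omega>. miss (X i \<omega>) (Z i \<omega>)) \<in> borel_measurable M" for i
    using measurable_compose[OF measurable_Pair[OF X_measurable Z_measurable] miss_meas] by simp
  have "(\<integral>\<^sup>+\<omega>. ennreal (\<eta> \<omega>) \<partial>M) = (INF m. \<integral>\<^sup>+\<omega>. (\<Prod>i<m. miss (X i \<omega>) (Z i \<omega>)) \<partial>M)"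
    unfolding \<eta>_eq
  proof (rule nn_integral_monotone_convergence_INF_decseq)
    show "decseq (\<lambda>m \<omega>. \<Prod>i<m. miss (X i \<omega>) (Z i \<omega>))"
      by (intro decseq_SucI le_funI) (auto simp: miss_def)
    show "(\<integral>\<^sup>+\<omega>. (\<Prod>i<0. miss (X i \<omega>) (Z i \<omega>)) \<partial>M) < \<infinity>"
      by (simp add: emeasure_space_1)
  qed measurable
  also have "\<dots> = (INF m. \<integral>\<^sup>+\<omega>. ennreal (\<Prod>i<m. 1 - p (X i \<omega>)) \<partial>M)"
    unfolding prod_fin ..
  also have "\<dots> = (\<integral>\<^sup>+\<omega>. product_functional X p \<omega> \<partial>M)"
    unfolding product_functional_def
  proof (rule nn_integral_monotone_convergence_INF_decseq[symmetric])
    show "decseq (\<lambda>m \<omega>. ennreal (\<Prod>i<m. 1 - p (X i \<omega>)))"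
      using decseq_SucD[OF decseq_prod[of "\<lambda>i. 1 - p (X i \<omega>)" for \<omega>]] p01
      by (intro decseq_SucI le_funI ennreal_leI) simp
    show "(\<integral>\<^sup>+\<omega>. ennreal (\<Prod>i<0. 1 - p (X i \<omega>)) \<partial>M) < \<infinity>"
      by (simp add: emeasure_space_1)
  qed measurable
  also have "\<dots> = ennreal (exp (- intensity * (\<integral>u. p u \<partial>lborel)))"
    by (rule product_functional_integral[OF points p_meas p01 p_int])
  finally have nn: "(\<integral>\<^sup>+\<omega>. ennreal (\<eta> \<omega>) \<partial>M) = ennreal (exp (- measure Q S))"
    by (simp add: Q_eq)
  have \<eta>_nonneg: "0 \<le> \<eta> \<omega>" for \<omega>
    unfolding \<eta>_def by (intro prod_nonneg) (auto simp: indicator_def)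
  \<comment> \<open>Needed to pass from the nonnegative integral to the Bochner integral; it holds
    because \<open>\<eta>\<close> is an infimum of countably many measurable products.\<close>
  have "\<eta> \<in> borel_measurable M"
  proof -
    have "(\<lambda>\<omega>. enn2real (ennreal (\<eta> \<omega>))) \<in> borel_measurable M" unfolding \<eta>_eq by measurable
    then show ?thesis using \<eta>_nonneg by simp
  qed
  then have "(\<integral>\<omega>. \<eta> \<omega> \<partial>M) = enn2real (\<integral>\<^sup>+\<omega>. ennreal (\<eta> \<omega>) \<partial>M)"
    using \<eta>_nonneg by (intro integral_eq_nn_integral) auto
  then have "(\<integral>\<omega>. \<eta> \<omega> \<partial>M) = exp (- measure Q S)" unfolding nn by simp
  then show ?thesis unfolding \<eta>_def S_def .
qed

end

section \<open>Exponential generating functions\<close>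

lemma fps_conv_radius_geI:
  fixes F :: "complex fps"
  assumes "0 < D" "\<And>n. cmod (fps_nth F n) \<le> B * D ^ n"
  shows "ereal (1 / D) \<le> fps_conv_radius F"
  unfolding fps_conv_radius_def
proof (rule conv_radius_geI_ex)
  fix r :: real assume r: "0 < r" "ereal r < ereal (1 / D)"
  have "summable (\<lambda>n. fps_nth F n * of_real r ^ n)"
  proof (rule summable_comparison_test')
    show "summable (\<lambda>n. B * (D * r) ^ n)"
      using r assms(1) by (intro summable_mult summable_geometric) (simp add: field_simps)
    show "norm (fps_nth F n * of_real r ^ n) \<le> B * (D * r) ^ n" if "0 \<le> n" for n
      using mult_right_mono[OF assms(2)[of n], of "r ^ n"] r
      by (simp add: norm_mult norm_power power_mult_distrib mult_ac)
  qed
  then show "\<exists>z. cmod z = r \<and> summable (\<lambda>n. fps_nth F n * z ^ n)"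
    using r by (intro exI[of _ "of_real r"]) auto
qed

text \<open>The recursion between moments and cumulants is the differential equation \<open>F' = G' F\<close>
  of the exponential generating functions.\<close>

lemma exp_eval_fps_cumulants:
  fixes \<mu> \<kappa> :: "nat \<Rightarrow> complex"
  assumes \<mu>0: "\<mu> 0 = 1"
    and rec: "\<And>n. \<mu> (Suc n) = (\<Sum>c\<le>n. of_nat (n choose c) * \<kappa> (Suc c) * \<mu> (n - c))"
    and \<kappa>0: "\<kappa> 0 = 0"
  defines "F \<equiv> Abs_fps (\<lambda>n. \<mu> n / fact n)" and "G \<equiv> Abs_fps (\<lambda>n. \<kappa> n / fact n)"
  assumes z: "ereal (cmod z) < R" and R: "R \<le> fps_conv_radius F" "R \<le> fps_conv_radius G"
  shows "exp (eval_fps G z) = eval_fps F z"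
proof -
  have ode: "fps_deriv F = fps_deriv G * F"
  proof (rule fps_ext)
    fix n
    have "fps_nth (fps_deriv G * F) n = (\<Sum>c\<le>n. of_nat (Suc c) * (\<kappa> (Suc c) / fact (Suc c)) * (\<mu> (n - c) / fact (n - c)))"
      by (simp add: fps_mult_nth F_def G_def atLeast0AtMost del: fact_Suc of_nat_Suc)
    also have "\<dots> = (\<Sum>c\<le>n. of_nat (n choose c) * \<kappa> (Suc c) * \<mu> (n - c) / fact n)"
    proof (rule sum.cong)
      fix c assume "c \<in> {..n}"
      then show "of_nat (Suc c) * (\<kappa> (Suc c) / fact (Suc c)) * (\<mu> (n - c) / fact (n - c)) =
          of_nat (n choose c) * \<kappa> (Suc c) * \<mu> (n - c) / fact n"
        by (simp add: binomial_fact field_simps del: of_nat_Suc)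
    qed simp
    also have "\<dots> = \<mu> (Suc n) / fact n"
      by (simp add: rec sum_divide_distrib)
    also have "\<dots> = fps_nth (fps_deriv F) n"
      by (simp add: F_def del: of_nat_Suc)
    finally show "fps_nth (fps_deriv F) n = fps_nth (fps_deriv G * F) n" ..
  qed
  \<comment> \<open>The equation \<open>F' = G' F\<close> says that \<open>F exp (- G)\<close> has
    derivative 0; it is constant on a disk around 0, where its value at the centre is 1.\<close>
  define h where "h w = eval_fps F w * exp (- eval_fps G w)" for w
  have conv: "w \<in> eball 0 (fps_conv_radius F)" "w \<in> eball 0 (fps_conv_radius G)"
    "w \<in> eball 0 (fps_conv_radius (fps_deriv G))" if "w \<in> eball 0 R" for w
    using that R fps_conv_radius_deriv[of G] by (auto simp: in_eball_iff intro: less_le_trans)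
  have h': "(h has_field_derivative 0) (at w)" if w: "w \<in> eball 0 R" for w
  proof -
    have F': "(eval_fps F has_field_derivative eval_fps (fps_deriv F) w) (at w)"
      and G': "(eval_fps G has_field_derivative eval_fps (fps_deriv G) w) (at w)"
      using conv[OF w] by (auto intro!: has_field_derivative_eval_fps)
    have "eval_fps (fps_deriv F) w = eval_fps (fps_deriv G) w * eval_fps F w"
      unfolding ode using conv[OF w] by (intro eval_fps_mult) (auto simp: in_eball_iff)
    with F' have F'': "(eval_fps F has_field_derivative eval_fps (fps_deriv G) w * eval_fps F w) (at w)" by simp
    show ?thesis
      unfolding h_def by (rule derivative_eq_intros F'' G' refl | simp)+
  qed
  obtain r where r: "cmod z < r" "ereal r < R"
    using ereal_dense2[OF z] by auto
  have deriv0: "(h has_field_derivative 0) (at w within ball 0 r)" if "w \<in> ball 0 r" for w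
  proof (rule has_field_derivative_at_within[OF h'])
    have "ereal (cmod w) < ereal r" using that by simp
    also note r(2)
    finally show "w \<in> eball 0 R" by (simp add: in_eball_iff)
  qed
  obtain c where c: "\<And>w. w \<in> ball 0 r \<Longrightarrow> h w = c"
    using has_field_derivative_zero_constant[OF convex_ball deriv0] by blast
  have "z \<in> ball 0 r" "0 \<in> ball 0 r" using r le_less_trans[OF norm_ge_zero r(1)] by auto
  then have "h z = h 0" using c by simp
  also have "h 0 = 1" by (simp add: h_def eval_fps_at_0 F_def G_def \<mu>0 \<kappa>0)
  finally show ?thesis by (simp add: h_def exp_minus field_simps)
qed

lemma (in prob_space) expectation_exp_sums:
  fixes Y :: "'a \<Rightarrow> real"
  assumes [measurable]: "Y \<in> borel_measurable M" and Y: "\<And>\<omega>. \<omega> \<in> space M \<Longrightarrow> \<bar>Y \<omega>\<bar> \<le> C"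
  shows "(\<lambda>n. complex_of_real (\<integral>\<omega>. Y \<omega> ^ n \<partial>M) / fact n * z ^ n) sums (\<integral>\<omega>. exp (z * complex_of_real (Y \<omega>)) \<partial>M)"
proof -
  have C: "0 \<le> C" using Y not_empty by force
  have pow: "\<bar>Y \<omega> ^ n\<bar> \<le> C ^ n" if "\<omega> \<in> space M" for \<omega> n
    using power_mono[OF Y[OF that], of n] by (simp add: power_abs)
  have int: "integrable M (\<lambda>\<omega>. Y \<omega> ^ n)" for n
    using pow by (intro integrable_const_bound[where B = "C ^ n"]) auto
  define f where "f n \<omega> = (z * complex_of_real (Y \<omega>)) ^ n /\<^sub>R fact n" for n \<omega>
  have f_eq: "f n \<omega> = z ^ n / fact n * complex_of_real (Y \<omega> ^ n)" for n \<omega>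
    by (simp add: f_def power_mult_distrib scaleR_conv_of_real field_simps)
  have f_int: "integrable M (f n)" for n
    unfolding f_eq using int by (intro integrable_mult_right integrable_of_real)
  have f_norm: "cmod (f n \<omega>) \<le> (cmod z * C) ^ n /\<^sub>R fact n" if "\<omega> \<in> space M" for n \<omega>
    using pow[OF that, of n]
    by (simp add: f_def norm_mult norm_power power_mult_distrib power_abs mult_left_mono divide_simps)
  have sm: "summable (\<lambda>n. (cmod z * C) ^ n /\<^sub>R fact n)" by (rule summable_exp_generic)
  have "(\<lambda>n. \<integral>\<omega>. f n \<omega> \<partial>M) sums (\<integral>\<omega>. (\<Sum>n. f n \<omega>) \<partial>M)"
  proof (rule sums_integral[OF f_int])
    show "AE \<omega> in M. summable (\<lambda>n. cmod (f n \<omega>))"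
      using f_norm by (intro AE_I2 summable_comparison_test'[OF sm]) auto
    have "(\<integral>\<omega>. cmod (f n \<omega>) \<partial>M) \<le> (\<integral>\<omega>. (cmod z * C) ^ n /\<^sub>R fact n \<partial>M)" for n
      using f_int f_norm by (intro integral_mono) auto
    then show "summable (\<lambda>n. \<integral>\<omega>. cmod (f n \<omega>) \<partial>M)"
      by (intro summable_comparison_test'[OF sm]) (auto simp: prob_space)
  qed
  moreover have "(\<Sum>n. f n \<omega>) = exp (z * complex_of_real (Y \<omega>))" for \<omega>
    unfolding f_def exp_def ..
  moreover have "(\<integral>\<omega>. f n \<omega> \<partial>M) = complex_of_real (\<integral>\<omega>. Y \<omega> ^ n \<partial>M) / fact n * z ^ n" for n
    unfolding f_eq by (simp del: of_real_power)
  ultimately show ?thesis by simp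
qed

section \<open>Convex averaging sequences\<close>

text \<open>A ball lies in a cube, the convex hull of finitely many points. Each of them belongs to
  some window, hence all of them to one window, and convexity does the rest.\<close>

lemma averaging_contains_ball:
  fixes W :: "nat \<Rightarrow> 'a::euclidean_space set"
  assumes "convex_averaging_sequence W"
  shows "\<exists>n0. \<forall>n\<ge>n0. cball 0 r \<subseteq> W n"
proof -
  have W: "\<And>n. convex (W n)" "incseq W" "(\<Union>n. W n) = UNIV"
    using assms by (auto simp: convex_averaging_sequence_def)
  obtain S where S: "finite S" "cball 0 r \<subseteq> convex hull (S :: 'a set)"
  proof -
    define d where "d = \<bar>r\<bar> + 1"
    have d: "0 < d" by (simp add: d_def)
    obtain S where S: "finite S" "cbox (0 - (\<Sum>i\<in>Basis. d *\<^sub>R i)) (0 + (\<Sum>i\<in>Basis. d *\<^sub>R i)) = convex hull (S :: 'a set)"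
      using cube_convex_hull[OF d, of 0] by blast
    have "cball 0 r \<subseteq> cbox (0 - (\<Sum>i\<in>Basis. d *\<^sub>R i)) (0 + (\<Sum>i\<in>Basis. d *\<^sub>R (i::'a)))"
    proof
      fix x :: 'a assume x: "x \<in> cball 0 r"
      have "\<bar>x \<bullet> i\<bar> \<le> d" if "i \<in> Basis" for i
        using Basis_le_norm[OF that, of x] x by (simp add: d_def)
      then show "x \<in> cbox (0 - (\<Sum>i\<in>Basis. d *\<^sub>R i)) (0 + (\<Sum>i\<in>Basis. d *\<^sub>R i))"
        by (force simp: mem_box abs_le_iff)
    qed
    with S that show ?thesis by simp
  qed
  have "\<exists>n. x \<in> W n" for x using W(3) by auto
  then obtain i where i: "x \<in> W (i x)" for x by metis
  define n0 where "n0 = Max (insert 0 (i ` S))"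
  have "S \<subseteq> W n" if "n0 \<le> n" for n
  proof
    fix x assume "x \<in> S"
    then have "i x \<le> n0" using S by (simp add: n0_def)
    then show "x \<in> W n" using i[of x] W(2) that by (meson incseq_def order_trans subsetD)
  qed
  then have "convex hull S \<subseteq> W n" if "n0 \<le> n" for n
    using W(1) that by (simp add: hull_minimal)
  with S show ?thesis by blast
qed

text \<open>If \<open>W n\<close> contains the ball of radius \<open>b / s\<close>, convexity puts
  \<open>(1 - s) x + v\<close> into \<open>W n\<close> for all \<open>x \<in> W n\<close> and
  \<open>|v| \<le> b\<close>. The shrunken window therefore survives all the shifts, and its volume
  is \<open>(1 - s) ^ d\<close> times that of \<open>W n\<close>, with \<open>s\<close> as small as
  desired.\<close>

lemma averaging_shift_ratio:
  fixes W :: "nat \<Rightarrow> 'a::euclidean_space set"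
  assumes W: "convex_averaging_sequence W" and Y: "finite Y"
  shows "(\<lambda>n. measure lborel {t \<in> W n. \<forall>i\<in>Y. y i + t \<in> W n} / measure lborel (W n)) \<longlonglongrightarrow> 1"
proof (rule LIMSEQ_I)
  fix e :: real assume e: "0 < e"
  have W': "\<And>n. compact (W n)" "\<And>n. convex (W n)" "\<And>n. 0 < measure lborel (W n)"
    using W by (auto simp: convex_averaging_sequence_def)
  define d where "d = DIM('a)"
  have "((\<lambda>s. (1 - s) ^ d) \<longlongrightarrow> (1 - 0 :: real) ^ d) (at_right 0)"
    by (intro tendsto_intros)
  then have "eventually (\<lambda>s. 1 - e < (1 - s) ^ d) (at_right (0::real))"
    using e by (intro order_tendstoD(1)) auto
  moreover have "eventually (\<lambda>s::real. 0 < s \<and> s < 1) (at_right 0)"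
    by (auto simp: eventually_at_right_field intro!: exI[of _ 1])
  ultimately have "eventually (\<lambda>s. 1 - e < (1 - s) ^ d \<and> 0 < s \<and> s < (1::real)) (at_right 0)"
    by eventually_elim auto
  then obtain s :: real where s: "1 - e < (1 - s) ^ d" "0 < s" "s < 1"
    using eventually_happens'[OF trivial_limit_at_right_real] by blast
  define b where "b = Max (insert 0 ((norm \<circ> y) ` Y))"
  have b: "norm (y i) \<le> b" if "i \<in> Y" for i using Y that by (simp add: b_def)
  obtain n0 where n0: "\<And>n. n \<ge> n0 \<Longrightarrow> cball 0 (b / s) \<subseteq> W n"
    using averaging_contains_ball[OF W, of "b / s"] by blast
  have "norm (measure lborel {t \<in> W n. \<forall>i\<in>Y. y i + t \<in> W n} / measure lborel (W n) - 1) < e" if n: "n \<ge> n0" for n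
  proof -
    let ?T = "{t \<in> W n. \<forall>i\<in>Y. y i + t \<in> W n}"
    have T_eq: "?T = W n \<inter> (\<Inter>i\<in>Y. (\<lambda>t. y i + t) -` W n)" by auto
    have "closed ?T"
      unfolding T_eq using W'(1)[of n]
      by (intro closed_Int closed_INT ballI continuous_closed_vimage compact_imp_closed) (auto intro: continuous_intros)
    then have T_sets: "?T \<in> sets lborel" "W n \<in> sets lborel"
      using W'(1)[of n] by (auto intro: borel_compact borel_closed)
    have fin: "emeasure lborel (W n) < \<infinity>" using W'(1)[of n] by (intro emeasure_bounded_finite compact_imp_bounded)
    have sub: "(\<lambda>x. (1 - s) *\<^sub>R x) ` W n \<subseteq> ?T"
    proof clarsimp
      fix x assume x: "x \<in> W n"
      have mem: "(1 - s) *\<^sub>R x + v \<in> W n" if "norm v \<le> b" for v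
      proof -
        have "norm ((1 / s) *\<^sub>R v) \<le> b / s" using that s by (simp add: divide_right_mono)
        then have "(1 / s) *\<^sub>R v \<in> W n" using n0[OF n] by auto
        from convexD[OF W'(2)[of n] x this, of "1 - s" s] s show ?thesis by simp
      qed
      have "0 \<le> b" by (simp add: b_def Y)
      with mem[of 0] have "(1 - s) *\<^sub>R x \<in> W n" by simp
      moreover have "y i + (1 - s) *\<^sub>R x \<in> W n" if "i \<in> Y" for i
        using mem[OF b[OF that]] by (simp add: add.commute)
      ultimately show "(1 - s) *\<^sub>R x \<in> W n \<and> (\<forall>i\<in>Y. y i + (1 - s) *\<^sub>R x \<in> W n)" by blast
    qed
    have "(1 - s) ^ d * measure lborel (W n) = measure lborel ((\<lambda>x. (1 - s) *\<^sub>R x) ` W n)"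
    proof -
      have "compact ((\<lambda>x. (1 - s) *\<^sub>R x) ` W n)" using W'(1)[of n] by (rule compact_scaling)
      then have "measure lborel ((\<lambda>x. (1 - s) *\<^sub>R x) ` W n) = measure lebesgue ((\<lambda>x. (1 - s) *\<^sub>R x + 0) ` W n)"
        by (simp add: borel_compact)
      also have "\<dots> = \<bar>1 - s\<bar> ^ d * measure lebesgue (W n)"
        unfolding d_def using measure_lebesgue_affine[of "1 - s" 0 "W n"] by (simp add: add.commute)
      finally show ?thesis using s borel_compact[OF W'(1)[of n]] by simp
    qed
    also have "\<dots> \<le> measure lborel ?T"
    proof (rule measure_mono_fmeasurable[OF sub])
      have "compact ((\<lambda>x. (1 - s) *\<^sub>R x) ` W n)" using W'(1)[of n] by (rule compact_scaling)
      then show "(\<lambda>x. (1 - s) *\<^sub>R x) ` W n \<in> sets lborel" by (auto intro: borel_compact)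
      show "?T \<in> fmeasurable lborel"
        by (rule fmeasurableI2[of "W n"]) (use fin T_sets in \<open>auto simp: fmeasurable_def\<close>)
    qed
    finally have "(1 - s) ^ d \<le> measure lborel ?T / measure lborel (W n)"
      using W'(3)[of n] by (simp add: field_simps)
    moreover have "measure lborel ?T / measure lborel (W n) \<le> 1"
      using W'(3)[of n] fin T_sets by (auto simp: divide_le_eq_1 fmeasurable_def intro!: measure_mono_fmeasurable)
    ultimately show ?thesis using s by simp
  qed
  then show "\<exists>no. \<forall>n\<ge>no. norm (measure lborel {t \<in> W n. \<forall>i\<in>Y. y i + t \<in> W n} / measure lborel (W n) - 1) < e"
    by blast
qed

section \<open>Window integrals\<close>

interpretation PL: product_sigma_finite "\<lambda>_::'i. lborel :: 'a::euclidean_space measure"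
  by standard

lemma finite_measure_window:
  assumes "compact W"
  shows "finite_measure (density lborel (indicator W) :: 'a::euclidean_space measure)"
proof (rule finite_measureI)
  have "emeasure (density lborel (indicator W)) UNIV = emeasure lborel (W \<inter> UNIV)"
    using assms by (intro emeasure_restricted) (auto simp: borel_compact)
  then show "emeasure (density lborel (indicator W)) (space (density lborel (indicator W))) \<noteq> \<infinity>"
    using emeasure_compact_finite[OF assms] by simp
qed

lemma finite_measure_PiM_window:
  assumes W: "compact W" and "finite I"
  shows "finite_measure (PiM I (\<lambda>_. density lborel (indicator W) :: 'a::euclidean_space measure))"
proof
  interpret L: finite_measure "density lborel (indicator W) :: 'a measure" by (rule finite_measure_window[OF W])
  interpret P: product_sigma_finite "\<lambda>_. density lborel (indicator W) :: 'a measure" ..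
  let ?L = "\<lambda>_. density lborel (indicator W) :: 'a measure"
  have "emeasure (PiM I ?L) (Pi\<^sub>E I (\<lambda>_. UNIV)) = (\<Prod>i\<in>I. emeasure (density lborel (indicator W)) (UNIV :: 'a set))"
    using assms by (intro P.emeasure_PiM) auto
  then show "emeasure (PiM I ?L) (space (PiM I ?L)) \<noteq> \<infinity>"
    using L.emeasure_finite[of UNIV] by (simp add: space_PiM power_eq_top_ennreal)
qed

text \<open>Moves the restriction to the window from the measure into the integrand, so that the
  translation invariance of the full product measure can be used.\<close>

lemma PiM_density_indicator:
  fixes W :: "'a::euclidean_space set" and Y :: "'i set"
  assumes Y: "finite Y" and W: "compact W"
  shows "PiM Y (\<lambda>_. density lborel (indicator W)) =
    density (PiM Y (\<lambda>_. lborel)) (\<lambda>x. \<Prod>i\<in>Y. indicator W (x i))"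
proof -
  interpret L: finite_measure "density lborel (indicator W) :: 'a measure" by (rule finite_measure_window[OF W])
  interpret P: product_sigma_finite "\<lambda>_::'i. density lborel (indicator W) :: 'a measure" ..
  have [measurable]: "W \<in> sets borel" using W by (rule borel_compact)
  show ?thesis
  proof (rule P.PiM_eqI[OF Y, symmetric])
    show "sets (density (PiM Y (\<lambda>_. lborel)) (\<lambda>x. \<Prod>i\<in>Y. indicator W (x i))) =
        sets (PiM Y (\<lambda>_. density lborel (indicator W)))"
      unfolding sets_density by (intro sets_PiM_cong) auto
    fix A assume "\<And>i. i \<in> Y \<Longrightarrow> A i \<in> sets (density lborel (indicator W))"
    then have A [measurable]: "A i \<in> sets borel" if "i \<in> Y" for i using that by auto
    have "emeasure (density (PiM Y (\<lambda>_. lborel)) (\<lambda>x. \<Prod>i\<in>Y. indicator W (x i))) (Pi\<^sub>E Y A) =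
       (\<integral>\<^sup>+x. (\<Prod>i\<in>Y. indicator W (x i)) * indicator (Pi\<^sub>E Y A) x \<partial>PiM Y (\<lambda>_. lborel))"
      using A Y by (intro emeasure_density sets_PiM_I_finite) auto
    also have "\<dots> = (\<integral>\<^sup>+x. (\<Prod>i\<in>Y. indicator (W \<inter> A i) (x i)) \<partial>PiM Y (\<lambda>_. lborel))"
    proof (rule nn_integral_cong)
      fix x assume x: "x \<in> space (PiM Y (\<lambda>_. lborel :: 'a measure))"
      have "indicator (Pi\<^sub>E Y A) x = (\<Prod>i\<in>Y. indicator (A i) (x i) :: ennreal)"
      proof (cases "x \<in> Pi\<^sub>E Y A")
        case True
        then show ?thesis by (auto intro!: prod.neutral[symmetric] simp: PiE_def Pi_def)
      next
        case False
        with x obtain i where "i \<in> Y" "x i \<notin> A i" by (auto simp: space_PiM PiE_def)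
        then have "(\<Prod>i\<in>Y. indicator (A i) (x i) :: ennreal) = 0"
          using Y by (intro prod_zero) (auto simp: indicator_def)
        with False show ?thesis by simp
      qed
      then show "(\<Prod>i\<in>Y. indicator W (x i)) * indicator (Pi\<^sub>E Y A) x = (\<Prod>i\<in>Y. indicator (W \<inter> A i) (x i) :: ennreal)"
        by (simp add: prod.distrib indicator_inter_arith)
    qed
    also have "\<dots> = (\<Prod>i\<in>Y. \<integral>\<^sup>+x. indicator (W \<inter> A i) x \<partial>lborel)"
      using A Y by (intro PL.product_nn_integral_prod) auto
    also have "\<dots> = (\<Prod>i\<in>Y. emeasure (density lborel (indicator W)) (A i))"
      using A by (intro prod.cong) (auto simp: emeasure_restricted)
    finally show "emeasure (density (PiM Y (\<lambda>_. lborel)) (\<lambda>x. \<Prod>i\<in>Y. indicator W (x i))) (Pi\<^sub>E Y A) =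
      (\<Prod>i\<in>Y. emeasure (density lborel (indicator W)) (A i))" .
  qed
qed

lemma distr_PiM_translate:
  fixes t :: "'a::euclidean_space" and Y :: "'i set"
  assumes Y: "finite Y"
  shows "distr (PiM Y (\<lambda>_. lborel)) (PiM Y (\<lambda>_. lborel)) (\<lambda>y. \<lambda>i\<in>Y. y i + t) = PiM Y (\<lambda>_. lborel)"
proof (rule PL.PiM_eqI[OF Y])
  fix A :: "'i \<Rightarrow> 'a set" assume "\<And>i. i \<in> Y \<Longrightarrow> A i \<in> sets lborel"
  then have A [measurable]: "A i \<in> sets borel" if "i \<in> Y" for i using that by simp
  have [measurable]: "(\<lambda>y. \<lambda>i\<in>Y. y i + t) \<in> PiM Y (\<lambda>_. lborel) \<rightarrow>\<^sub>M PiM Y (\<lambda>_. lborel)"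
    by (intro measurable_restrict) measurable
  have vim: "(\<lambda>y. \<lambda>i\<in>Y. y i + t) -` Pi\<^sub>E Y A \<inter> space (PiM Y (\<lambda>_. lborel)) = Pi\<^sub>E Y (\<lambda>i. (\<lambda>u. u + t) -` A i)"
    by (auto simp: space_PiM PiE_def Pi_def)
  have "emeasure (distr (PiM Y (\<lambda>_. lborel)) (PiM Y (\<lambda>_. lborel)) (\<lambda>y. \<lambda>i\<in>Y. y i + t)) (Pi\<^sub>E Y A) =
      emeasure (PiM Y (\<lambda>_. lborel)) (Pi\<^sub>E Y (\<lambda>i. (\<lambda>u. u + t) -` A i))"
    using A Y by (subst emeasure_distr) (auto simp: vim intro!: sets_PiM_I_finite)
  also have "\<dots> = (\<Prod>i\<in>Y. emeasure lborel ((\<lambda>u. u + t) -` A i))"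
    using A Y measurable_sets_borel[of "\<lambda>u. u + t"] by (intro PL.emeasure_PiM) auto
  also have "\<dots> = (\<Prod>i\<in>Y. emeasure lborel (A i))"
  proof (rule prod.cong)
    fix i assume i: "i \<in> Y"
    have "emeasure (distr lborel borel ((+) t)) (A i) = emeasure lborel ((\<lambda>u. u + t) -` A i)"
    proof -
      have "(+) t = (\<lambda>u. u + t)" by (auto simp: add.commute)
      then show ?thesis using A[OF i] by (subst emeasure_distr) auto
    qed
    then show "emeasure lborel ((\<lambda>u. u + t) -` A i) = emeasure lborel (A i)"
      by (simp add: lborel_distr_plus)
  qed simp
  finally show "emeasure (distr (PiM Y (\<lambda>_. lborel)) (PiM Y (\<lambda>_. lborel)) (\<lambda>y. \<lambda>i\<in>Y. y i + t)) (Pi\<^sub>E Y A) =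
      (\<Prod>i\<in>Y. emeasure lborel (A i))" .
qed simp

text \<open>Abstracts from the missing probabilities \<open>\<rho>\<close>: \<open>r x J\<close> depends only on the positions
  \<open>x j\<close> with \<open>j \<in> J\<close>.\<close>

locale correlation =
  fixes r :: "(nat \<Rightarrow> 'a::euclidean_space) \<Rightarrow> nat set \<Rightarrow> real" and D :: real
  assumes r_empty [simp]: "r x {} = 1"
    and r_cong: "(\<And>j. j \<in> J \<Longrightarrow> x j = y j) \<Longrightarrow> r x J = r y J"
    and r_measurable: "finite J \<Longrightarrow> (\<lambda>x. r x J) \<in> borel_measurable (PiM UNIV (\<lambda>_. lborel))"
    and r_nonneg: "0 \<le> r x J" and r_le: "r x J \<le> 1"
    and r_shift: "r (\<lambda>i. x i + t) J = r x J"
    and D_pos: "0 < D"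
    and ursell_bound: "finite Y \<Longrightarrow> a \<notin> Y \<Longrightarrow>
      (\<integral>\<^sup>+y. ennreal \<bar>ursell (r (override_on x y Y)) {a} Y\<bar> \<partial>PiM Y (\<lambda>_. lborel)) \<le>
        ennreal (fact (card Y) * D ^ card Y)"
begin

lemma ursell_r_cong:
  assumes "finite Y" "\<And>j. j \<in> X \<union> Y \<Longrightarrow> x j = y j"
  shows "ursell (r x) X Y = ursell (r y) X Y"
  using assms by (intro ursell_cong r_cong) auto

lemma ursell_r_measurable:
  assumes "finite X" "finite Y"
  shows "(\<lambda>x. ursell (r x) X Y) \<in> borel_measurable (PiM UNIV (\<lambda>_. lborel))"
proof -
  let ?r = "\<lambda>x J. if finite J then r x J else 0"
  have "ursell (r x) X Y = ursell (?r x) X Y" for x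
    using assms by (intro ursell_cong) (auto simp: finite_subset)
  moreover have "(\<lambda>x. ursell (?r x) X Y) \<in> borel_measurable (PiM UNIV (\<lambda>_. lborel))"
  proof (rule measurable_ursell)
    show "(\<lambda>x. if finite J then r x J else 0) \<in> borel_measurable (PiM UNIV (\<lambda>_. lborel))" for J
      using r_measurable by (cases "finite J") auto
  qed
  ultimately show ?thesis by simp
qed

lemma ursell_r_shift: "ursell (r (\<lambda>i. x i + t)) X Y = ursell (r x) X Y"
proof -
  have "r (\<lambda>i. x i + t) = r x" by (auto simp: r_shift)
  then show ?thesis by simp
qed

text \<open>A crude bound without control of the growth in \<open>Y\<close>. It only serves to make
  integrals over bounded windows finite.\<close>

lemma ursell_r_bounded:
  assumes "finite Y"
  shows "\<exists>C. \<forall>x. \<bar>ursell (r x) X Y\<bar> \<le> C"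
  using assms
proof (induction Y rule: finite_psubset_induct)
  case (psubset Y)
  have "\<exists>C. \<forall>x. \<bar>ursell (r x) X S\<bar> \<le> C" if "S \<in> Pow Y - {Y}" for S
    using psubset.IH[of S] that by auto
  then obtain C where C: "\<And>S x. S \<in> Pow Y - {Y} \<Longrightarrow> \<bar>ursell (r x) X S\<bar> \<le> C S" by metis
  have "\<bar>ursell (r x) X Y\<bar> \<le> 1 + (\<Sum>S\<in>Pow Y - {Y}. C S)" for x
  proof -
    have "ursell (r x) X Y = r x (X \<union> Y) - (\<Sum>S\<in>Pow Y - {Y}. ursell (r x) X S * r x (Y - S))"
      using psubset.hyps by (subst ursell.simps) simp
    moreover have "\<bar>\<Sum>S\<in>Pow Y - {Y}. ursell (r x) X S * r x (Y - S)\<bar> \<le> (\<Sum>S\<in>Pow Y - {Y}. C S)"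
    proof (rule order_trans[OF sum_abs sum_mono])
      fix S assume S: "S \<in> Pow Y - {Y}"
      have "\<bar>ursell (r x) X S * r x (Y - S)\<bar> \<le> \<bar>ursell (r x) X S\<bar>"
        using r_nonneg r_le by (simp add: abs_mult mult_left_le)
      also have "\<dots> \<le> C S" by (rule C[OF S])
      finally show "\<bar>ursell (r x) X S * r x (Y - S)\<bar> \<le> C S" .
    qed
    ultimately show ?thesis using r_nonneg[of x "X \<union> Y"] r_le[of x "X \<union> Y"] by linarith
  qed
  then show ?case by blast
qed

lemma measurable_finite_coords:
  fixes F :: "(nat \<Rightarrow> 'a) \<Rightarrow> real"
  assumes [measurable]: "F \<in> borel_measurable (PiM UNIV (\<lambda>_. lborel))"
    and cong: "\<And>x y. (\<And>j. j \<in> Y \<Longrightarrow> x j = y j) \<Longrightarrow> F x = F y"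
    and L: "sets L = sets lborel"
  shows "F \<in> borel_measurable (PiM Y (\<lambda>_. L))"
proof -
  have [measurable]: "(\<lambda>y. override_on (\<lambda>_. 0) y Y) \<in> PiM Y (\<lambda>_. lborel) \<rightarrow>\<^sub>M PiM UNIV (\<lambda>_. lborel)"
    by (rule measurable_override_on) simp
  have "(\<lambda>y. F (override_on (\<lambda>_. 0) y Y)) \<in> borel_measurable (PiM Y (\<lambda>_. lborel))" by measurable
  moreover have "F (override_on (\<lambda>_. 0) y Y) = F y" for y by (intro cong) (auto simp: override_on_def)
  moreover have "sets (PiM Y (\<lambda>_. L)) = sets (PiM Y (\<lambda>_. lborel))" using L by (intro sets_PiM_cong) auto
  ultimately show ?thesis by (simp cong: measurable_cong_sets)
qed

section \<open>Moments and cumulants of the vacant volume in a window\<close>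

definition corr_moment :: "'a set \<Rightarrow> nat set \<Rightarrow> real"
  where "corr_moment W Y = (\<integral>x. r x Y \<partial>PiM Y (\<lambda>_. density lborel (indicator W)))"

text \<open>Root and remaining points all range over the window, so this is a cumulant of order
  \<open>card Y + 1\<close>.\<close>

definition window_cumulant :: "'a set \<Rightarrow> nat \<Rightarrow> nat set \<Rightarrow> real"
  where "window_cumulant W a Y =
    (\<integral>x. ursell (r x) {a} Y \<partial>PiM (insert a Y) (\<lambda>_. density lborel (indicator W)))"

text \<open>The defining relation of the Ursell functions, integrated over the window. The two
  factors depend on the disjoint sets of points \<open>insert a S\<close> and \<open>Y - S\<close>,
  so each integral splits into a product.\<close>

lemma corr_moment_insert:
  assumes W: "compact W" and Y: "finite Y" "a \<notin> Y"
  shows "corr_moment W (insert a Y) = (\<Sum>S\<in>Pow Y. window_cumulant W a S * corr_moment W (Y - S))"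
proof -
  interpret L: finite_measure "density lborel (indicator W) :: 'a measure" by (rule finite_measure_window[OF W])
  interpret P: product_sigma_finite "\<lambda>_::nat. density lborel (indicator W) :: 'a measure" ..
  let ?L = "\<lambda>_::nat. density lborel (indicator W)"
  note fin = finite_measure_PiM_window[OF W]
  have fold: "integrable (PiM (insert a Y) ?L) (\<lambda>x. ursell (r x) {a} S * r x (Y - S)) \<and>
      (\<integral>x. ursell (r x) {a} S * r x (Y - S) \<partial>PiM (insert a Y) ?L) = window_cumulant W a S * corr_moment W (Y - S)"
    if S: "S \<in> Pow Y" for S
  proof -
    have finS: "finite S" "finite (Y - S)" using S Y finite_subset by auto
    have un: "insert a S \<union> (Y - S) = insert a Y" and dis: "insert a S \<inter> (Y - S) = {}" using S Y by auto
    interpret F: finite_measure "PiM (insert a Y) ?L" using Y by (intro fin) auto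
    obtain C where C: "\<And>x. \<bar>ursell (r x) {a} S\<bar> \<le> C" using ursell_r_bounded[OF finS(1)] by blast
    have int: "integrable (PiM (insert a Y) ?L) (\<lambda>x. ursell (r x) {a} S * r x (Y - S))"
    proof (rule F.integrable_const_bound[where B = C])
      show "AE x in PiM (insert a Y) ?L. norm (ursell (r x) {a} S * r x (Y - S)) \<le> C"
        using C r_nonneg r_le by (intro AE_I2) (auto simp: abs_mult intro: order_trans[OF mult_left_le])
      show "(\<lambda>x. ursell (r x) {a} S * r x (Y - S)) \<in> borel_measurable (PiM (insert a Y) ?L)"
      proof (rule measurable_finite_coords)
        show "(\<lambda>x. ursell (r x) {a} S * r x (Y - S)) \<in> borel_measurable (PiM UNIV (\<lambda>_. lborel))"
          using finS by (intro borel_measurable_times ursell_r_measurable r_measurable) auto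
        show "ursell (r x) {a} S * r x (Y - S) = ursell (r y) {a} S * r y (Y - S)"
          if "\<And>j. j \<in> insert a Y \<Longrightarrow> x j = y j" for x y
          using that S finS by (intro arg_cong2[where f = "(*)"] ursell_r_cong r_cong) auto
      qed simp
    qed
    have "(\<integral>x. ursell (r x) {a} S * r x (Y - S) \<partial>PiM (insert a Y) ?L) =
      (\<integral>s. \<integral>t. ursell (r (merge (insert a S) (Y - S) (s, t))) {a} S * r (merge (insert a S) (Y - S) (s, t)) (Y - S)
        \<partial>PiM (Y - S) ?L \<partial>PiM (insert a S) ?L)"
      using P.product_integral_fold[OF dis, unfolded un, of "\<lambda>x. ursell (r x) {a} S * r x (Y - S)"] finS int by simp
    also have "\<dots> = (\<integral>s. \<integral>t. ursell (r s) {a} S * r t (Y - S) \<partial>PiM (Y - S) ?L \<partial>PiM (insert a S) ?L)"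
      using finS S Y
      by (intro Bochner_Integration.integral_cong arg_cong2[where f = "(*)"] ursell_r_cong r_cong refl) (auto simp: merge_def)
    also have "\<dots> = window_cumulant W a S * corr_moment W (Y - S)"
      by (simp add: window_cumulant_def corr_moment_def)
    finally show ?thesis using int by simp
  qed
  have "corr_moment W (insert a Y) = (\<integral>x. (\<Sum>S\<in>Pow Y. ursell (r x) {a} S * r x (Y - S)) \<partial>PiM (insert a Y) ?L)"
    unfolding corr_moment_def using Y by (subst ursell_conv) auto
  also have "\<dots> = (\<Sum>S\<in>Pow Y. \<integral>x. ursell (r x) {a} S * r x (Y - S) \<partial>PiM (insert a Y) ?L)"
    using fold by (intro Bochner_Integration.integral_sum) auto
  also have "\<dots> = (\<Sum>S\<in>Pow Y. window_cumulant W a S * corr_moment W (Y - S))"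
    using fold by (intro sum.cong) auto
  finally show ?thesis .
qed

text \<open>The root \<open>a\<close> sits at the origin.\<close>

definition pinned :: "nat \<Rightarrow> nat set \<Rightarrow> (nat \<Rightarrow> 'a) \<Rightarrow> real"
  where "pinned a Y y = ursell (r (override_on (\<lambda>_. 0) y Y)) {a} Y"

text \<open>The volume of the positions of the root for which the whole configuration, seen from the
  root, stays in the window; for one further point it is the set covariance of
  \<open>W\<close>.\<close>

definition overlap :: "'a set \<Rightarrow> nat set \<Rightarrow> (nat \<Rightarrow> 'a) \<Rightarrow> real"
  where "overlap W Y y = measure lborel {t \<in> W. \<forall>i\<in>Y. y i + t \<in> W}"

lemma pinned_integrable:
  assumes Y: "finite Y" "a \<notin> Y"
  shows "integrable (PiM Y (\<lambda>_. lborel)) (pinned a Y)"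
    and "(\<integral>y. \<bar>pinned a Y y\<bar> \<partial>PiM Y (\<lambda>_. lborel)) \<le> fact (card Y) * D ^ card Y"
proof -
  have [measurable]: "(\<lambda>y. override_on (\<lambda>_. 0) y Y) \<in> PiM Y (\<lambda>_. lborel) \<rightarrow>\<^sub>M PiM UNIV (\<lambda>_. lborel)"
    by (rule measurable_override_on) simp
  have [measurable]: "pinned a Y \<in> borel_measurable (PiM Y (\<lambda>_. lborel))"
    unfolding pinned_def[abs_def] using ursell_r_measurable[of "{a}" Y] Y by measurable
  have bound: "(\<integral>\<^sup>+y. ennreal \<bar>pinned a Y y\<bar> \<partial>PiM Y (\<lambda>_. lborel)) \<le> ennreal (fact (card Y) * D ^ card Y)"
    unfolding pinned_def by (rule ursell_bound[OF Y])
  then show int: "integrable (PiM Y (\<lambda>_. lborel)) (pinned a Y)"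
    by (intro integrableI_bounded) (auto intro: le_less_trans)
  have "ennreal (\<integral>y. \<bar>pinned a Y y\<bar> \<partial>PiM Y (\<lambda>_. lborel)) = (\<integral>\<^sup>+y. ennreal \<bar>pinned a Y y\<bar> \<partial>PiM Y (\<lambda>_. lborel))"
    using int by (intro nn_integral_eq_integral[symmetric]) auto
  with bound have "ennreal (\<integral>y. \<bar>pinned a Y y\<bar> \<partial>PiM Y (\<lambda>_. lborel)) \<le> ennreal (fact (card Y) * D ^ card Y)"
    by simp
  then show "(\<integral>y. \<bar>pinned a Y y\<bar> \<partial>PiM Y (\<lambda>_. lborel)) \<le> fact (card Y) * D ^ card Y"
    using D_pos by (subst (asm) ennreal_le_iff) auto
qed

lemma overlap_bounds:
  assumes "compact W" "finite Y"
  shows "0 \<le> overlap W Y y" "overlap W Y y \<le> measure lborel W"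
proof -
  show "0 \<le> overlap W Y y" by (simp add: overlap_def)
  show "overlap W Y y \<le> measure lborel W"
  proof (cases "{t \<in> W. \<forall>i\<in>Y. y i + t \<in> W} \<in> sets lborel")
    case True
    then show ?thesis
      unfolding overlap_def using assms(1)
      by (intro measure_mono_fmeasurable) (auto simp: fmeasurable_compact)
  qed (simp add: overlap_def measure_notin_sets)
qed

text \<open>The other points are described relative to the root at \<open>t\<close>. By translation
  invariance the Ursell function no longer depends on \<open>t\<close>, and by Fubini the integral
  over \<open>t\<close> only measures where the configuration fits into the window.\<close>

lemma window_cumulant_eq:
  assumes W: "compact W" and Y: "finite Y" "a \<notin> Y"
  shows "window_cumulant W a Y = (\<integral>y. pinned a Y y * overlap W Y y \<partial>PiM Y (\<lambda>_. lborel))"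
proof -
  have [measurable]: "W \<in> sets borel" using W by (rule borel_compact)
  let ?F = "\<lambda>x. ursell (r x) {a} Y"
  let ?P = "PiM Y (\<lambda>_::nat. lborel :: 'a measure)"
  let ?h = "\<lambda>t y. indicator W t * (\<Prod>i\<in>Y. indicator W (y i + t)) :: real"
  interpret Y: finite_product_sigma_finite "\<lambda>_::nat. lborel :: 'a measure" Y by standard (rule Y)
  interpret PY: pair_sigma_finite "lborel :: 'a measure" ?P ..
  obtain C where C: "\<And>x. \<bar>?F x\<bar> \<le> C" using ursell_r_bounded[OF Y(1)] by blast
  have F_meas: "?F \<in> borel_measurable (PiM (insert a Y) (\<lambda>_. lborel))"
    by (rule measurable_finite_coords) (use Y in \<open>auto intro: ursell_r_measurable ursell_r_cong\<close>)
  have prod_ennreal_indicator: "(\<Prod>i\<in>I. indicator W (x i) :: ennreal) = ennreal (\<Prod>i\<in>I. indicator W (x i))" for x :: "nat \<Rightarrow> 'a" and I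
    by (subst prod_ennreal[symmetric]) (auto simp: ennreal_indicator)
  have "window_cumulant W a Y = (\<integral>x. ?F x \<partial>density (PiM (insert a Y) (\<lambda>_. lborel)) (\<lambda>x. ennreal (\<Prod>i\<in>insert a Y. indicator W (x i))))"
    unfolding window_cumulant_def using Y W by (subst PiM_density_indicator) (auto simp: prod_ennreal_indicator)
  also have "\<dots> = (\<integral>x. (\<Prod>i\<in>insert a Y. indicator W (x i)) * ?F x \<partial>PiM (insert a Y) (\<lambda>_. lborel))"
    using F_meas by (subst integral_density) (auto intro!: prod_nonneg)
  also have "\<dots> = (\<integral>t. \<integral>y. (\<Prod>i\<in>insert a Y. indicator W ((y(a := t)) i)) * ?F (y(a := t)) \<partial>?P \<partial>lborel)"
  proof -
    let ?G = "\<lambda>x. (\<Prod>i\<in>insert a Y. indicator W (x i)) * ?F x"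
    have W_int: "integrable lborel (indicator W :: 'a \<Rightarrow> real)"
      using emeasure_compact_finite[OF W] by (intro integrable_real_indicator) auto
    have "integrable (PiM (insert a Y) (\<lambda>_::nat. lborel)) (\<lambda>x. C * (\<Prod>i\<in>insert a Y. indicator W (x i) :: real))"
      using Y W_int by (intro integrable_mult_right PL.product_integrable_prod) auto
    then have G_int: "integrable (PiM (insert a Y) (\<lambda>_. lborel)) ?G"
    proof (rule Bochner_Integration.integrable_bound)
      show "?G \<in> borel_measurable (PiM (insert a Y) (\<lambda>_. lborel))" using F_meas by measurable
      show "AE x in PiM (insert a Y) (\<lambda>_. lborel). norm (?G x) \<le> norm (C * (\<Prod>i\<in>insert a Y. indicator W (x i) :: real))"
      proof (rule AE_I2)
        fix x :: "nat \<Rightarrow> 'a"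
        have p: "0 \<le> (\<Prod>i\<in>insert a Y. indicator W (x i) :: real)" by (intro prod_nonneg) auto
        have "norm (?G x) = (\<Prod>i\<in>insert a Y. indicator W (x i)) * \<bar>?F x\<bar>" using p by (simp add: abs_mult del: prod.insert)
        also have "\<dots> \<le> (\<Prod>i\<in>insert a Y. indicator W (x i)) * C" by (intro mult_left_mono C p)
        also have "\<dots> \<le> norm (C * (\<Prod>i\<in>insert a Y. indicator W (x i) :: real))" by (simp add: mult.commute)
        finally show "norm (?G x) \<le> norm (C * (\<Prod>i\<in>insert a Y. indicator W (x i) :: real))" .
      qed
    qed
    have upd: "(\<lambda>(t, y). y(a := t)) \<in> lborel \<Otimes>\<^sub>M ?P \<rightarrow>\<^sub>M PiM (insert a Y) (\<lambda>_. lborel)"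
      using measurable_compose[OF measurable_pair_swap' measurable_add_dim[of a Y "\<lambda>_. lborel :: 'a measure"]]
      by (simp add: case_prod_beta')
    have G_meas: "?G \<in> borel_measurable (PiM (insert a Y) (\<lambda>_. lborel))" using G_int by auto
    have g_meas: "(\<lambda>t. \<integral>y. ?G (y(a := t)) \<partial>?P) \<in> borel_measurable lborel"
      using measurable_compose[OF upd G_meas]
      by (intro Y.borel_measurable_lebesgue_integral) (simp add: case_prod_beta')
    have "(\<integral>x. ?G x \<partial>PiM ({a} \<union> Y) (\<lambda>_. lborel)) =
        (\<integral>s. \<integral>y. ?G (merge {a} Y (s, y)) \<partial>?P \<partial>PiM {a} (\<lambda>_. lborel))"
      using Y G_int by (intro PL.product_integral_fold) auto
    also have "\<dots> = (\<integral>s. \<integral>y. ?G (y(a := s a)) \<partial>?P \<partial>PiM {a} (\<lambda>_. lborel))"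
      using Y by (intro Bochner_Integration.integral_cong arg_cong2[where f = "(*)"] prod.cong ursell_r_cong refl arg_cong[where f = "indicator W"])
        (auto simp: merge_def)
    also have "\<dots> = (\<integral>t. \<integral>y. ?G (y(a := t)) \<partial>?P \<partial>lborel)"
      by (rule PL.product_integral_singleton[OF g_meas])
    finally show ?thesis by simp
  qed
  also have "\<dots> = (\<integral>t. \<integral>y. ?h t y * pinned a Y y \<partial>?P \<partial>lborel)"
  proof (rule Bochner_Integration.integral_cong[OF refl])
    fix t :: 'a
    let ?H = "\<lambda>y. indicator W t * (\<Prod>i\<in>Y. indicator W (y i)) * ?F (y(a := t))"
    have [measurable]: "(\<lambda>y. y(a := t)) \<in> ?P \<rightarrow>\<^sub>M PiM (insert a Y) (\<lambda>_. lborel)"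
    proof -
      have "(\<lambda>y. (y, t)) \<in> ?P \<rightarrow>\<^sub>M ?P \<Otimes>\<^sub>M lborel" by measurable
      from measurable_compose[OF this measurable_add_dim] show ?thesis by simp
    qed
    have [measurable]: "(\<lambda>y. \<lambda>i\<in>Y. y i + t) \<in> ?P \<rightarrow>\<^sub>M ?P"
      by (intro measurable_restrict) measurable
    have H_meas: "?H \<in> borel_measurable ?P" using F_meas by measurable
    have "(\<integral>y. (\<Prod>i\<in>insert a Y. indicator W ((y(a := t)) i)) * ?F (y(a := t)) \<partial>?P) = (\<integral>y. ?H y \<partial>?P)"
    proof (rule Bochner_Integration.integral_cong[OF refl])
      fix y :: "nat \<Rightarrow> 'a"
      have "(\<Prod>i\<in>Y. indicator W ((y(a := t)) i) :: real) = (\<Prod>i\<in>Y. indicator W (y i))"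
        using Y by (intro prod.cong) auto
      then show "(\<Prod>i\<in>insert a Y. indicator W ((y(a := t)) i)) * ?F (y(a := t)) = ?H y" using Y by simp
    qed
    also have "\<dots> = (\<integral>y. ?H y \<partial>distr ?P ?P (\<lambda>y. \<lambda>i\<in>Y. y i + t))"
      unfolding distr_PiM_translate[OF Y(1)] ..
    also have "\<dots> = (\<integral>y. ?H (\<lambda>i\<in>Y. y i + t) \<partial>?P)"
      by (rule integral_distr[OF _ H_meas]) measurable
    also have "\<dots> = (\<integral>y. ?h t y * pinned a Y y \<partial>?P)"
    proof (rule Bochner_Integration.integral_cong[OF refl])
      fix y :: "nat \<Rightarrow> 'a"
      have "?F ((\<lambda>i\<in>Y. y i + t)(a := t)) = ?F (\<lambda>i. override_on (\<lambda>_. 0) y Y i + t)"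
        using Y by (intro ursell_r_cong) (auto simp: override_on_def)
      then have "?F ((\<lambda>i\<in>Y. y i + t)(a := t)) = pinned a Y y" by (simp add: ursell_r_shift pinned_def)
      then show "?H (\<lambda>i\<in>Y. y i + t) = ?h t y * pinned a Y y" by simp
    qed
    finally show "(\<integral>y. (\<Prod>i\<in>insert a Y. indicator W ((y(a := t)) i)) * ?F (y(a := t)) \<partial>?P) =
        (\<integral>y. ?h t y * pinned a Y y \<partial>?P)" .
  qed
  also have "\<dots> = (\<integral>y. \<integral>t. ?h t y * pinned a Y y \<partial>lborel \<partial>?P)"
  proof (rule PY.Fubini_integral[symmetric])
    have "pinned a Y \<in> borel_measurable ?P" using pinned_integrable(1)[OF Y] by auto
    note [measurable] = this
    \<comment> \<open>The majorant keeps only the condition that the root is in \<open>W\<close>. It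
      is a product of integrable functions because the Ursell function with pinned root is
      integrable over the whole space.\<close>
    have "integrable (lborel \<Otimes>\<^sub>M ?P) (\<lambda>(t, y). indicator W t * pinned a Y y)"
    proof (rule PY.Fubini_integrable)
      show "(\<lambda>(t, y). indicator W t * pinned a Y y) \<in> borel_measurable (lborel \<Otimes>\<^sub>M ?P)"
        by (simp add: case_prod_beta')
      have "integrable lborel (\<lambda>t. indicator W t * (\<integral>y. \<bar>pinned a Y y\<bar> \<partial>?P))"
        using emeasure_compact_finite[OF W] by (intro integrable_mult_left integrable_real_indicator) auto
      then show "integrable lborel (\<lambda>t. \<integral>y. norm (case (t, y) of (t, y) \<Rightarrow> indicator W t * pinned a Y y) \<partial>?P)"
        by (simp add: abs_mult)
      show "AE t in lborel. integrable ?P (\<lambda>y. case (t, y) of (t, y) \<Rightarrow> indicator W t * pinned a Y y)"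
        using pinned_integrable(1)[OF Y] by (intro AE_I2) auto
    qed
    then show "integrable (lborel \<Otimes>\<^sub>M ?P) (\<lambda>(t, y). ?h t y * pinned a Y y)"
    proof (rule Bochner_Integration.integrable_bound)
      show "(\<lambda>(t, y). ?h t y * pinned a Y y) \<in> borel_measurable (lborel \<Otimes>\<^sub>M ?P)"
        by (simp add: case_prod_beta')
      have "\<bar>?h t y\<bar> \<le> indicator W t" for t y
      proof -
        have "(\<Prod>i\<in>Y. indicator W (y i + t) :: real) \<le> 1" by (intro prod_le_1) auto
        moreover have "0 \<le> (\<Prod>i\<in>Y. indicator W (y i + t) :: real)" by (intro prod_nonneg) auto
        ultimately show ?thesis by (auto simp: abs_mult intro: mult_left_le)
      qed
      then show "AE w in lborel \<Otimes>\<^sub>M ?P. norm (case w of (t, y) \<Rightarrow> ?h t y * pinned a Y y) \<le>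
          norm (case w of (t, y) \<Rightarrow> indicator W t * pinned a Y y)"
        by (intro AE_I2) (auto simp only: split_beta real_norm_def abs_mult intro!: mult_right_mono abs_ge_zero order_trans[OF _ abs_ge_self])
    qed
  qed
  also have "\<dots> = (\<integral>y. pinned a Y y * overlap W Y y \<partial>?P)"
  proof (rule Bochner_Integration.integral_cong[OF refl])
    fix y :: "nat \<Rightarrow> 'a"
    have "?h t y = indicator {t \<in> W. \<forall>i\<in>Y. y i + t \<in> W} t" for t
    proof (cases "t \<in> W \<and> (\<forall>i\<in>Y. y i + t \<in> W)")
      case True
      then show ?thesis by (auto intro!: prod.neutral)
    next
      case False
      then have "t \<notin> W \<or> (\<Prod>i\<in>Y. indicator W (y i + t) :: real) = 0" using Y by (auto simp: indicator_def)
      with False show ?thesis by auto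
    qed
    then have "(\<integral>t. ?h t y * pinned a Y y \<partial>lborel) = (\<integral>t. indicator {t \<in> W. \<forall>i\<in>Y. y i + t \<in> W} t \<partial>lborel) * pinned a Y y"
      by simp
    also have "(\<integral>t. indicator {t \<in> W. \<forall>i\<in>Y. y i + t \<in> W} t \<partial>lborel) = overlap W Y y"
      by (simp add: overlap_def)
    finally show "(\<integral>t. ?h t y * pinned a Y y \<partial>lborel) = pinned a Y y * overlap W Y y" by simp
  qed
  finally show ?thesis .
qed

section \<open>Window cumulants indexed by their order\<close>

lemma corr_moment_empty [simp]: "corr_moment W {} = 1"
  by (simp add: corr_moment_def PiM_empty)

text \<open>The index \<open>n\<close> counts the points besides the root, so the order of the
  cumulant is \<open>n + 1\<close>.\<close>

definition window_cumulant_card :: "'a set \<Rightarrow> nat \<Rightarrow> real"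
  where "window_cumulant_card W n = window_cumulant W 1 {2..n + 1}"

text \<open>The relation between moments and cumulants determines the cumulants successively. If the
  moments depend only on the number of points, so do the cumulants.\<close>

lemma window_cumulant_card_eq:
  assumes W: "compact W" and m: "\<And>Y. finite Y \<Longrightarrow> corr_moment W Y = m (card Y)"
    and Y: "finite Y" "a \<notin> Y"
  shows "window_cumulant W a Y = window_cumulant_card W (card Y)"
  using Y
proof (induction "card Y" arbitrary: Y a rule: less_induct)
  case less
  define n where "n = card Y"
  \<comment> \<open>The value forced by the moments and the lower cumulants. The case distinction
    removes the term \<open>c = n\<close>, which belongs to the cumulant being computed.\<close>
  define E where "E = m (Suc n) - (\<Sum>c\<le>n. of_nat (n choose c) * (if c = n then 0 else window_cumulant_card W c * m (n - c)))"
  have eq: "window_cumulant W a' Y' = E" if Y': "finite Y'" "a' \<notin> Y'" "card Y' = n" for a' Y'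
  proof -
    have IH: "window_cumulant W a' S = window_cumulant_card W (card S)" if "S \<in> Pow Y' - {Y'}" for S
    proof (rule less.hyps)
      have "S \<subset> Y'" using that by auto
      then show "card S < card Y"
        using Y' psubset_card_mono[of Y' S] by (simp add: n_def)
      show "finite S" "a' \<notin> S" using that Y' finite_subset by auto
    qed
    have "m (Suc n) = corr_moment W (insert a' Y')" using Y' by (simp add: m)
    also have "\<dots> = window_cumulant W a' Y' + (\<Sum>S\<in>Pow Y' - {Y'}. window_cumulant W a' S * corr_moment W (Y' - S))"
      using corr_moment_insert[OF W Y'(1,2)] Y' by (simp add: sum_Pow_split)
    also have "(\<Sum>S\<in>Pow Y' - {Y'}. window_cumulant W a' S * corr_moment W (Y' - S)) =
        (\<Sum>S\<in>Pow Y' - {Y'}. if card S = n then 0 else window_cumulant_card W (card S) * m (n - card S))"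
    proof (rule sum.cong)
      fix S assume S: "S \<in> Pow Y' - {Y'}"
      then have "finite S" "card S < n" using Y' psubset_card_mono[of Y' S] finite_subset by auto
      then show "window_cumulant W a' S * corr_moment W (Y' - S) =
          (if card S = n then 0 else window_cumulant_card W (card S) * m (n - card S))"
        using IH[OF S] S Y' by (auto simp: m card_Diff_subset)
    qed simp
    also have "\<dots> = (\<Sum>S\<in>Pow Y'. if card S = n then 0 else window_cumulant_card W (card S) * m (n - card S))"
      using Y' by (intro sum.mono_neutral_left) auto
    also have "\<dots> = (\<Sum>c\<le>n. of_nat (n choose c) * (if c = n then 0 else window_cumulant_card W c * m (n - c)))"
      using sum_Pow_card[OF Y'(1), of "\<lambda>c. if c = n then 0 else window_cumulant_card W c * m (n - c)"] Y' by simp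
    finally show ?thesis by (simp add: E_def)
  qed
  have "window_cumulant W a Y = E" using less.prems by (intro eq) (auto simp: n_def)
  also have "E = window_cumulant W 1 {2..n + 1}" by (intro eq[symmetric]) auto
  finally show ?case by (simp add: window_cumulant_card_def n_def)
qed

lemma corr_moment_rec:
  assumes W: "compact W" and m: "\<And>Y. finite Y \<Longrightarrow> corr_moment W Y = m (card Y)"
  shows "m (Suc n) = (\<Sum>c\<le>n. of_nat (n choose c) * (window_cumulant_card W c * m (n - c)))"
proof -
  have "m (Suc n) = corr_moment W (insert (n + 1) {1..n})" by (simp add: m)
  also have "\<dots> = (\<Sum>S\<in>Pow {1..n}. window_cumulant W (n + 1) S * corr_moment W ({1..n} - S))"
    by (rule corr_moment_insert[OF W]) auto
  also have "\<dots> = (\<Sum>S\<in>Pow {1..n}. window_cumulant_card W (card S) * m (n - card S))"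
  proof (rule sum.cong)
    fix S assume S: "S \<in> Pow {1..n}"
    then have "finite S" "n + 1 \<notin> S" using finite_subset by auto
    then show "window_cumulant W (n + 1) S * corr_moment W ({1..n} - S) = window_cumulant_card W (card S) * m (n - card S)"
      using S window_cumulant_card_eq[OF W m] by (simp add: m card_Diff_subset)
  qed simp
  also have "\<dots> = (\<Sum>c\<le>n. of_nat (n choose c) * (window_cumulant_card W c * m (n - c)))"
    using sum_Pow_card[of "{1..n}" "\<lambda>c. window_cumulant_card W c * m (n - c)"] by simp
  finally show ?thesis .
qed

lemma window_cumulant_bound:
  assumes W: "compact W"
  shows "\<bar>window_cumulant_card W n\<bar> \<le> measure lborel W * (fact n * D ^ n)"
proof -
  let ?Y = "{2..n + 1}"
  have Y: "finite ?Y" "1 \<notin> ?Y" and card: "card ?Y = n" by auto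
  have "\<bar>window_cumulant_card W n\<bar> \<le> (\<integral>y. \<bar>pinned 1 ?Y y * overlap W ?Y y\<bar> \<partial>PiM ?Y (\<lambda>_. lborel))"
    unfolding window_cumulant_card_def window_cumulant_eq[OF W Y] by (rule integral_abs_bound)
  also have "\<dots> \<le> (\<integral>y. measure lborel W * \<bar>pinned 1 ?Y y\<bar> \<partial>PiM ?Y (\<lambda>_. lborel))"
  proof (rule integral_mono')
    show "integrable (PiM ?Y (\<lambda>_. lborel)) (\<lambda>y. measure lborel W * \<bar>pinned 1 ?Y y\<bar>)"
      using pinned_integrable(1)[OF Y] by auto
    show "\<bar>pinned 1 ?Y y * overlap W ?Y y\<bar> \<le> measure lborel W * \<bar>pinned 1 ?Y y\<bar>" for y
      using overlap_bounds[OF W Y(1), of y] mult_right_mono[of "overlap W ?Y y" "measure lborel W" "\<bar>pinned 1 ?Y y\<bar>"]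
      by (simp add: abs_mult mult.commute)
  qed simp
  also have "\<dots> = measure lborel W * (\<integral>y. \<bar>pinned 1 ?Y y\<bar> \<partial>PiM ?Y (\<lambda>_. lborel))" by simp
  also have "\<dots> \<le> measure lborel W * (fact n * D ^ n)"
    using pinned_integrable(2)[OF Y] unfolding card by (intro mult_left_mono) auto
  finally show ?thesis .
qed

lemma overlap_measurable:
  assumes W: "compact W" and Y: "finite Y"
  shows "overlap W Y \<in> borel_measurable (PiM Y (\<lambda>_. lborel))"
proof -
  have [measurable]: "W \<in> sets borel" using W by (rule borel_compact)
  have [measurable]: "countable Y" using Y by (rule countable_finite)
  have "{w \<in> space (PiM Y (\<lambda>_. lborel) \<Otimes>\<^sub>M lborel). snd w \<in> W \<and> (\<forall>i\<in>Y. fst w i + snd w \<in> W)}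
      \<in> sets (PiM Y (\<lambda>_. lborel) \<Otimes>\<^sub>M lborel)"
    by measurable
  from lborel.measurable_emeasure_Pair[OF this]
  have "(\<lambda>y. emeasure lborel {t \<in> W. \<forall>i\<in>Y. y i + t \<in> W}) \<in> borel_measurable (PiM Y (\<lambda>_. lborel))"
    by (simp add: space_pair_measure vimage_def cong: measurable_cong)
  then show ?thesis
    unfolding overlap_def[abs_def] measure_def by measurable
qed

text \<open>After division by the volume the overlap tends to 1 for every fixed configuration and is
  at most 1, so the integrable function \<open>pinned\<close> dominates.\<close>

lemma window_cumulant_limit:
  assumes W: "convex_averaging_sequence W"
  shows "(\<lambda>n. window_cumulant_card (W n) c / measure lborel (W n)) \<longlonglongrightarrow> (\<integral>y. pinned 1 {2..c + 1} y \<partial>PiM {2..c + 1} (\<lambda>_. lborel))"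
proof -
  let ?Y = "{2..c + 1}"
  have Y: "finite ?Y" "1 \<notin> ?Y" by auto
  have W': "compact (W n)" "0 < measure lborel (W n)" for n
    using W by (auto simp: convex_averaging_sequence_def)
  have int: "integrable (PiM ?Y (\<lambda>_. lborel)) (pinned 1 ?Y)" by (rule pinned_integrable(1)[OF Y])
  have "(\<lambda>n. \<integral>y. pinned 1 ?Y y * (overlap (W n) ?Y y / measure lborel (W n)) \<partial>PiM ?Y (\<lambda>_. lborel))
      \<longlonglongrightarrow> (\<integral>y. pinned 1 ?Y y \<partial>PiM ?Y (\<lambda>_. lborel))"
  proof (rule integral_dominated_convergence)
    show "integrable (PiM ?Y (\<lambda>_. lborel)) (\<lambda>y. \<bar>pinned 1 ?Y y\<bar>)" using int by auto
    show "(\<lambda>y. pinned 1 ?Y y * (overlap (W n) ?Y y / measure lborel (W n))) \<in> borel_measurable (PiM ?Y (\<lambda>_. lborel))" for n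
      using overlap_measurable[OF W'(1) Y(1)] int by (intro borel_measurable_times borel_measurable_divide) auto
    have "(\<lambda>n. pinned 1 ?Y y * (overlap (W n) ?Y y / measure lborel (W n))) \<longlonglongrightarrow> pinned 1 ?Y y * 1" for y
      unfolding overlap_def by (intro tendsto_mult tendsto_const averaging_shift_ratio[OF W Y(1)])
    then show "AE y in PiM ?Y (\<lambda>_. lborel). (\<lambda>n. pinned 1 ?Y y * (overlap (W n) ?Y y / measure lborel (W n))) \<longlonglongrightarrow> pinned 1 ?Y y"
      by (intro AE_I2) simp
    have "\<bar>overlap (W n) ?Y y / measure lborel (W n)\<bar> \<le> 1" for n y
      using overlap_bounds[OF W'(1) Y(1), of n y] W'(2)[of n] by (simp add: divide_le_eq_1)
    then show "AE y in PiM ?Y (\<lambda>_. lborel). norm (pinned 1 ?Y y * (overlap (W n) ?Y y / measure lborel (W n))) \<le> \<bar>pinned 1 ?Y y\<bar>" for n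
      by (intro AE_I2) (simp only: real_norm_def abs_mult mult_left_le abs_ge_zero)
  qed (use int in auto)
  then show ?thesis
    unfolding window_cumulant_card_def window_cumulant_eq[OF W'(1) Y] by simp
qed

text \<open>The cumulant of order \<open>n\<close> of minus the vacant volume: the sign comes from
  the change of sign of the variable, and the shift of the index from \<open>f\<close> counting the
  points besides the root.\<close>

definition cumulant_coeff :: "(nat \<Rightarrow> real) \<Rightarrow> nat \<Rightarrow> complex"
  where "cumulant_coeff f n = (if n = 0 then 0 else (- 1) ^ n * complex_of_real (f (n - 1)))"

lemma cumulant_coeff_bound:
  assumes "\<And>n. \<bar>f n\<bar> \<le> C * (fact n * D ^ n)" "0 \<le> C"
  shows "cmod (cumulant_coeff f n / fact n) \<le> C / D * D ^ n"
proof (cases n)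
  case (Suc k)
  have "cmod (cumulant_coeff f n / fact n) = \<bar>f k\<bar> / fact n"
    by (simp add: cumulant_coeff_def Suc norm_divide norm_mult norm_power del: fact_Suc)
  also have "\<dots> \<le> C * (fact k * D ^ k) / fact n"
    by (intro divide_right_mono assms) auto
  also have "\<dots> = (fact k * (C * D ^ k)) / (fact k * (1 + real k))"
    by (simp add: Suc algebra_simps)
  also have "\<dots> = C * D ^ k / (1 + real k)"
    by (rule mult_divide_mult_cancel_left) simp
  also have "\<dots> \<le> C * D ^ k / 1"
    using D_pos assms(2) by (intro divide_left_mono) auto
  finally show ?thesis using D_pos by (simp add: Suc)
qed (use assms D_pos in \<open>auto simp: cumulant_coeff_def\<close>)

text \<open>\<open>measure lborel W - V\<close> is the covered volume, so the transform equals
  \<open>exp (z * measure lborel W)\<close> times the Laplace transform of \<open>V\<close> at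
  \<open>z\<close>. The latter is the exponential of the cumulant series on the disk where that
  series is known to converge.\<close>

lemma window_log_branch:
  assumes P: "prob_space P" and W: "compact W"
    and V: "V \<in> borel_measurable P" "\<And>\<omega>. \<omega> \<in> space P \<Longrightarrow> 0 \<le> V \<omega> \<and> V \<omega> \<le> measure lborel W"
    and moment: "\<And>Y. finite Y \<Longrightarrow> corr_moment W Y = (\<integral>\<omega>. V \<omega> ^ card Y \<partial>P)"
  shows "log_branch_on {z. cmod z < 1 / D}
    (\<lambda>z. \<integral>\<omega>. exp (z * complex_of_real (measure lborel W - V \<omega>)) \<partial>P)
    (\<lambda>z. z * complex_of_real (measure lborel W) +
      eval_fps (Abs_fps (\<lambda>n. cumulant_coeff (window_cumulant_card W) n / fact n)) z)"
proof -
  interpret P: prob_space P by fact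
  define w where "w = measure lborel W"
  have w: "0 \<le> w" by (simp add: w_def)
  define m where "m n = (\<integral>\<omega>. V \<omega> ^ n \<partial>P)" for n
  define \<mu> where "\<mu> n = (- 1) ^ n * complex_of_real (m n)" for n
  define \<kappa> where "\<kappa> = cumulant_coeff (window_cumulant_card W)"
  define F where "F = Abs_fps (\<lambda>n. \<mu> n / fact n)"
  define G where "G = Abs_fps (\<lambda>n. \<kappa> n / fact n)"
  have m_bound: "\<bar>m n\<bar> \<le> w ^ n" for n
  proof -
    have "\<bar>m n\<bar> \<le> (\<integral>\<omega>. \<bar>V \<omega> ^ n\<bar> \<partial>P)" unfolding m_def by (rule integral_abs_bound)
    also have "\<dots> \<le> (\<integral>\<omega>. w ^ n \<partial>P)"
      using V(2) by (intro integral_mono') (auto simp: w_def power_abs intro!: power_mono)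
    finally show ?thesis by (simp add: P.prob_space)
  qed
  \<comment> \<open>\<open>V\<close> is bounded, so the moment series converges for all
    \<open>z\<close>; the estimate by \<open>exp (w / D)\<close> only puts this into the form needed
    for the given disk.\<close>
  have F_radius: "ereal (1 / D) \<le> fps_conv_radius F"
  proof (rule fps_conv_radius_geI[OF D_pos])
    fix n
    have "cmod (fps_nth F n) = \<bar>m n\<bar> / fact n"
      by (simp add: F_def \<mu>_def norm_divide norm_mult norm_power)
    also have "\<dots> \<le> w ^ n / fact n" by (intro divide_right_mono m_bound) auto
    also have "\<dots> = (w / D) ^ n /\<^sub>R fact n * D ^ n" using D_pos by (simp add: power_divide field_simps)
    also have "\<dots> \<le> exp (w / D) * D ^ n"
    proof (intro mult_right_mono)
      have "(\<Sum>k\<in>{n}. (w / D) ^ k /\<^sub>R fact k) \<le> (\<Sum>k. (w / D) ^ k /\<^sub>R fact k)"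
        using w D_pos by (intro sum_le_suminf summable_exp_generic) auto
      then show "(w / D) ^ n /\<^sub>R fact n \<le> exp (w / D)" by (simp add: exp_def)
    qed (use D_pos in auto)
    finally show "cmod (fps_nth F n) \<le> exp (w / D) * D ^ n" .
  qed
  have G_radius: "ereal (1 / D) \<le> fps_conv_radius G"
  proof (rule fps_conv_radius_geI[OF D_pos])
    show "cmod (fps_nth G n) \<le> w / D * D ^ n" for n
      unfolding G_def \<kappa>_def fps_nth_Abs_fps
      by (rule cumulant_coeff_bound) (use window_cumulant_bound[OF W] in \<open>auto simp: w_def\<close>)
  qed
  have rec: "\<mu> (Suc n) = (\<Sum>c\<le>n. of_nat (n choose c) * \<kappa> (Suc c) * \<mu> (n - c))" for n
  proof -
    have "m (Suc n) = (\<Sum>c\<le>n. of_nat (n choose c) * (window_cumulant_card W c * m (n - c)))"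
      by (rule corr_moment_rec[OF W]) (simp add: moment m_def)
    then have "\<mu> (Suc n) = (\<Sum>c\<le>n. (- 1) ^ Suc n * complex_of_real (of_nat (n choose c) * (window_cumulant_card W c * m (n - c))))"
      by (simp add: \<mu>_def sum_distrib_left del: power_Suc)
    also have "\<dots> = (\<Sum>c\<le>n. of_nat (n choose c) * \<kappa> (Suc c) * \<mu> (n - c))"
    proof (rule sum.cong)
      fix c assume "c \<in> {..n}"
      then have "(- 1 :: complex) ^ Suc n = (- 1) ^ Suc c * (- 1) ^ (n - c)"
        by (simp flip: power_add)
      then show "(- 1) ^ Suc n * complex_of_real (of_nat (n choose c) * (window_cumulant_card W c * m (n - c))) =
          of_nat (n choose c) * \<kappa> (Suc c) * \<mu> (n - c)"
        by (simp add: \<kappa>_def cumulant_coeff_def \<mu>_def del: power_Suc)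
    qed simp
    finally show ?thesis .
  qed
  have eval: "exp (eval_fps G z) = (\<integral>\<omega>. exp (- z * complex_of_real (V \<omega>)) \<partial>P)" if z: "cmod z < 1 / D" for z
  proof -
    have "exp (eval_fps G z) = eval_fps F z"
      unfolding F_def G_def
    proof (rule exp_eval_fps_cumulants[OF _ rec])
      show "\<mu> 0 = 1" by (simp add: \<mu>_def m_def P.prob_space)
      show "\<kappa> 0 = 0" by (simp add: \<kappa>_def cumulant_coeff_def)
      show "ereal (cmod z) < ereal (1 / D)" using z by simp
    qed (use F_radius G_radius in \<open>auto simp: F_def G_def\<close>)
    also have "\<dots> = (\<Sum>n. complex_of_real (m n) / fact n * (- z) ^ n)"
      unfolding eval_fps_def by (intro suminf_cong) (simp add: F_def \<mu>_def power_minus[of z])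
    also have "\<dots> = (\<integral>\<omega>. exp (- z * complex_of_real (V \<omega>)) \<partial>P)"
      unfolding m_def using V
      by (intro sums_unique[symmetric] P.expectation_exp_sums[where C = w]) (auto simp: w_def)
    finally show ?thesis .
  qed
  have holo: "eval_fps G holomorphic_on {z. cmod z < 1 / D}"
  proof (rule holomorphic_on_subset[OF holomorphic_on_eval_fps])
    show "{z. cmod z < 1 / D} \<subseteq> eball 0 (fps_conv_radius G)"
      by (auto simp: in_eball_iff intro!: less_le_trans[OF _ G_radius])
  qed auto
  show ?thesis
    unfolding log_branch_on_def \<kappa>_def[symmetric] G_def[symmetric] w_def[symmetric]
  proof (intro conjI ballI)
    show "(\<lambda>z. z * complex_of_real w + eval_fps G z) holomorphic_on {z. cmod z < 1 / D}"
      by (intro holomorphic_intros holo)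
    show "0 * complex_of_real w + eval_fps G 0 = 0"
      by (simp add: eval_fps_at_0 G_def \<kappa>_def cumulant_coeff_def)
    fix z assume "z \<in> {z. cmod z < 1 / D}"
    then have "exp (z * complex_of_real w + eval_fps G z) =
        exp (z * complex_of_real w) * (\<integral>\<omega>. exp (- z * complex_of_real (V \<omega>)) \<partial>P)"
      by (simp add: exp_add eval)
    also have "\<dots> = (\<integral>\<omega>. exp (z * complex_of_real w) * exp (- z * complex_of_real (V \<omega>)) \<partial>P)" by simp
    also have "\<dots> = (\<integral>\<omega>. exp (z * complex_of_real (w - V \<omega>)) \<partial>P)"
      by (simp flip: exp_add add: algebra_simps)
    finally show "exp (z * complex_of_real w + eval_fps G z) = (\<integral>\<omega>. exp (z * complex_of_real (w - V \<omega>)) \<partial>P)" .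
  qed
qed

text \<open>Division by the volume turns the linear term into \<open>z\<close> and makes the
  cumulant bounds uniform in \<open>n\<close>, which supplies the summable majorant for exchanging
  limit and series.\<close>

lemma log_laplace_limit:
  assumes W: "convex_averaging_sequence W" and z: "cmod z < 1 / D"
  shows "(\<lambda>n. (z * complex_of_real (measure lborel (W n)) +
      eval_fps (Abs_fps (\<lambda>k. cumulant_coeff (window_cumulant_card (W n)) k / fact k)) z) / complex_of_real (measure lborel (W n)))
    \<longlonglongrightarrow> z + eval_fps (Abs_fps (\<lambda>k. cumulant_coeff (\<lambda>c. \<integral>y. pinned 1 {2..c + 1} y \<partial>PiM {2..c + 1} (\<lambda>_. lborel)) k / fact k)) z"
proof -
  have W': "compact (W n)" "0 < measure lborel (W n)" for n
    using W by (auto simp: convex_averaging_sequence_def)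
  define f where "f n c = window_cumulant_card (W n) c / measure lborel (W n)" for n c
  define l where "l c = (\<integral>y. pinned 1 {2..c + 1} y \<partial>PiM {2..c + 1} (\<lambda>_. lborel))" for c
  have f_bound: "\<bar>f n c\<bar> \<le> 1 * (fact c * D ^ c)" for n c
    using window_cumulant_bound[OF W'(1)[of n], of c] W'(2)[of n] by (simp add: f_def field_simps)
  have "(\<lambda>n. \<Sum>k. cumulant_coeff (f n) k / fact k * z ^ k) \<longlonglongrightarrow> (\<Sum>k. cumulant_coeff l k / fact k * z ^ k)"
  proof (rule tannerys_theorem[THEN conjunct2, THEN conjunct2])
    show "(\<lambda>n. cumulant_coeff (f n) k / fact k * z ^ k) \<longlonglongrightarrow> cumulant_coeff l k / fact k * z ^ k" for k
    proof -
      have "(\<lambda>n. f n (k - 1)) \<longlonglongrightarrow> l (k - 1)"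
        unfolding f_def l_def by (rule window_cumulant_limit[OF W])
      then show ?thesis
        unfolding cumulant_coeff_def by (cases "k = 0") (auto intro!: tendsto_intros)
    qed
    have "cmod (cumulant_coeff (f n) k / fact k * z ^ k) \<le> 1 / D * (D * cmod z) ^ k" for n k
      using mult_right_mono[OF cumulant_coeff_bound[of "f n" 1 k, OF f_bound], of "cmod z ^ k"]
      by (simp add: norm_mult norm_power norm_divide power_mult_distrib mult_ac)
    then show "eventually (\<lambda>(k, n). cmod (cumulant_coeff (f n) k / fact k * z ^ k) \<le> 1 / D * (D * cmod z) ^ k)
        (at_top \<times>\<^sub>F sequentially)"
      by (intro always_eventually) auto
    show "summable (\<lambda>k. 1 / D * (D * cmod z) ^ k)"
      using z D_pos by (intro summable_mult summable_geometric) (simp add: field_simps)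
  qed simp
  then have lim: "(\<lambda>n. z + (\<Sum>k. cumulant_coeff (f n) k / fact k * z ^ k)) \<longlonglongrightarrow>
      z + (\<Sum>k. cumulant_coeff l k / fact k * z ^ k)"
    by (intro tendsto_intros)
  have eq: "(z * complex_of_real (measure lborel (W n)) +
      eval_fps (Abs_fps (\<lambda>k. cumulant_coeff (window_cumulant_card (W n)) k / fact k)) z) / complex_of_real (measure lborel (W n)) =
      z + (\<Sum>k. cumulant_coeff (f n) k / fact k * z ^ k)" for n
  proof -
    have coeff: "cumulant_coeff (window_cumulant_card (W n)) k / fact k * z ^ k =
        complex_of_real (measure lborel (W n)) * (cumulant_coeff (f n) k / fact k * z ^ k)" for k
      using W'(2)[of n] by (simp add: cumulant_coeff_def f_def)
    have "summable (\<lambda>k. cumulant_coeff (f n) k / fact k * z ^ k)"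
    proof (rule summable_comparison_test')
      show "summable (\<lambda>k. 1 / D * (D * cmod z) ^ k)"
        using z D_pos by (intro summable_mult summable_geometric) (simp add: field_simps)
      show "cmod (cumulant_coeff (f n) k / fact k * z ^ k) \<le> 1 / D * (D * cmod z) ^ k" if "0 \<le> k" for k
        using mult_right_mono[OF cumulant_coeff_bound[of "f n" 1 k, OF f_bound], of "cmod z ^ k"]
        by (simp add: norm_mult norm_power norm_divide power_mult_distrib mult_ac)
    qed
    then have "eval_fps (Abs_fps (\<lambda>k. cumulant_coeff (window_cumulant_card (W n)) k / fact k)) z =
        complex_of_real (measure lborel (W n)) * (\<Sum>k. cumulant_coeff (f n) k / fact k * z ^ k)"
      unfolding eval_fps_def fps_nth_Abs_fps coeff by (rule suminf_mult)
    then show ?thesis using W'(2)[of n] by (simp add: field_simps)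
  qed
  show ?thesis unfolding eq l_def[symmetric] using lim by (simp add: eval_fps_def)
qed

lemma limit_analytic:
  "(\<lambda>z. z + eval_fps (Abs_fps (\<lambda>k. cumulant_coeff (\<lambda>c. \<integral>y. pinned 1 {2..c + 1} y \<partial>PiM {2..c + 1} (\<lambda>_. lborel)) k / fact k)) z)
    analytic_on {z. cmod z < 1 / D}"
proof -
  define l where "l c = (\<integral>y. pinned 1 {2..c + 1} y \<partial>PiM {2..c + 1} (\<lambda>_. lborel))" for c
  define G where "G = Abs_fps (\<lambda>k. cumulant_coeff l k / fact k)"
  have l_bound: "\<bar>l c\<bar> \<le> 1 * (fact c * D ^ c)" for c
  proof -
    have "\<bar>l c\<bar> \<le> (\<integral>y. \<bar>pinned 1 {2..c + 1} y\<bar> \<partial>PiM {2..c + 1} (\<lambda>_. lborel))"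
      unfolding l_def by (rule integral_abs_bound)
    also have "\<dots> \<le> fact c * D ^ c" using pinned_integrable(2)[of "{2..c + 1}" 1] by simp
    finally show ?thesis by simp
  qed
  have G_radius: "ereal (1 / D) \<le> fps_conv_radius G"
    by (rule fps_conv_radius_geI[OF D_pos, where B = "1 / D"])
      (use cumulant_coeff_bound[OF l_bound] in \<open>auto simp: G_def\<close>)
  have "{z. cmod z < 1 / D} \<subseteq> eball 0 (fps_conv_radius G)"
    by (auto simp: in_eball_iff intro!: less_le_trans[OF _ G_radius])
  then have "(\<lambda>z. z + eval_fps G z) holomorphic_on {z. cmod z < 1 / D}"
    by (intro holomorphic_intros holomorphic_on_subset[OF holomorphic_on_eval_fps]) auto
  moreover have "open {z. cmod z < 1 / D}"
    by (intro open_Collect_less continuous_intros)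
  ultimately show ?thesis
    unfolding G_def l_def by (simp add: analytic_on_open)
qed

end

section \<open>The Poisson grain model\<close>

text \<open>With \<open>y = z v\<close>, the left-hand side is at most
  \<open>v (exp y - 1) \<le> v y exp y\<close>. Since \<open>y \<le> a v / 4\<close>, a quarter of
  the exponent \<open>a v\<close> controls \<open>exp y\<close>, and the other three quarters absorb
  \<open>(a v)^2\<close>.\<close>

lemma exp_moment_pointwise:
  fixes a v z :: real
  assumes a: "0 < a" and z: "0 \<le> z" "z \<le> a / 4" and v: "0 \<le> v"
  shows "(\<Sum>c=1..s. z ^ c / fact c * v ^ Suc c) \<le> 2 * z / a\<^sup>2 * exp (a * v)"
proof -
  define y where "y = z * v"
  have y: "0 \<le> y" "y \<le> a * v / 4" using z v mult_right_mono[OF z(2) v] by (auto simp: y_def)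
  have "(\<Sum>c=1..s. y ^ c / fact c) = (\<Sum>c\<in>insert 0 {1..s}. y ^ c /\<^sub>R fact c) - 1"
    by (simp add: field_simps)
  also have "\<dots> \<le> (\<Sum>c. y ^ c /\<^sub>R fact c) - 1"
    using y by (intro diff_right_mono sum_le_suminf summable_exp_generic) auto
  also have "\<dots> = exp y - 1" by (simp add: exp_def)
  also have "\<dots> \<le> y * exp y"
  proof -
    have "1 - y \<le> exp (- y)" using exp_ge_add_one_self[of "- y"] by simp
    then have "(1 - y) * exp y \<le> exp (- y) * exp y" by (intro mult_right_mono) auto
    then show ?thesis by (simp add: algebra_simps flip: exp_add)
  qed
  also have "\<dots> \<le> y * exp (a * v / 4)" using y by (intro mult_left_mono) auto
  finally have "v * (\<Sum>c=1..s. y ^ c / fact c) \<le> v * (y * exp (a * v / 4))"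
    using v by (rule mult_left_mono)
  also have "\<dots> = z / a\<^sup>2 * ((a * v)\<^sup>2 * exp (a * v / 4))"
    using a by (simp add: y_def power2_eq_square field_simps)
  also have "\<dots> \<le> z / a\<^sup>2 * (2 * exp (a * v))"
  proof (intro mult_left_mono)
    \<comment> \<open>Squaring \<open>2 u \<le> exp u\<close> gives
      \<open>9 / 16 (a v)^2 \<le> exp (3 a v / 4)\<close>, and
      \<open>16 / 9 \<le> 2\<close>.\<close>
    define u where "u = 3 * (a * v) / 8"
    have u: "0 \<le> u" using a v by (simp add: u_def)
    have "u * 2 \<le> exp (u - 1) * exp 1"
      using exp_ge_add_one_self[of "u - 1"] exp_ge_add_one_self[of 1] u by (intro mult_mono) auto
    also have "\<dots> = exp u" by (simp flip: exp_add)
    finally have "(u * 2)\<^sup>2 \<le> (exp u)\<^sup>2" using u by (intro power_mono) auto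
    also have "(exp u)\<^sup>2 = exp (3 * (a * v) / 4)"
      by (simp add: power2_eq_square u_def flip: exp_add)
    also have "(u * 2)\<^sup>2 = 9 / 16 * (a * v)\<^sup>2" by (simp add: u_def power2_eq_square field_simps)
    finally have "(a * v)\<^sup>2 \<le> 2 * exp (3 * (a * v) / 4)"
      using exp_ge_zero[of "3 * (a * v) / 4"] by linarith
    then have "(a * v)\<^sup>2 * exp (a * v / 4) \<le> 2 * exp (3 * (a * v) / 4) * exp (a * v / 4)"
      by (intro mult_right_mono) auto
    also have "\<dots> = 2 * exp (a * v)" by (simp flip: exp_add)
    finally show "(a * v)\<^sup>2 * exp (a * v / 4) \<le> 2 * exp (a * v)" .
  qed (use z a in auto)
  finally show ?thesis
    by (simp add: y_def sum_distrib_left power_mult_distrib mult_ac)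
qed

context poisson_grain_model
begin

lemma nn_integral_law:
  assumes [measurable]: "f \<in> borel_measurable borel"
  shows "(\<integral>\<^sup>+K. f (emeasure lborel K) \<partial>law) = (\<integral>\<^sup>+\<omega>. f (ennreal (measure lborel (Z\<^sub>0 \<omega>))) \<partial>M)"
proof -
  have "(\<integral>\<^sup>+K. f (emeasure lborel K) \<partial>law) = (\<integral>\<^sup>+\<omega>. f (emeasure lborel (Z\<^sub>0 \<omega>)) \<partial>M)"
    unfolding law_def using typical_grain by (subst nn_integral_distr) auto
  also have "\<dots> = (\<integral>\<^sup>+\<omega>. f (ennreal (measure lborel (Z\<^sub>0 \<omega>))) \<partial>M)"
  proof (rule nn_integral_cong)
    fix \<omega> assume "\<omega> \<in> space M"
    then have "compact (Z\<^sub>0 \<omega>)" using measurable_space[OF typical_grain] by (auto simp: compacts_def)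
    then show "f (emeasure lborel (Z\<^sub>0 \<omega>)) = f (ennreal (measure lborel (Z\<^sub>0 \<omega>)))"
      using emeasure_compact_finite[of "Z\<^sub>0 \<omega>"] by (simp add: emeasure_eq_ennreal_measure less_top)
  qed
  finally show ?thesis .
qed

text \<open>The pointwise estimate bounds the moment sum by
  \<open>intensity * (2 * z / a^2 * Ma)\<close>, and \<open>g\<close> is exactly this number for the
  chosen \<open>z\<close>. The summand \<open>a\<close> in the denominator ensures
  \<open>z \<le> a / 4\<close>, as the pointwise estimate requires.\<close>

lemma hitting_momentsI:
  fixes a Ma z g :: real
  assumes a: "0 < a" and int: "integrable M (\<lambda>\<omega>. exp (a * measure lborel (Z\<^sub>0 \<omega>)))"
    and Ma: "Ma = (\<integral>\<omega>. exp (a * measure lborel (Z\<^sub>0 \<omega>)) \<partial>M)"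
    and z: "z = a\<^sup>2 / (4 * (a + intensity * Ma))" and g: "g = intensity * Ma / (2 * (a + intensity * Ma))"
  shows "hitting_moments lborel Q hits z g" and "(\<integral>\<^sup>+K. emeasure lborel K \<partial>law) < \<infinity>"
proof -
  have Ma0: "0 \<le> Ma" unfolding Ma by (intro integral_nonneg_AE) auto
  have aL: "0 < a + intensity * Ma" using a Ma0 intensity_pos by (simp add: add_pos_nonneg)
  have z_pos: "0 < z" using a aL by (simp add: z)
  have z_le: "z \<le> a / 4"
    using a aL Ma0 intensity_pos by (simp add: z field_simps power2_eq_square)
  have exp_int: "(\<integral>\<^sup>+\<omega>. ennreal (C * exp (a * measure lborel (Z\<^sub>0 \<omega>))) \<partial>M) = ennreal (C * Ma)" if "0 \<le> C" for C
    unfolding Ma using int that by (subst nn_integral_eq_integral) auto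
  show fin: "(\<integral>\<^sup>+K. emeasure lborel K \<partial>law) < \<infinity>"
  proof -
    have "(\<integral>\<^sup>+K. emeasure lborel K \<partial>law) = (\<integral>\<^sup>+\<omega>. ennreal (measure lborel (Z\<^sub>0 \<omega>)) \<partial>M)"
      using nn_integral_law[of "\<lambda>x. x"] by simp
    also have "\<dots> \<le> (\<integral>\<^sup>+\<omega>. ennreal (1 / a * exp (a * measure lborel (Z\<^sub>0 \<omega>))) \<partial>M)"
    proof (intro nn_integral_mono ennreal_leI)
      fix \<omega>
      have "a * measure lborel (Z\<^sub>0 \<omega>) \<le> exp (a * measure lborel (Z\<^sub>0 \<omega>))"
        using exp_ge_add_one_self[of "a * measure lborel (Z\<^sub>0 \<omega>)"] by linarith
      then show "measure lborel (Z\<^sub>0 \<omega>) \<le> 1 / a * exp (a * measure lborel (Z\<^sub>0 \<omega>))"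
        using a by (simp add: field_simps)
    qed
    also have "\<dots> < \<infinity>" using a by (subst exp_int) auto
    finally show ?thesis .
  qed
  show "hitting_moments lborel Q hits z g"
  proof unfold_locales
    show "0 < z" by (rule z_pos)
    show "0 \<le> g" using a Ma0 intensity_pos aL by (simp add: g)
    fix x
    have [measurable]: "Measurable.pred Q (\<lambda>p. p \<in> hits x)"
      using pred_hits'[of x] by (simp add: pred_def sets_Q space_pair_measure)
    have "emeasure Q {p \<in> space Q. p \<in> hits x} = (\<integral>\<^sup>+p. indicator {p \<in> space Q. p \<in> hits x} p \<partial>Q)"
      by (rule nn_integral_indicator[symmetric]) measurable
    also have "\<dots> = (\<integral>\<^sup>+p. indicator (hits x) p * H.ell p ^ 0 \<partial>Q)"
      by (intro nn_integral_cong) (simp add: indicator_def)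
    also have "\<dots> < \<infinity>"
      unfolding moment_eq using fin by (simp add: ennreal_mult_less_top)
    finally show "emeasure Q {p \<in> space Q. p \<in> hits x} < \<infinity>" .
    fix s :: nat
    have "(\<Sum>c=1..s. ennreal (z ^ c / fact c) * (\<integral>\<^sup>+p. indicator (hits x) p * H.ell p ^ c \<partial>Q)) =
       ennreal intensity * (\<Sum>c=1..s. ennreal (z ^ c / fact c) * (\<integral>\<^sup>+K. emeasure lborel K ^ Suc c \<partial>law))"
      unfolding moment_eq by (simp add: sum_distrib_left mult_ac)
    also have "(\<Sum>c=1..s. ennreal (z ^ c / fact c) * (\<integral>\<^sup>+K. emeasure lborel K ^ Suc c \<partial>law)) =
        (\<Sum>c=1..s. \<integral>\<^sup>+\<omega>. ennreal (z ^ c / fact c * measure lborel (Z\<^sub>0 \<omega>) ^ Suc c) \<partial>M)"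
    proof (rule sum.cong)
      fix c
      have vol [measurable]: "(\<lambda>\<omega>. ennreal (measure lborel (Z\<^sub>0 \<omega>))) \<in> borel_measurable M"
      proof -
        have "(\<lambda>\<omega>. emeasure lborel (Z\<^sub>0 \<omega>)) \<in> borel_measurable M"
          by (rule measurable_compose[OF typical_grain volume_measurable])
        then have "(\<lambda>\<omega>. enn2real (emeasure lborel (Z\<^sub>0 \<omega>))) \<in> borel_measurable M" by measurable
        then show ?thesis by (simp add: measure_def)
      qed
      have "(\<integral>\<^sup>+K. emeasure lborel K ^ Suc c \<partial>law) = (\<integral>\<^sup>+\<omega>. ennreal (measure lborel (Z\<^sub>0 \<omega>)) ^ Suc c \<partial>M)"
        by (rule nn_integral_law) measurable
      then have "ennreal (z ^ c / fact c) * (\<integral>\<^sup>+K. emeasure lborel K ^ Suc c \<partial>law) =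
          (\<integral>\<^sup>+\<omega>. ennreal (z ^ c / fact c) * ennreal (measure lborel (Z\<^sub>0 \<omega>)) ^ Suc c \<partial>M)"
        by (simp add: nn_integral_cmult del: power_Suc)
      also have "\<dots> = (\<integral>\<^sup>+\<omega>. ennreal (z ^ c / fact c * measure lborel (Z\<^sub>0 \<omega>) ^ Suc c) \<partial>M)"
        by (intro nn_integral_cong, subst ennreal_power, simp, rule ennreal_mult[symmetric]) (use z_pos in auto)
      finally show "ennreal (z ^ c / fact c) * (\<integral>\<^sup>+K. emeasure lborel K ^ Suc c \<partial>law) = \<dots>" .
    qed simp
    also have "\<dots> = (\<integral>\<^sup>+\<omega>. (\<Sum>c=1..s. ennreal (z ^ c / fact c * measure lborel (Z\<^sub>0 \<omega>) ^ Suc c)) \<partial>M)"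
    proof (rule nn_integral_sum[symmetric])
      have "(\<lambda>\<omega>. emeasure lborel (Z\<^sub>0 \<omega>)) \<in> borel_measurable M"
        by (rule measurable_compose[OF typical_grain volume_measurable])
      then have [measurable]: "(\<lambda>\<omega>. measure lborel (Z\<^sub>0 \<omega>)) \<in> borel_measurable M" unfolding measure_def by measurable
      show "(\<lambda>\<omega>. ennreal (z ^ c / fact c * measure lborel (Z\<^sub>0 \<omega>) ^ Suc c)) \<in> borel_measurable M" for c by measurable
    qed
    also have "\<dots> \<le> (\<integral>\<^sup>+\<omega>. ennreal (2 * z / a\<^sup>2 * exp (a * measure lborel (Z\<^sub>0 \<omega>))) \<partial>M)"
    proof (rule nn_integral_mono)
      fix \<omega>
      have "(\<Sum>c=1..s. ennreal (z ^ c / fact c * measure lborel (Z\<^sub>0 \<omega>) ^ Suc c)) =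
          ennreal (\<Sum>c=1..s. z ^ c / fact c * measure lborel (Z\<^sub>0 \<omega>) ^ Suc c)"
        using z_pos by (intro sum_ennreal) auto
      also have "\<dots> \<le> ennreal (2 * z / a\<^sup>2 * exp (a * measure lborel (Z\<^sub>0 \<omega>)))"
        using z_pos z_le by (intro ennreal_leI exp_moment_pointwise a) auto
      finally show "(\<Sum>c=1..s. ennreal (z ^ c / fact c * measure lborel (Z\<^sub>0 \<omega>) ^ Suc c)) \<le> \<dots>" .
    qed
    also have "\<dots> = ennreal (2 * z / a\<^sup>2 * Ma)" using z_pos by (intro exp_int) auto
    finally have "(\<Sum>c=1..s. ennreal (z ^ c / fact c) * (\<integral>\<^sup>+p. indicator (hits x) p * H.ell p ^ c \<partial>Q)) \<le>
       ennreal intensity * ennreal (2 * z / a\<^sup>2 * Ma)" by (simp add: mult_left_mono)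
    also have "\<dots> = ennreal (intensity * (2 * z / a\<^sup>2 * Ma))"
      using z_pos Ma0 intensity_pos by (intro ennreal_mult[symmetric]) auto
    also have "intensity * (2 * z / a\<^sup>2 * Ma) = g"
    proof -
      define A where "A = a + intensity * Ma"
      have "2 * z / a\<^sup>2 = 1 / (2 * A)"
        unfolding z A_def[symmetric] using a aL by (simp add: A_def[symmetric] field_simps)
      then have "2 * z / a\<^sup>2 = 1 / (2 * (a + intensity * Ma))" unfolding A_def .
      then show ?thesis unfolding g by simp
    qed
    finally show "(\<Sum>c=1..s. ennreal (z ^ c / fact c) * (\<integral>\<^sup>+p. indicator (hits x) p * H.ell p ^ c \<partial>Q)) \<le> ennreal g" .
  qed
qed

lemma measure_Q_shift:
  fixes J :: "nat set"
  shows "measure Q {p \<in> space Q. \<exists>j\<in>J. p \<in> hits (x j + t)} = measure Q {p \<in> space Q. \<exists>j\<in>J. p \<in> hits (x j)}"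
proof -
  define S where "S x = {p \<in> space Q. \<exists>j\<in>J. p \<in> hits (x j)}" for x :: "nat \<Rightarrow> 'a"
  have S: "S x \<in> sets (compacts_borel \<Otimes>\<^sub>M borel)" for x
  proof -
    have "{p \<in> space (compacts_borel \<Otimes>\<^sub>M borel). \<exists>j\<in>J. p \<in> hits (x j)} \<in> sets (compacts_borel \<Otimes>\<^sub>M borel)"
      by measurable
    then show ?thesis by (simp add: S_def space_pair_measure)
  qed
  have Q_S: "emeasure Q (S x) = ennreal intensity * (\<integral>\<^sup>+K. \<integral>\<^sup>+u. indicator (S x) (K, u) \<partial>lborel \<partial>law)" for x
  proof -
    have "indicator (S x) \<in> borel_measurable (compacts_borel \<Otimes>\<^sub>M borel)" using S by simp
    from nn_integral_Q(1)[OF this] show ?thesis using S[of x] by (simp add: sets_Q)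
  qed
  have slice: "(\<integral>\<^sup>+u. indicator (S (\<lambda>j. x j + t)) (K, u) \<partial>lborel) = (\<integral>\<^sup>+u. indicator (S x) (K, u) \<partial>lborel)"
    if K: "K \<in> space law" for K
  proof -
    have Kc: "K \<in> space compacts_borel" using K by simp
    have m: "(\<lambda>u. indicator (S y) (K, u) :: ennreal) \<in> borel_measurable borel" for y
    proof -
      have "(\<lambda>u. (K, u)) \<in> borel \<rightarrow>\<^sub>M compacts_borel \<Otimes>\<^sub>M borel" using Kc by measurable
      from measurable_compose[OF this] S show ?thesis by (metis borel_measurable_indicator)
    qed
    have "(\<integral>\<^sup>+u. indicator (S (\<lambda>j. x j + t)) (K, u) \<partial>lborel) =
        (\<integral>\<^sup>+u. indicator (S (\<lambda>j. x j + t)) (K, u) \<partial>distr lborel borel ((+) t))"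
      unfolding lborel_distr_plus ..
    also have "\<dots> = (\<integral>\<^sup>+u. indicator (S (\<lambda>j. x j + t)) (K, t + u) \<partial>lborel)"
      using m by (intro nn_integral_distr) auto
    also have "\<dots> = (\<integral>\<^sup>+u. indicator (S x) (K, u) \<partial>lborel)"
      by (intro nn_integral_cong) (auto simp: S_def hits_def indicator_def algebra_simps)
    finally show ?thesis .
  qed
  have "(\<integral>\<^sup>+K. \<integral>\<^sup>+u. indicator (S (\<lambda>j. x j + t)) (K, u) \<partial>lborel \<partial>law) =
      (\<integral>\<^sup>+K. \<integral>\<^sup>+u. indicator (S x) (K, u) \<partial>lborel \<partial>law)"
    by (rule nn_integral_cong) (rule slice)
  then have "emeasure Q (S (\<lambda>j. x j + t)) = emeasure Q (S x)"
    unfolding Q_S by simp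
  then show ?thesis by (simp add: measure_def S_def)
qed

lemma eta_measurable: "(\<lambda>w. 1 - indicator (grain_union X Z (snd w)) (fst w) :: real) \<in> borel_measurable (borel \<Otimes>\<^sub>M M)"
  using jointly_measurable by (simp add: case_prod_beta')

lemma eta_measurable': "(\<lambda>\<omega>. 1 - indicator (grain_union X Z \<omega>) x :: real) \<in> borel_measurable M"
proof -
  have "(\<lambda>\<omega>. (x, \<omega>)) \<in> M \<rightarrow>\<^sub>M borel \<Otimes>\<^sub>M M" by measurable
  from measurable_compose[OF this eta_measurable] show ?thesis by simp
qed

section \<open>The vacant volume in a window\<close>

definition vacant :: "'a set \<Rightarrow> 'w \<Rightarrow> real"
  where "vacant W \<omega> = (\<integral>x. 1 - indicator (grain_union X Z \<omega>) x \<partial>density lborel (indicator W))"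

lemma vacant_measurable:
  assumes "compact W"
  shows "vacant W \<in> borel_measurable M"
proof -
  interpret L: finite_measure "density lborel (indicator W) :: 'a measure" by (rule finite_measure_window[OF assms])
  have swap: "(\<lambda>w. (snd w, fst w)) \<in> M \<Otimes>\<^sub>M density lborel (indicator W) \<rightarrow>\<^sub>M borel \<Otimes>\<^sub>M M" by measurable
  show ?thesis
    unfolding vacant_def[abs_def]
    by (rule L.borel_measurable_lebesgue_integral)
      (use measurable_compose[OF swap eta_measurable] in \<open>simp add: case_prod_beta'\<close>)
qed

lemma vacant_eq:
  assumes W: "compact W" and \<omega>: "\<omega> \<in> space M"
  shows "vacant W \<omega> = measure lborel W - measure lborel (grain_union X Z \<omega> \<inter> W)"
    and "0 \<le> vacant W \<omega>" "vacant W \<omega> \<le> measure lborel W"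
proof -
  have "(\<lambda>x. (x, \<omega>)) \<in> borel \<rightarrow>\<^sub>M borel \<Otimes>\<^sub>M M" using \<omega> by measurable
  from measurable_compose[OF this jointly_measurable]
  have "(\<lambda>x. indicator (grain_union X Z \<omega>) x :: real) \<in> borel_measurable borel" by simp
  then have S [measurable]: "grain_union X Z \<omega> \<in> sets borel"
    by (simp add: borel_measurable_indicator_iff)
  have [measurable]: "W \<in> sets borel" using W by (rule borel_compact)
  have fin: "emeasure lborel W < \<infinity>" by (rule emeasure_compact_finite[OF W])
  have fin': "emeasure lborel (grain_union X Z \<omega> \<inter> W) < \<infinity>"
    by (rule le_less_trans[OF emeasure_mono fin]) auto
  have "vacant W \<omega> = (\<integral>x. indicator W x * (1 - indicator (grain_union X Z \<omega>) x) \<partial>lborel)"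
    unfolding vacant_def
    using integral_density[of "\<lambda>x. 1 - indicator (grain_union X Z \<omega>) x :: real" lborel "indicator W"]
    by (simp add: ennreal_indicator)
  also have "\<dots> = (\<integral>x. indicator W x - indicator (grain_union X Z \<omega> \<inter> W) x \<partial>lborel)"
    by (intro Bochner_Integration.integral_cong) (auto simp: indicator_def)
  also have "\<dots> = measure lborel W - measure lborel (grain_union X Z \<omega> \<inter> W)"
    using fin fin' by (subst Bochner_Integration.integral_diff) auto
  finally show eq: "vacant W \<omega> = measure lborel W - measure lborel (grain_union X Z \<omega> \<inter> W)" .
  show "vacant W \<omega> \<le> measure lborel W" unfolding eq by simp
  show "0 \<le> vacant W \<omega>" unfolding vacant_def by (intro integral_nonneg_AE) (auto simp: indicator_def)
qed

text \<open>Robbins' formula: a power of the vacant volume is an iterated integral of products of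
  vacancy indicators, and joint measurability permits taking the expectation inside.\<close>

lemma vacant_moment:
  fixes Y :: "nat set"
  assumes W: "compact W" and Y: "finite Y"
  shows "(\<integral>x. (\<integral>\<omega>. (\<Prod>j\<in>Y. 1 - indicator (grain_union X Z \<omega>) (x j)) \<partial>M) \<partial>PiM Y (\<lambda>_. density lborel (indicator W))) =
    (\<integral>\<omega>. vacant W \<omega> ^ card Y \<partial>M)"
proof -
  let ?L = "density lborel (indicator W) :: 'a measure"
  let ?PY = "PiM Y (\<lambda>_::nat. ?L)"
  interpret L: finite_measure ?L by (rule finite_measure_window[OF W])
  interpret P: product_sigma_finite "\<lambda>_::nat. ?L" ..
  interpret PY: finite_measure ?PY by (rule finite_measure_PiM_window[OF W Y])
  interpret pair_sigma_finite ?PY M ..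
  interpret fin: finite_measure "?PY \<Otimes>\<^sub>M M"
    by (intro finite_measure_pair_measure) unfold_locales
  have meas: "(\<lambda>w. 1 - indicator (grain_union X Z (snd w)) (fst w j) :: real) \<in> borel_measurable (?PY \<Otimes>\<^sub>M M)"
    if "j \<in> Y" for j
  proof -
    have "(\<lambda>w. (fst w j, snd w)) \<in> ?PY \<Otimes>\<^sub>M M \<rightarrow>\<^sub>M borel \<Otimes>\<^sub>M M"
    proof (rule measurable_Pair)
      show "(\<lambda>w. fst w j) \<in> ?PY \<Otimes>\<^sub>M M \<rightarrow>\<^sub>M borel"
        using measurable_compose[OF measurable_fst measurable_component_singleton[OF that], of "\<lambda>_. ?L" M]
        by (simp cong: measurable_cong_sets)
    qed measurable
    from measurable_compose[OF this eta_measurable] show ?thesis by simp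
  qed
  let ?f = "\<lambda>w. \<Prod>j\<in>Y. (1::real) - indicator (grain_union X Z (snd w)) (fst w j)"
  have "integrable (?PY \<Otimes>\<^sub>M M) ?f"
  proof (rule fin.integrable_const_bound[where B = 1])
    show "?f \<in> borel_measurable (?PY \<Otimes>\<^sub>M M)"
      by (intro borel_measurable_prod meas)
    have "norm (?f w) \<le> 1" for w
      unfolding real_norm_def abs_prod by (rule prod_le_1) (auto simp: indicator_def)
    then show "AE w in ?PY \<Otimes>\<^sub>M M. norm (?f w) \<le> 1" by (rule AE_I2)
  qed
  then have "integrable (?PY \<Otimes>\<^sub>M M) (\<lambda>(x, \<omega>). \<Prod>j\<in>Y. (1::real) - indicator (grain_union X Z \<omega>) (x j))"
    by (simp add: case_prod_beta')
  from Fubini_integral[OF this]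
  have "(\<integral>x. (\<integral>\<omega>. (\<Prod>j\<in>Y. (1::real) - indicator (grain_union X Z \<omega>) (x j)) \<partial>M) \<partial>?PY) =
    (\<integral>\<omega>. (\<integral>x. (\<Prod>j\<in>Y. (1::real) - indicator (grain_union X Z \<omega>) (x j)) \<partial>?PY) \<partial>M)" by simp
  also have "\<dots> = (\<integral>\<omega>. vacant W \<omega> ^ card Y \<partial>M)"
  proof (rule Bochner_Integration.integral_cong[OF refl])
    fix \<omega> assume \<omega>: "\<omega> \<in> space M"
    have "(\<lambda>x. (x, \<omega>)) \<in> borel \<rightarrow>\<^sub>M borel \<Otimes>\<^sub>M M" using \<omega> by measurable
    from measurable_compose[OF this eta_measurable]
    have "(\<lambda>x. 1 - indicator (grain_union X Z \<omega>) x :: real) \<in> borel_measurable ?L" by simp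
    then have "integrable ?L (\<lambda>x. 1 - indicator (grain_union X Z \<omega>) x :: real)"
      by (intro L.integrable_const_bound[where B = 1]) (auto simp: indicator_def)
    then have "(\<integral>x. (\<Prod>j\<in>Y. 1 - indicator (grain_union X Z \<omega>) (x j)) \<partial>?PY) = (\<Prod>j\<in>Y. vacant W \<omega>)"
      unfolding vacant_def using Y by (intro P.product_integral_prod) auto
    then show "(\<integral>x. (\<Prod>j\<in>Y. 1 - indicator (grain_union X Z \<omega>) (x j)) \<partial>?PY) = vacant W \<omega> ^ card Y" by simp
  qed
  finally show ?thesis .
qed

end

theorem theorem1:
  fixes P :: "'w measure"
    and lam a M\<^sub>a H \<Delta> :: real
    and X :: "nat \<Rightarrow> 'w \<Rightarrow> 'a::euclidean_space"
    and Z :: "nat \<Rightarrow> 'w \<Rightarrow> 'a set"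
    and Z\<^sub>0 :: "'w \<Rightarrow> 'a set"
    and \<Xi> :: "'w \<Rightarrow> 'a set"
    and W :: "nat \<Rightarrow> 'a set"
  assumes "poisson_grain_model P lam X Z Z\<^sub>0"
    and "\<Xi> = grain_union X Z"
    and "0 < a"
    and "integrable P (\<lambda>\<omega>. exp (a * measure lborel (Z\<^sub>0 \<omega>)))"
    and "M\<^sub>a = (\<integral>\<omega>. exp (a * measure lborel (Z\<^sub>0 \<omega>)) \<partial>P)"
    and "convex_averaging_sequence W"
    and "H = 8 * lam * M\<^sub>a * (1 + exp (lam * (\<integral>\<omega>. measure lborel (Z\<^sub>0 \<omega>) \<partial>P))) / a\<^sup>2"
    and "\<Delta> = 8 * (a + lam * M\<^sub>a) * (1 + exp (lam * (\<integral>\<omega>. measure lborel (Z\<^sub>0 \<omega>) \<partial>P))) / a\<^sup>2"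
  shows "(\<forall>k\<ge>2.
        integrable (PiM {2..k} (\<lambda>_. lborel)) (\<lambda>x. cmod (set_cumulant P \<Xi> k (x(1 := 0)))) \<and>
        (\<integral>x. cmod (set_cumulant P \<Xi> k (x(1 := 0))) \<partial>PiM {2..k} (\<lambda>_. lborel))
          \<le> fact (k - 1) * H * \<Delta> ^ (k - 2)) \<and>
    (\<exists>logE L.
        (\<forall>n. log_branch_on {z. cmod z < 1 / \<Delta>}
          (\<lambda>z. \<integral>\<omega>. exp (z * complex_of_real (measure lborel (\<Xi> \<omega> \<inter> W n))) \<partial>P) (logE n)) \<and>
        (\<forall>z. cmod z < 1 / \<Delta> \<longrightarrow>
          (\<lambda>n. logE n z / complex_of_real (measure lborel (W n))) \<longlonglongrightarrow> L z) \<and>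
        L analytic_on {z. cmod z < 1 / \<Delta>})"
proof -
  interpret G: poisson_grain_model P lam X Z Z\<^sub>0 by fact
  note a = \<open>0 < a\<close> and W = \<open>convex_averaging_sequence W\<close>
  define A where "A = a + lam * M\<^sub>a"
  define z where "z = a\<^sup>2 / (4 * A)"
  define g where "g = lam * M\<^sub>a / (2 * A)"
  \<comment> \<open>The growth rate \<open>4 / z\<close> delivered by the induction.\<close>
  define b where "b = 16 * A / a\<^sup>2"
  have Ma: "0 \<le> M\<^sub>a" unfolding assms(5) by (intro integral_nonneg_AE) auto
  have lM: "0 \<le> lam * M\<^sub>a" using Ma G.intensity_pos by simp
  have A: "0 < A" using a lM by (simp add: A_def)
  have z_b: "4 / z = b" using a A by (simp add: z_def b_def)
  have b_pos: "0 < b" using a A by (simp add: b_def)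
  note HM' = G.hitting_momentsI[OF a assms(4,5) z_def[unfolded A_def] g_def[unfolded A_def]]
  interpret HM: hitting_moments lborel G.Q G.hits z g by (rule HM'(1))
  have g: "0 \<le> g" "g \<le> 1 / 2"
    using lM a A by (auto simp: g_def A_def divide_le_eq)
  \<comment> \<open>For \<open>0 \<le> g \<le> 1 / 2\<close> the quadratic term is at most
    \<open>g\<close>, so \<open>exp g - 1 \<le> 2 g\<close>; the denominator 2 in \<open>g\<close>
    is made for this.\<close>
  have exp_g: "exp g - 1 \<le> lam * M\<^sub>a / A"
  proof -
    have "exp g \<le> 1 + g + g\<^sup>2" using g by (intro exp_bound) auto
    also have "g\<^sup>2 \<le> g" using g by (simp add: power2_eq_square mult_left_le)
    moreover have "2 * g = lam * M\<^sub>a / A" by (simp add: g_def)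
    ultimately show ?thesis by linarith
  qed
  have lMA: "lam * M\<^sub>a / A \<le> 1" using a A by (simp add: A_def)
  have exp_g2: "exp g \<le> 2" using exp_g lMA by simp
  define E where "E = exp (lam * (\<integral>\<omega>. measure lborel (Z\<^sub>0 \<omega>) \<partial>P))"
  have E: "1 \<le> E"
    unfolding E_def using G.intensity_pos by (auto intro!: mult_nonneg_nonneg integral_nonneg_AE)
  \<comment> \<open>The given constant exceeds the growth rate by the factor
    \<open>(1 + E) / 2 \<ge> 1\<close>; \<open>H\<close> exceeds what is needed by the same
    factor.\<close>
  have \<Delta>_eq: "\<Delta> = b * ((1 + E) / 2)" unfolding assms(8) b_def A_def[symmetric] E_def[symmetric] using a by (simp add: field_simps)
  have b_le: "b \<le> \<Delta>" unfolding \<Delta>_eq using E b_pos by simp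
  have \<Delta>_pos: "0 < \<Delta>" using b_le b_pos by simp
  have H_ge: "(exp g - 1) * b \<le> H"
  proof -
    have "(exp g - 1) * b \<le> lam * M\<^sub>a / A * b" using exp_g b_pos by (intro mult_right_mono) auto
    also have "\<dots> = 8 * lam * M\<^sub>a * 2 / a\<^sup>2" using A by (simp add: b_def)
    also have "\<dots> \<le> 8 * lam * M\<^sub>a * (1 + E) / a\<^sup>2"
      using E lM by (intro divide_right_mono mult_left_mono) (auto simp: mult.commute)
    finally show ?thesis by (simp add: assms(7) E_def)
  qed
  have ursell_le: "(\<integral>\<^sup>+y. ennreal \<bar>ursell (HM.rho (override_on x y Y)) {c} Y\<bar> \<partial>PiM Y (\<lambda>_. lborel)) \<le>
      ennreal ((exp g - 1) * (fact (card Y) * b ^ card Y))"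
    if Y: "finite Y" "c \<notin> Y" "Y \<noteq> {}" for x :: "nat \<Rightarrow> 'a" and c Y
  proof -
    have "fact (card Y) / (z / 4) ^ card Y = fact (card Y) * b ^ card Y"
      unfolding z_b[symmetric] by (simp add: power_divide)
    then show ?thesis
      using HM.ursell_singleton_bound[OF exp_g2 Y, of x] by (simp add: weight_def)
  qed
  interpret C: correlation HM.rho \<Delta>
  proof
    show "HM.rho x {} = 1" for x :: "nat \<Rightarrow> 'a" by simp
    show "HM.rho x J = HM.rho y J" if "\<And>j. j \<in> J \<Longrightarrow> x j = y j" for J and x y :: "nat \<Rightarrow> 'a"
      using that by (rule HM.rho_cong)
    show "(\<lambda>x. HM.rho x J) \<in> borel_measurable (PiM UNIV (\<lambda>_. lborel))" if "finite J" for J :: "nat set"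
      using that by (rule HM.rho_measurable)
    show "0 \<le> HM.rho x J" "HM.rho x J \<le> 1" for x :: "nat \<Rightarrow> 'a" and J
      by (auto simp: HM.rho_def HM.V_def)
    show "HM.rho (\<lambda>i. x i + t) J = HM.rho x J" for x :: "nat \<Rightarrow> 'a" and t J
      unfolding HM.rho_def HM.V_def G.measure_Q_shift ..
    show "0 < \<Delta>" by (rule \<Delta>_pos)
    fix x :: "nat \<Rightarrow> 'a" and c :: nat and Y :: "nat set" assume Y: "finite Y" "c \<notin> Y"
    show "(\<integral>\<^sup>+y. ennreal \<bar>ursell (HM.rho (override_on x y Y)) {c} Y\<bar> \<partial>PiM Y (\<lambda>_. lborel)) \<le>
      ennreal (fact (card Y) * \<Delta> ^ card Y)"
    \<comment> \<open>Without further points the Ursell function is a vacancy probability, so it is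
      bounded by 1 but lacks the factor \<open>exp g - 1\<close>. In the other case this factor is
      at most 1 and is given away.\<close>
    proof (cases "Y = {}")
      case True
      then show ?thesis
        by (simp add: ursell.simps[of _ _ "{}"] PiM_empty HM.rho_def HM.V_def)
    next
      case False
      have "(exp g - 1) * (fact (card Y) * b ^ card Y) \<le> 1 * (fact (card Y) * \<Delta> ^ card Y)"
        using exp_g2 g b_pos b_le by (intro mult_mono power_mono) auto
      from order_trans[OF ursell_le[OF Y False] ennreal_leI[OF this]] show ?thesis by simp
    qed
  qed
  have rho_eq: "(\<integral>\<omega>. (\<Prod>j\<in>J. 1 - indicator (\<Xi> \<omega>) (x j)) \<partial>P) = HM.rho x J" if "finite J" for J :: "nat set" and x
    unfolding HM.rho_def HM.V_def assms(2) by (rule G.void_probability[OF that HM'(2)])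
  \<comment> \<open>The computation by derivatives makes \<open>k\<close> the root. Symmetry moves
    the root to index 1, whose point is the origin, and the modulus removes the sign that comes from
    passing to vacancies.\<close>
  have cumulant: "cmod (set_cumulant P \<Xi> k (x(1 := 0))) = \<bar>C.pinned 1 {2..k} x\<bar>" if k: "2 \<le> k" for k x
  proof -
    let ?x = "x(1 := 0)" and ?\<eta> = "\<lambda>j \<omega>. 1 - indicator (\<Xi> \<omega>) ((x(1 := 0)) j) :: real"
    have "set_cumulant P \<Xi> k ?x = mixed_cumulant P k (\<lambda>j \<omega>. 1 - ?\<eta> j \<omega>)"
      by (simp add: set_cumulant_def)
    also have "\<dots> = (- 1) ^ k * complex_of_real (ursell (\<lambda>J. \<integral>\<omega>. (\<Prod>j\<in>J. ?\<eta> j \<omega>) \<partial>P) {k} {1..<k})"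
    proof (rule mixed_cumulant_one_minus[OF G.prob_space_axioms _ _ _ k])
      show "?\<eta> j \<in> borel_measurable P" for j unfolding assms(2) by (rule G.eta_measurable')
    qed (auto simp: indicator_def)
    also have "ursell (\<lambda>J. \<integral>\<omega>. (\<Prod>j\<in>J. ?\<eta> j \<omega>) \<partial>P) {k} {1..<k} = ursell (HM.rho ?x) {k} {1..<k}"
      using finite_subset[of _ "{k} \<union> {1..<k}"] G.prob_space by (intro ursell_cong rho_eq) auto
    also have "\<dots> = ursell (HM.rho ?x) {1} {2..k}"
    proof -
      have "ursell (HM.rho ?x) {k} (insert 1 {2..<k}) = ursell (HM.rho ?x) {1} (insert k {2..<k})"
        using k by (intro ursell_commute) auto
      moreover have "insert 1 {2..<k} = {1..<k}" "insert k {2..<k} = {2..k}" using k by auto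
      ultimately show ?thesis by simp
    qed
    also have "\<dots> = C.pinned 1 {2..k} x"
      unfolding C.pinned_def by (intro C.ursell_r_cong) (auto simp: override_on_def)
    finally show ?thesis by (simp only: norm_mult norm_power norm_minus_cancel norm_one power_one mult_1 norm_of_real)
  qed
  have part1: "integrable (PiM {2..k} (\<lambda>_. lborel)) (\<lambda>x. cmod (set_cumulant P \<Xi> k (x(1 := 0)))) \<and>
        (\<integral>x. cmod (set_cumulant P \<Xi> k (x(1 := 0))) \<partial>PiM {2..k} (\<lambda>_. lborel))
          \<le> fact (k - 1) * H * \<Delta> ^ (k - 2)" if k: "2 \<le> k" for k
  proof -
    have Y: "finite {2..k}" "1 \<notin> {2..k}" "{2..k} \<noteq> {}" "card {2..k} = k - 1" using k by auto
    have int: "integrable (PiM {2..k} (\<lambda>_. lborel)) (\<lambda>x. \<bar>C.pinned 1 {2..k} x\<bar>)"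
      using C.pinned_integrable(1)[OF Y(1,2)] by auto
    have "ennreal (\<integral>x. \<bar>C.pinned 1 {2..k} x\<bar> \<partial>PiM {2..k} (\<lambda>_. lborel)) \<le>
        ennreal ((exp g - 1) * (fact (k - 1) * b ^ (k - 1)))"
      using ursell_le[OF Y(1-3), of "\<lambda>_. 0"] int Y(4)
      by (subst nn_integral_eq_integral[symmetric]) (auto simp: C.pinned_def)
    then have "(\<integral>x. \<bar>C.pinned 1 {2..k} x\<bar> \<partial>PiM {2..k} (\<lambda>_. lborel)) \<le> (exp g - 1) * (fact (k - 1) * b ^ (k - 1))"
      using g b_pos by (subst (asm) ennreal_le_iff) auto
    \<comment> \<open>There are \<open>k - 1\<close> integrated points: one power of
      \<open>b\<close> goes into \<open>H\<close>, the remaining \<open>k - 2\<close> into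
      \<open>\<Delta>\<close>.\<close>
    also have "\<dots> = fact (k - 1) * ((exp g - 1) * b * b ^ (k - 2))"
    proof -
      have "k - 1 = Suc (k - 2)" using k by simp
      then have "b ^ (k - 1) = b * b ^ (k - 2)" by (metis power_Suc)
      then show ?thesis by simp
    qed
    also have "\<dots> \<le> fact (k - 1) * (H * \<Delta> ^ (k - 2))"
    proof -
      have "0 \<le> (exp g - 1) * b" using g b_pos by simp
      with H_ge have "0 \<le> H" by linarith
      then show ?thesis using H_ge b_le b_pos by (intro mult_left_mono mult_mono power_mono) auto
    qed
    finally show ?thesis unfolding cumulant[OF k] using int by (simp add: mult.assoc)
  qed
  have W': "compact (W n)" for n using W by (auto simp: convex_averaging_sequence_def)
  define logE where "logE n z = z * complex_of_real (measure lborel (W n)) +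
      eval_fps (Abs_fps (\<lambda>k. C.cumulant_coeff (C.window_cumulant_card (W n)) k / fact k)) z" for n z
  have branch: "log_branch_on {z. cmod z < 1 / \<Delta>}
      (\<lambda>z. \<integral>\<omega>. exp (z * complex_of_real (measure lborel (\<Xi> \<omega> \<inter> W n))) \<partial>P) (logE n)" for n
  proof -
    have "log_branch_on {z. cmod z < 1 / \<Delta>}
      (\<lambda>z. \<integral>\<omega>. exp (z * complex_of_real (measure lborel (W n) - G.vacant (W n) \<omega>)) \<partial>P) (logE n)"
      unfolding logE_def
    proof (rule C.window_log_branch[OF G.prob_space_axioms W' G.vacant_measurable[OF W']])
      show "0 \<le> G.vacant (W n) \<omega> \<and> G.vacant (W n) \<omega> \<le> measure lborel (W n)" if "\<omega> \<in> space P" for \<omega>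
        using G.vacant_eq[OF W' that] by simp
      show "C.corr_moment (W n) Y = (\<integral>\<omega>. G.vacant (W n) \<omega> ^ card Y \<partial>P)" if Y: "finite Y" for Y
        unfolding G.vacant_moment[OF W' Y, symmetric] C.corr_moment_def rho_eq[OF Y, unfolded assms(2), symmetric] ..
    qed
    moreover have "(\<integral>\<omega>. exp (z * complex_of_real (measure lborel (W n) - G.vacant (W n) \<omega>)) \<partial>P) =
        (\<integral>\<omega>. exp (z * complex_of_real (measure lborel (\<Xi> \<omega> \<inter> W n))) \<partial>P)" for z
      unfolding assms(2) by (intro Bochner_Integration.integral_cong refl) (simp add: G.vacant_eq(1)[OF W'])
    ultimately show ?thesis by simp
  qed
  have limit: "(\<lambda>n. logE n z / complex_of_real (measure lborel (W n))) \<longlonglongrightarrow>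
      z + eval_fps (Abs_fps (\<lambda>k. C.cumulant_coeff
        (\<lambda>c. \<integral>y. C.pinned 1 {2..c + 1} y \<partial>PiM {2..c + 1} (\<lambda>_. lborel)) k / fact k)) z"
    if "cmod z < 1 / \<Delta>" for z
    unfolding logE_def by (rule C.log_laplace_limit[OF W that])
  show ?thesis
    by (intro conjI exI allI impI) (use part1 in blast, use part1 in blast, rule branch, erule limit, rule C.limit_analytic)
qed

end
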